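(* Let $\beta\in[-1,1]\setminus\{0\}$, let $x,y\in\mathbb{R}$, and let $(B_t)_{t\ge 0}$ be a standard one-dimensional Brownian motion with $B_0=0$. Let $X^x$ and $X^y$ be the solutions, relative to the same Brownian motion $B$ and with the same $\beta$, of the equations $$X^x_t = x + B_t + \beta L^x_t,\qquad X^y_t = y + B_t + \beta L^y_t,\qquad t\ge 0,$$ where $L^x_t$ (respectively $L^y_t$) is the symmetric local time at $0$ of the process $X^x$ (respectively $X^y$) up to time $t$. Then, almost surely, there exists $t<\infty$ such that $X^x_t = X^y_t$.
   Context: For a fixed $\beta\in[-1,1]$ and $x\in\mathbb{R}$, the equation $X^x_t = x + B_t + \beta L^x_t$, $t\ge 0$, with $L^x_t$ the symmetric local time of $X^x$ at $0$, is known (Harrison and Shepp, 1981) to have a unique strong solution, called skew Brownian motion (started from $x$, driven by $B$). The symmetric local time at $0$ of a continuous semimartingale $X$ of this form (with quadratic variation $\langle X\rangle_t=t$) is the continuous nondecreasing process $$L_t=\lim_{\varepsilon\downarrow 0}\frac{1}{2\varepsilon}\int_0^t \mathbf{1}_{\{|X_s|<\varepsilon\}}\,ds ,$$ equivalently the average of the right and left semimartingale local times of $X$ at $0$. *)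

theory Defs
  imports "HOL-Probability.Probability"
begin

(* Time is the half-line t \<ge> 0 inside the type real; F, B, X and L are unconstrained at
   negative times, apart from F being a filtration indexed by the whole type. *)
locale brownian_motion = prob_space M + filtration "space M" F
  for M :: "'w measure" and F :: "real \<Rightarrow> 'w measure" +
  fixes B :: "real \<Rightarrow> 'w \<Rightarrow> real"
  assumes subalgebra_F: "\<And>t. 0 \<le> t \<Longrightarrow> subalgebra M (F t)"
    and adapted: "\<And>t. 0 \<le> t \<Longrightarrow> B t \<in> borel_measurable (F t)"
    and start: "AE \<omega> in M. B 0 \<omega> = 0"
    and continuous_paths: "AE \<omega> in M. continuous_on {0..} (\<lambda>t. B t \<omega>)"
    and normal_increments: "\<And>s t. 0 \<le> s \<Longrightarrow> s < t \<Longrightarrow>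
      distributed M lborel (\<lambda>\<omega>. B t \<omega> - B s \<omega>) (normal_density 0 (sqrt (t - s)))"
    and indep_increments: "\<And>s t. 0 \<le> s \<Longrightarrow> s < t \<Longrightarrow>
      indep_set (sets (F s)) {(\<lambda>\<omega>. B t \<omega> - B s \<omega>) -` A \<inter> space M | A. A \<in> sets borel}"

definition symmetric_local_time ::
    "'w measure \<Rightarrow> (real \<Rightarrow> 'w \<Rightarrow> real) \<Rightarrow> (real \<Rightarrow> 'w \<Rightarrow> real) \<Rightarrow> bool" where
  "symmetric_local_time M X L \<longleftrightarrow>
    (AE \<omega> in M.
      continuous_on {0..} (\<lambda>t. L t \<omega>) \<and>
      mono_on {0..} (\<lambda>t. L t \<omega>) \<and>
      (\<forall>t\<ge>0. ((\<lambda>\<epsilon>. 1 / (2 * \<epsilon>) * (LINT s:{0..t}|lborel. indicator {s. \<bar>X s \<omega>\<bar> < \<epsilon>} s))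
        \<longlongrightarrow> L t \<omega>) (at_right 0)))"

(* Adaptedness to a filtration for which B is a Brownian motion is part of the notion of
   solution; with F the (augmented) filtration of B this is the notion of strong solution. *)
definition skew_brownian_motion ::
    "'w measure \<Rightarrow> (real \<Rightarrow> 'w measure) \<Rightarrow> (real \<Rightarrow> 'w \<Rightarrow> real) \<Rightarrow> real \<Rightarrow> real \<Rightarrow>
      (real \<Rightarrow> 'w \<Rightarrow> real) \<Rightarrow> (real \<Rightarrow> 'w \<Rightarrow> real) \<Rightarrow> bool" where
  "skew_brownian_motion M F B \<beta> x X L \<longleftrightarrow>
    (\<forall>t\<ge>0. X t \<in> borel_measurable (F t)) \<and>
    (AE \<omega> in M. continuous_on {0..} (\<lambda>t. X t \<omega>)) \<and>
    symmetric_local_time M X L \<and>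
    (AE \<omega> in M. \<forall>t\<ge>0. X t \<omega> = x + B t \<omega> + \<beta> * L t \<omega>)"

end

theory Submission
  imports Defs
begin

text \<open>Take \<open>x < y\<close> and put \<open>D = Y - X\<close>, \<open>R = \<bar>Y\<bar> - \<bar>X\<bar>\<close>. By Tanaka's formula \<open>\<bar>X\<bar> - L\<^sup>x\<close> and
  \<open>\<bar>Y\<bar> - L\<^sup>y\<close> are martingales, so \<open>dR = dW + dD / \<beta>\<close> with a martingale \<open>W\<close>. Hence for every concave \<open>h\<close>
  the process \<open>h(D) - \<beta> h'(D) R\<close> has the drift \<open>- \<beta> h''(D) R dD\<close>, and since \<open>dD = \<beta> (dL\<^sup>y - dL\<^sup>x)\<close>,
  where \<open>R = D\<close> on the support of \<open>dL\<^sup>x\<close> and \<open>R = - D\<close> on that of \<open>dL\<^sup>y\<close> as long as \<open>D > 0\<close>, this drift is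
  \<open>\<beta>\<^sup>2 h''(D) D (dL\<^sup>x + dL\<^sup>y) \<le> 0\<close>. With \<open>h = \<surd>\<close> the nonnegative supermartingale so obtained controls
  \<open>\<integral> D\<^sup>-\<^sup>1\<^sup>/\<^sup>2 (dL\<^sup>x + dL\<^sup>y)\<close>. As \<open>D \<le> y - x + \<bar>\<beta>\<bar> (L\<^sup>x + L\<^sup>y)\<close>, the total local time is almost surely finite
  on the event that \<open>D\<close> never vanishes. But the local time of \<open>X\<close> is almost surely unbounded, because
  \<open>(1 + \<bar>X\<bar>) exp (- L\<^sup>x)\<close> is a supermartingale while \<open>\<bar>B\<^sub>t\<bar>\<close> tends to infinity in probability.

  Stochastic integrals are avoided by summing conditionally centred increments over time grids, and
  Tanaka's formula comes from smoothing \<open>\<bar>u\<bar>\<close> by functions whose second derivative is squeezed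
  between the indicators that define the local time.\<close>

section \<open>Time grids and Riemann sums\<close>

text \<open>The martingale property is available only against bounded adapted weights, whereas
  \<open>1 / (2 * sqrt D)\<close> blows up as \<open>D\<close> tends to 0. The Lyapunov process is
  therefore killed at the first grid time with \<open>D < d\<close>. It is nonnegative while
  \<open>D > 0\<close>, because \<open>\<bar>\<beta> * R\<bar> \<le> D\<close> leaves half of
  \<open>sqrt D\<close>, and the final estimate does not depend on \<open>d\<close>. The integral of
  \<open>1 / sqrt D\<close> against the local times is never formed. Its substitute is
  \<open>U = sqrt (y - x + \<bar>\<beta>\<bar> * (Lx + Ly))\<close>: as
  \<open>D \<le> U\<^sup>2\<close>, it grows at most like \<open>\<bar>\<beta>\<bar> / 2\<close>
  times that integral, and it still tends to infinity with the local times. So a multiple of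
  \<open>U\<close> may be added to the process and charged to the negative drift. In continuous time
  the drift rate is \<open>\<beta>\<^sup>2 / (4 * sqrt D)\<close>; the discrete steps keep
  \<open>\<beta>\<^sup>2 / (24 * sqrt D)\<close>, whence the factor
  \<open>\<bar>\<beta>\<bar> / 12\<close> in front of \<open>U\<close>. On a fixed path every step
  has nonpositive residual once the grid is fine enough, but how fine depends on the path. A crude
  bound by local time increments, divided by \<open>sqrt d\<close>, lets dominated convergence
  dispose of the remaining positive parts.\<close>

definition grid :: "real \<Rightarrow> real \<Rightarrow> nat \<Rightarrow> nat \<Rightarrow> real" where
  "grid s t n k = s + real k * ((t - s) / real n)"

lemma grid_0 [simp]: "grid s t n 0 = s"
  by (simp add: grid_def)

lemma grid_end [simp]: "0 < n \<Longrightarrow> grid s t n n = t"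
  by (simp add: grid_def)

lemma grid_Suc: "grid s t n (Suc k) = grid s t n k + (t - s) / real n"
  by (simp only: grid_def of_nat_Suc distrib_right mult_1)

lemma grid_mono: "s \<le> t \<Longrightarrow> j \<le> k \<Longrightarrow> grid s t n j \<le> grid s t n k"
  unfolding grid_def by (intro add_left_mono mult_right_mono) auto

lemma grid_ge: "s \<le> t \<Longrightarrow> s \<le> grid s t n k"
  using grid_mono[of s t 0 k n] by simp

lemma grid_le: "s \<le> t \<Longrightarrow> k \<le> n \<Longrightarrow> grid s t n k \<le> t"
  using grid_mono[of s t k n n] by (cases "n = 0") auto

lemma grid_less_Suc: "s < t \<Longrightarrow> 0 < n \<Longrightarrow> grid s t n k < grid s t n (Suc k)"
  by (simp add: grid_Suc)

lemma sum_grid_diff: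
  fixes g :: "real \<Rightarrow> real"
  assumes "0 < n"
  shows "(\<Sum>k<n. g (grid s t n (Suc k)) - g (grid s t n k)) = g t - g s"
  using assms by (subst sum_lessThan_telescope) simp

text \<open>Uniform continuity, once the mesh is below the modulus. Oscillation is measured from the
  left end of a cell because that is where adapted integrands are evaluated.\<close>

lemma eventually_grid_oscillation:
  fixes g :: "real \<Rightarrow> real"
  assumes "s \<le> t" and g: "continuous_on {s..t} g" and "0 < e"
  shows "\<forall>\<^sub>F n in sequentially. 0 < n \<and>
    (\<forall>k<n. \<forall>u\<in>{grid s t n k..grid s t n (Suc k)}. \<bar>g u - g (grid s t n k)\<bar> \<le> e)"
proof -
  have "uniformly_continuous_on {s..t} g"
    using g by (intro compact_uniformly_continuous) auto
  then obtain d where d: "0 < d"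
    "\<And>u v. u \<in> {s..t} \<Longrightarrow> v \<in> {s..t} \<Longrightarrow> dist v u < d \<Longrightarrow> dist (g v) (g u) < e"
    using \<open>0 < e\<close> unfolding uniformly_continuous_on_def by metis
  have "(\<lambda>n. (t - s) / real n) \<longlonglongrightarrow> 0"
    by (rule lim_const_over_n)
  then have "\<forall>\<^sub>F n in sequentially. (t - s) / real n < d"
    using d(1) by (rule order_tendstoD)
  with eventually_gt_at_top[of 0] show ?thesis
  proof eventually_elim
    case (elim n)
    have "\<bar>g u - g (grid s t n k)\<bar> \<le> e"
      if "k < n" "u \<in> {grid s t n k..grid s t n (Suc k)}" for k u
    proof -
      have "s \<le> grid s t n k" "grid s t n (Suc k) \<le> t"
        using that assms by (auto intro: grid_ge grid_le)
      then have "dist (g u) (g (grid s t n k)) < e"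
        using that elim by (intro d(2)) (auto simp: dist_real_def grid_Suc)
      then show ?thesis by (simp add: dist_real_def)
    qed
    then show ?case using elim by blast
  qed
qed

text \<open>Cell by cell the sum is compared with increments of the antiderivative \<open>G\<close>
  through the mean value theorem. These sums will be the second order term of Ito's formula.\<close>

lemma riemann_sums_tendsto:
  fixes g :: "real \<Rightarrow> real"
  assumes st: "s \<le> t" and g: "continuous_on {s..t} g"
  shows "(\<lambda>n. \<Sum>k<n. g (grid s t n k) * ((t - s) / real n)) \<longlonglongrightarrow> integral {s..t} g"
proof (rule tendstoI)
  fix e :: real assume "0 < e"
  \<comment> \<open>The summand 1 keeps the denominator positive when \<open>s = t\<close>;
    \<open>e'\<close> is the oscillation that keeps the total error within
    \<open>e / 2\<close>.\<close>
  define c where "c = t - s + 1"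
  define e' where "e' = e / (2 * c)"
  have c: "0 < c" "t - s \<le> c" using st by (auto simp: c_def)
  have e': "0 < e'" "e' * (t - s) < e"
  proof -
    show "0 < e'" using \<open>0 < e\<close> c by (simp add: e'_def)
    have "e' * (t - s) \<le> e' * c" using \<open>0 < e'\<close> c by simp
    also have "\<dots> = e / 2" using c by (simp add: e'_def)
    finally show "e' * (t - s) < e" using \<open>0 < e\<close> by simp
  qed
  define G where "G u = integral {s..u} g" for u
  have G: "(G has_real_derivative g u) (at u within {s..t})" if "u \<in> {s..t}" for u
    unfolding G_def using that g by (intro integral_has_real_derivative)
  show "\<forall>\<^sub>F n in sequentially.
      dist (\<Sum>k<n. g (grid s t n k) * ((t - s) / real n)) (integral {s..t} g) < e"
    using eventually_grid_oscillation[OF st g e'(1)]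
  proof eventually_elim
    case (elim n)
    let ?h = "(t - s) / real n"
    have "\<bar>g (grid s t n k) * ?h - (G (grid s t n (Suc k)) - G (grid s t n k))\<bar> \<le> e' * ?h"
      if "k < n" for k
    proof (cases "s < t")
      case True
      let ?a = "grid s t n k" and ?b = "grid s t n (Suc k)"
      have ab: "?a < ?b" "s \<le> ?a" "?b \<le> t"
        using that True elim by (auto intro: grid_less_Suc grid_ge grid_le)
      have "(G has_derivative (\<lambda>y. g u * y)) (at u within {?a..?b})" if "?a \<le> u" "u \<le> ?b" for u
      proof -
        have "(G has_real_derivative g u) (at u within {?a..?b})"
          by (rule DERIV_subset[OF G]) (use that ab in auto)
        then show ?thesis by (simp add: has_field_derivative_def)
      qed
      from mvt_simple[OF ab(1) this] obtain \<xi>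
        where \<xi>: "\<xi> \<in> {?a<..<?b}" "G ?b - G ?a = ?h * g \<xi>"
        by (auto simp: grid_Suc mult.commute)
      have "\<bar>g \<xi> - g ?a\<bar> \<le> e'" using elim that \<xi>(1) by auto
      then have "\<bar>g \<xi> - g ?a\<bar> * ?h \<le> e' * ?h" using True by (intro mult_right_mono) auto
      also have "\<bar>g \<xi> - g ?a\<bar> * ?h = \<bar>(g ?a - g \<xi>) * ?h\<bar>"
        using True by (simp only: abs_mult abs_minus_commute[of "g ?a"]) simp
      also have "(g ?a - g \<xi>) * ?h = g ?a * ?h - (G ?b - G ?a)"
        unfolding \<xi>(2) by (simp only: left_diff_distrib mult.commute[of ?h])
      finally show ?thesis .
    qed (use st in \<open>simp add: grid_def\<close>)
    then have "(\<Sum>k<n. \<bar>g (grid s t n k) * ?h - (G (grid s t n (Suc k)) - G (grid s t n k))\<bar>)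
        \<le> (\<Sum>k<n. e' * ?h)"
      by (intro sum_mono) auto
    also have "(\<Sum>k<n. e' * ?h) = e' * (t - s)" using elim by simp
    finally have "\<bar>\<Sum>k<n. g (grid s t n k) * ?h - (G (grid s t n (Suc k)) - G (grid s t n k))\<bar>
        \<le> e' * (t - s)"
      by (rule order_trans[OF sum_abs])
    moreover have "(\<Sum>k<n. G (grid s t n (Suc k)) - G (grid s t n k)) = integral {s..t} g"
      using elim by (subst sum_grid_diff) (auto simp: G_def)
    ultimately show ?case using e' by (simp add: dist_real_def sum_subtractf)
  qed
qed

section \<open>Occupation times and local time\<close>

lemma occupation_measurable:
  fixes X :: "real \<Rightarrow> real"
  assumes "continuous_on {0..} X" "0 \<le> s"
  shows "{s..t} \<inter> {u. \<bar>X u\<bar> < e} \<in> sets borel"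
proof -
  have "continuous_on {s..t} (\<lambda>u. \<bar>X u\<bar>)"
    using assms by (intro continuous_intros continuous_on_subset[OF assms(1)]) auto
  then have "(\<lambda>u. indicator {s..t} u *\<^sub>R \<bar>X u\<bar>) \<in> borel_measurable borel"
    by (rule borel_measurable_continuous_on_indicator[rotated]) auto
  then have "{u \<in> space borel. indicator {s..t} u *\<^sub>R \<bar>X u\<bar> < e} \<inter> {s..t} \<in> sets borel"
    by measurable
  also have "{u \<in> space borel. indicator {s..t} u *\<^sub>R \<bar>X u\<bar> < e} \<inter> {s..t} =
      {s..t} \<inter> {u. \<bar>X u\<bar> < e}"
    by (auto simp: indicator_def)
  finally show ?thesis .
qed

lemma occupation_eq_measure:
  fixes X :: "real \<Rightarrow> real"
  shows "(LINT u:{s..t}|lborel. indicator {u. \<bar>X u\<bar> < e} u) =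
    measure lborel ({s..t} \<inter> {u. \<bar>X u\<bar> < e})"
proof -
  have "(LINT u:{s..t}|lborel. indicator {u. \<bar>X u\<bar> < e} u) =
      (LINT u|lborel. indicator ({s..t} \<inter> {u. \<bar>X u\<bar> < e}) u :: real)"
    unfolding set_lebesgue_integral_def
    by (intro Bochner_Integration.integral_cong) (auto simp: indicator_def)
  then show ?thesis by simp
qed

lemma occupation_split:
  fixes X :: "real \<Rightarrow> real"
  assumes X: "continuous_on {0..} X" and st: "0 \<le> s" "s \<le> t"
  shows "measure lborel ({0..t} \<inter> {u. \<bar>X u\<bar> < e}) =
    measure lborel ({0..s} \<inter> {u. \<bar>X u\<bar> < e}) + measure lborel ({s..t} \<inter> {u. \<bar>X u\<bar> < e})"
proof -
  let ?A = "{0..s} \<inter> {u. \<bar>X u\<bar> < e}" and ?B = "{s..t} \<inter> {u. \<bar>X u\<bar> < e}"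
  have [measurable]: "?A \<in> sets borel" "?B \<in> sets borel"
    using st by (auto intro!: occupation_measurable[OF X])
  have fin: "emeasure lborel ?A \<noteq> \<infinity>" "emeasure lborel ?B \<noteq> \<infinity>"
  proof -
    have "emeasure lborel ?A \<le> emeasure lborel {0..s}" "emeasure lborel ?B \<le> emeasure lborel {s..t}"
      by (auto intro!: emeasure_mono)
    then show "emeasure lborel ?A \<noteq> \<infinity>" "emeasure lborel ?B \<noteq> \<infinity>"
      using st by (auto simp: top_unique)
  qed
  have "?A \<inter> ?B \<subseteq> {s}" by auto
  then have "finite (?A \<inter> ?B)" by (rule finite_subset) simp
  then have "?A \<inter> ?B \<in> null_sets lborel" by (rule finite_imp_null_set_lborel)
  then have "measure lborel (?A \<inter> ?B) = 0"
    by (simp add: measure_def null_setsD1)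
  moreover have "measure lborel (?A \<union> ?B) = measure lborel ?A + measure lborel ?B - measure lborel (?A \<inter> ?B)"
    using fin by (intro measure_Un3) (auto simp: fmeasurable_def top.not_eq_extremum)
  moreover have "?A \<union> ?B = {0..t} \<inter> {u. \<bar>X u\<bar> < e}"
    using st by auto
  ultimately show ?thesis by simp
qed

text \<open>The limit clause of \<open>symmetric_local_time\<close> for a single path, with the
  Lebesgue integral rewritten as the measure of an occupation set.\<close>

definition occupation_limit :: "(real \<Rightarrow> real) \<Rightarrow> (real \<Rightarrow> real) \<Rightarrow> bool" where
  "occupation_limit X L \<longleftrightarrow>
    (\<forall>t\<ge>0. ((\<lambda>e. measure lborel ({0..t} \<inter> {u. \<bar>X u\<bar> < e}) / (2 * e)) \<longlongrightarrow> L t) (at_right 0))"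

lemma occupation_limit_zero:
  assumes "occupation_limit X L"
  shows "L 0 = 0"
proof -
  have "((\<lambda>e. measure lborel ({0..0} \<inter> {u. \<bar>X u\<bar> < e}) / (2 * e)) \<longlongrightarrow> L 0) (at_right 0)"
    using assms by (auto simp: occupation_limit_def)
  moreover have "measure lborel ({0..0} \<inter> {u. \<bar>X u\<bar> < e}) = 0" for e
  proof -
    have "{0..0} \<inter> {u. \<bar>X u\<bar> < e} \<in> null_sets lborel"
      by (intro finite_imp_null_set_lborel) auto
    then show ?thesis by (simp add: measure_def null_setsD1)
  qed
  ultimately have "((\<lambda>e::real. 0) \<longlongrightarrow> L 0) (at_right 0)" by simp
  then show ?thesis
    by (metis tendsto_const tendsto_unique trivial_limit_at_right_real)
qed

lemma occupation_limit_diff: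
  fixes X :: "real \<Rightarrow> real"
  assumes "occupation_limit X L" "continuous_on {0..} X" "0 \<le> s" "s \<le> t"
  shows "((\<lambda>e. measure lborel ({s..t} \<inter> {u. \<bar>X u\<bar> < e}) / (2 * e)) \<longlongrightarrow> L t - L s) (at_right 0)"
proof -
  have "((\<lambda>e. measure lborel ({0..t} \<inter> {u. \<bar>X u\<bar> < e}) / (2 * e)
      - measure lborel ({0..s} \<inter> {u. \<bar>X u\<bar> < e}) / (2 * e)) \<longlongrightarrow> L t - L s) (at_right 0)"
    using assms by (intro tendsto_diff) (auto simp: occupation_limit_def)
  then show ?thesis
    using occupation_split[OF assms(2-4)] by (simp add: diff_divide_distrib[symmetric])
qed

text \<open>By compactness \<open>\<bar>X\<bar>\<close> has a positive minimum on the interval, so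
  the occupation sets are empty for small \<open>e\<close>. Used mostly in contrapositive form:
  where the local time grows there is a zero.\<close>

lemma local_time_flat:
  fixes X :: "real \<Rightarrow> real"
  assumes L: "occupation_limit X L" and X: "continuous_on {0..} X" and st: "0 \<le> s" "s \<le> t"
    and nz: "\<And>u. u \<in> {s..t} \<Longrightarrow> X u \<noteq> 0"
  shows "L s = L t"
proof -
  have "continuous_on {s..t} (\<lambda>u. \<bar>X u\<bar>)"
    using st by (intro continuous_intros continuous_on_subset[OF X]) auto
  then obtain v where v: "v \<in> {s..t}" "\<And>u. u \<in> {s..t} \<Longrightarrow> \<bar>X v\<bar> \<le> \<bar>X u\<bar>"
    using continuous_attains_inf[of "{s..t}" "\<lambda>u. \<bar>X u\<bar>"] st by auto
  have "\<forall>\<^sub>F e in at_right 0. e \<in> {0<..<\<bar>X v\<bar>}"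
    using nz[OF v(1)] by (intro eventually_at_right_field[THEN iffD2] exI[of _ "\<bar>X v\<bar>"]) auto
  then have "\<forall>\<^sub>F e in at_right 0. measure lborel ({s..t} \<inter> {u. \<bar>X u\<bar> < e}) / (2 * e) = 0"
  proof eventually_elim
    case (elim e)
    then have "{s..t} \<inter> {u. \<bar>X u\<bar> < e} = {}" using v(2) by fastforce
    then show ?case by simp
  qed
  then have "((\<lambda>e. measure lborel ({s..t} \<inter> {u. \<bar>X u\<bar> < e}) / (2 * e)) \<longlongrightarrow> 0) (at_right 0)"
    by (rule tendsto_eventually)
  with occupation_limit_diff[OF L X st] have "L t - L s = 0"
    using tendsto_unique trivial_limit_at_right_real by blast
  then show ?thesis by simp
qed

lemma grid_cell:
  assumes "0 < n" "s \<le> u" "u \<le> t"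
  shows "\<exists>k<n. u \<in> {grid s t n k..grid s t n (Suc k)}"
proof -
  have "u \<le> grid s t n j \<Longrightarrow> 0 < j \<Longrightarrow> \<exists>k<j. u \<in> {grid s t n k..grid s t n (Suc k)}" for j
  proof (induction j)
    case (Suc j)
    show ?case
    proof (cases "u \<le> grid s t n j \<and> 0 < j")
      case True
      then show ?thesis using Suc.IH less_SucI by blast
    next
      case False
      then have "grid s t n j \<le> u" using assms by (cases j) auto
      then show ?thesis using Suc.prems by auto
    qed
  qed simp
  from this[of n] show ?thesis using assms by simp
qed

text \<open>At the last zero \<open>u\<close> of \<open>X\<close> before \<open>t\<close> the
  equation reads \<open>\<beta> * L u = - (x + B u)\<close>, and \<open>L\<close> does not grow
  after \<open>u\<close>. This is the one source of integrability for the local time: it reduces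
  \<open>L\<close> to the running maximum of \<open>\<bar>B\<bar>\<close>.\<close>

lemma local_time_bound:
  fixes X B L :: "real \<Rightarrow> real"
  assumes occ: "occupation_limit X L" and X: "continuous_on {0..} X" and L: "continuous_on {0..} L"
    and eq: "\<And>u. 0 \<le> u \<Longrightarrow> X u = x + B u + \<beta> * L u" and t: "0 \<le> t"
  shows "\<exists>u\<in>{0..t}. \<bar>\<beta> * L t\<bar> \<le> \<bar>x + B u\<bar>"
proof (cases "L t = 0")
  case True
  then show ?thesis using t by (intro bexI[of _ 0]) auto
next
  case False
  define Z where "Z = {u \<in> {0..t}. X u = 0}"
  have "Z \<noteq> {}"
    using local_time_flat[OF occ X, of 0 t] t False occupation_limit_zero[OF occ] by (auto simp: Z_def)
  moreover have "closed Z"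
    unfolding Z_def
    by (intro continuous_closed_preimage_constant continuous_on_subset[OF X]) auto
  then have "compact Z"
    unfolding compact_eq_bounded_closed
    by (auto simp: Z_def intro: bounded_subset[of "{0..t}"])
  ultimately obtain u where u: "u \<in> Z" "\<And>v. v \<in> Z \<Longrightarrow> v \<le> u"
    using compact_attains_sup by metis
  then have u0: "0 \<le> u" "u \<le> t" "X u = 0" by (auto simp: Z_def)
  \<comment> \<open>Flatness does not apply on \<open>{u..t}\<close>, since \<open>X u = 0\<close>.
    It holds on \<open>{v..t}\<close> for every \<open>v > u\<close>, and continuity of
    \<open>L\<close> reaches \<open>u\<close>.\<close>
  have "L u = L t"
  proof (cases "u < t")
    case True
    have "L v = L t" if "v \<in> {u<..t}" for v
    proof (rule local_time_flat[OF occ X])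
      fix w assume "w \<in> {v..t}"
      then show "X w \<noteq> 0" using u(2)[of w] that u0 by (auto simp: Z_def)
    qed (use that u0 in auto)
    moreover have "continuous_on (closure {u<..t}) L"
      using True u0 by (auto intro: continuous_on_subset[OF L])
    moreover have "u \<in> closure {u<..t}" using True by simp
    ultimately show ?thesis
      using continuous_constant_on_closure by blast
  qed (use u0 in simp)
  then have "\<beta> * L t = - (x + B u)" using eq[of u] u0 by simp
  then show ?thesis using u0 by (intro bexI[of _ u]) auto
qed

section \<open>Smoothing the absolute value\<close>

text \<open>With the next lemma this gives two successive antiderivatives of the absolute value, so
  that \<open>smooth_abs\<close>, \<open>smooth_sgn\<close> and \<open>trapezoid\<close> share one
  closed form and differentiate into each other. Only \<open>v = 0\<close> needs a difference
  quotient.\<close>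

lemma has_real_derivative_abs_sq: "((\<lambda>v. v * \<bar>v\<bar> / 2) has_real_derivative \<bar>v\<bar>) (at v)"
  for v :: real
proof (cases v "0 :: real" rule: linorder_cases)
  case less
  have "((\<lambda>v. - (v * v) / 2) has_real_derivative \<bar>v\<bar>) (at v)"
    using less by (auto intro!: derivative_eq_intros)
  then show ?thesis
    by (rule has_field_derivative_transform_within_open[of _ _ _ "{..<0}"]) (use less in auto)
next
  case greater
  have "((\<lambda>v. (v * v) / 2) has_real_derivative \<bar>v\<bar>) (at v)"
    using greater by (auto intro!: derivative_eq_intros)
  then show ?thesis
    by (rule has_field_derivative_transform_within_open[of _ _ _ "{0<..}"]) (use greater in auto)
next
  case equal
  have "(\<lambda>h::real. \<bar>h\<bar> / 2) \<midarrow>0\<rightarrow> 0" by (auto intro!: tendsto_eq_intros)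
  then have "(\<lambda>h::real. (h * \<bar>h\<bar> / 2) / h) \<midarrow>0\<rightarrow> 0"
    by (rule Lim_transform_eventually) (auto simp: eventually_at_filter)
  then show ?thesis using equal by (simp add: DERIV_def)
qed

lemma has_real_derivative_abs_cube:
  "((\<lambda>v. \<bar>v\<bar> ^ 3 / 6) has_real_derivative v * \<bar>v\<bar> / 2) (at v)" for v :: real
proof (cases v "0 :: real" rule: linorder_cases)
  case less
  have "((\<lambda>v. - (v ^ 3) / 6) has_real_derivative v * \<bar>v\<bar> / 2) (at v)"
    using less by (auto intro!: derivative_eq_intros simp: power2_eq_square)
  then show ?thesis
    by (rule has_field_derivative_transform_within_open[of _ _ _ "{..<0}"])
      (use less in \<open>auto simp: power3_eq_cube\<close>)
next
  case greater
  have "((\<lambda>v. (v ^ 3) / 6) has_real_derivative v * \<bar>v\<bar> / 2) (at v)"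
    using greater by (auto intro!: derivative_eq_intros simp: power2_eq_square)
  then show ?thesis
    by (rule has_field_derivative_transform_within_open[of _ _ _ "{0<..}"]) (use greater in auto)
next
  case equal
  have "(\<lambda>h::real. h * \<bar>h\<bar> / 6) \<midarrow>0\<rightarrow> 0" by (auto intro!: tendsto_eq_intros)
  then have "(\<lambda>h::real. (\<bar>h\<bar> ^ 3 / 6) / h) \<midarrow>0\<rightarrow> 0"
  proof (rule Lim_transform_eventually)
    show "\<forall>\<^sub>F h in at (0::real). h * \<bar>h\<bar> / 6 = \<bar>h\<bar> ^ 3 / 6 / h"
      by (auto simp: eventually_at_filter power3_eq_cube abs_mult_self_eq field_simps abs_if)
  qed
  then show ?thesis using equal by (simp add: DERIV_def)
qed

text \<open>The second derivative is a trapezoid of mass 2, constant on \<open>[-a, a]\<close> and supported on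
  \<open>[-b, b]\<close>; this is why the function agrees with the absolute value outside \<open>[-b, b]\<close>.\<close>

definition smooth_abs :: "real \<Rightarrow> real \<Rightarrow> real \<Rightarrow> real" where
  "smooth_abs a b u =
    (\<bar>u + b\<bar> ^ 3 / 6 - \<bar>u + a\<bar> ^ 3 / 6 - \<bar>u - a\<bar> ^ 3 / 6 + \<bar>u - b\<bar> ^ 3 / 6) / ((b - a) * (a + b))"

definition smooth_sgn :: "real \<Rightarrow> real \<Rightarrow> real \<Rightarrow> real" where
  "smooth_sgn a b u =
    ((u + b) * \<bar>u + b\<bar> / 2 - (u + a) * \<bar>u + a\<bar> / 2 - (u - a) * \<bar>u - a\<bar> / 2 + (u - b) * \<bar>u - b\<bar> / 2)
      / ((b - a) * (a + b))"

definition trapezoid :: "real \<Rightarrow> real \<Rightarrow> real \<Rightarrow> real" where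
  "trapezoid a b u = (\<bar>u + b\<bar> - \<bar>u + a\<bar> - \<bar>u - a\<bar> + \<bar>u - b\<bar>) / ((b - a) * (a + b))"

lemma continuous_on_trapezoid [continuous_intros]:
  "continuous_on S f \<Longrightarrow> continuous_on S (\<lambda>u. trapezoid a b (f u))"
  unfolding trapezoid_def divide_inverse
  by (intro continuous_on_mult_right continuous_on_add continuous_on_diff continuous_on_rabs continuous_on_const)

lemma DERIV_smooth_abs: "(smooth_abs a b has_real_derivative smooth_sgn a b u) (at u)"
  unfolding smooth_abs_def[abs_def] smooth_sgn_def
  by (intro DERIV_cdivide DERIV_add DERIV_diff
      DERIV_chain2[OF has_real_derivative_abs_cube, where s=UNIV and Db=1, simplified])
     (auto intro!: derivative_eq_intros)

lemma DERIV_smooth_sgn: "(smooth_sgn a b has_real_derivative trapezoid a b u) (at u)"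
  unfolding trapezoid_def smooth_sgn_def[abs_def]
  by (intro DERIV_cdivide DERIV_add DERIV_diff
      DERIV_chain2[OF has_real_derivative_abs_sq, where s=UNIV and Db=1, simplified])
     (auto intro!: derivative_eq_intros)

context
  fixes a b :: real
  assumes ab: "0 < a" "a < b"
begin

lemma trapezoid_inner: "\<bar>u\<bar> \<le> a \<Longrightarrow> trapezoid a b u = 2 / (a + b)"
proof -
  assume "\<bar>u\<bar> \<le> a"
  then have num: "\<bar>u + b\<bar> - \<bar>u + a\<bar> - \<bar>u - a\<bar> + \<bar>u - b\<bar> = (b - a) * 2"
    using ab abs_of_nonneg[of "u + b"] abs_of_nonneg[of "u + a"] abs_of_nonpos[of "u - a"]
      abs_of_nonpos[of "u - b"] by (simp add: abs_le_iff)
  show ?thesis using ab unfolding trapezoid_def num by (simp del: left_diff_distrib_numeral)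
qed

lemma trapezoid_outer: "b \<le> \<bar>u\<bar> \<Longrightarrow> trapezoid a b u = 0"
proof -
  assume "b \<le> \<bar>u\<bar>"
  then have num: "\<bar>u + b\<bar> - \<bar>u + a\<bar> - \<bar>u - a\<bar> + \<bar>u - b\<bar> = 0"
    using ab by linarith
  show ?thesis unfolding trapezoid_def num by simp
qed

lemma trapezoid_bounds: "0 \<le> trapezoid a b u" "trapezoid a b u \<le> 2 / (a + b)"
proof -
  let ?n = "\<bar>u + b\<bar> - \<bar>u + a\<bar> - \<bar>u - a\<bar> + \<bar>u - b\<bar>"
  have n: "0 \<le> ?n" "?n \<le> (b - a) * 2" using ab by (auto simp: abs_if)
  show "0 \<le> trapezoid a b u" using ab n(1) unfolding trapezoid_def by auto
  have "trapezoid a b u \<le> ((b - a) * 2) / ((b - a) * (a + b))"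
    unfolding trapezoid_def using n ab by (intro divide_right_mono) auto
  also have "\<dots> = 2 / (a + b)" using ab by (simp del: left_diff_distrib_numeral)
  finally show "trapezoid a b u \<le> 2 / (a + b)" .
qed

text \<open>The numerator is a signed sum of four 1-Lipschitz functions, whence the 4. That the
  constant blows up as \<open>b - a\<close> tends to 0 is harmless: the grid is refined before the
  smoothing is removed.\<close>

lemma trapezoid_lipschitz:
  "\<bar>trapezoid a b u - trapezoid a b v\<bar> \<le> 4 / ((b - a) * (a + b)) * \<bar>u - v\<bar>"
proof -
  let ?n = "\<lambda>u. \<bar>u + b\<bar> - \<bar>u + a\<bar> - \<bar>u - a\<bar> + \<bar>u - b\<bar>"
  have "\<bar>(p1 - p2 - p3 + p4) - (q1 - q2 - q3 + q4)\<bar> \<le> 4 * d"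
    if "\<bar>p1 - q1\<bar> \<le> d" "\<bar>p2 - q2\<bar> \<le> d" "\<bar>p3 - q3\<bar> \<le> d" "\<bar>p4 - q4\<bar> \<le> d"
    for p1 p2 p3 p4 q1 q2 q3 q4 d :: real
    using that unfolding abs_le_iff by linarith
  then have key: "\<bar>?n u - ?n v\<bar> \<le> 4 * \<bar>u - v\<bar>"
    using abs_triangle_ineq3[of "u + b" "v + b"] abs_triangle_ineq3[of "u + a" "v + a"]
      abs_triangle_ineq3[of "u - a" "v - a"] abs_triangle_ineq3[of "u - b" "v - b"]
    by simp
  have eq: "\<bar>trapezoid a b u - trapezoid a b v\<bar> = \<bar>?n u - ?n v\<bar> / ((b - a) * (a + b))"
    unfolding trapezoid_def using ab by (simp add: diff_divide_distrib[symmetric])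
  have "\<bar>trapezoid a b u - trapezoid a b v\<bar> \<le> (4 * \<bar>u - v\<bar>) / ((b - a) * (a + b))"
    unfolding eq by (rule divide_right_mono[OF key]) (use ab in simp)
  then show ?thesis by simp
qed

lemma smooth_sgn_0: "smooth_sgn a b 0 = 0"
  using ab by (simp add: smooth_sgn_def)

lemma smooth_sgn_outer:
  "b \<le> u \<Longrightarrow> smooth_sgn a b u = 1" "u \<le> - b \<Longrightarrow> smooth_sgn a b u = - 1"
proof -
  have nz: "(b - a) * (a + b) \<noteq> 0" using ab by auto
  assume "b \<le> u"
  then show "smooth_sgn a b u = 1"
    using ab nz unfolding smooth_sgn_def by (simp add: nonzero_divide_eq_eq) (simp add: field_simps)
next
  have nz: "(b - a) * (a + b) \<noteq> 0" using ab by auto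
  assume "u \<le> - b"
  then show "smooth_sgn a b u = - 1"
    using ab nz unfolding smooth_sgn_def by (simp add: nonzero_divide_eq_eq) (simp add: field_simps)
qed

lemma smooth_sgn_mono: "u \<le> v \<Longrightarrow> smooth_sgn a b u \<le> smooth_sgn a b v"
  using DERIV_smooth_sgn trapezoid_bounds(1) DERIV_nonneg_imp_nondecreasing[of u v "smooth_sgn a b"]
  by blast

lemma smooth_sgn_bound: "\<bar>smooth_sgn a b u\<bar> \<le> 1"
proof -
  have "smooth_sgn a b u \<le> smooth_sgn a b (max u b)" "smooth_sgn a b (min u (-b)) \<le> smooth_sgn a b u"
    by (auto intro: smooth_sgn_mono)
  then show ?thesis by (simp add: smooth_sgn_outer abs_le_iff)
qed

lemma smooth_sgn_le: "\<bar>smooth_sgn a b u\<bar> \<le> 2 / (a + b) * \<bar>u\<bar>"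
proof -
  have "norm (smooth_sgn a b u - smooth_sgn a b 0) \<le> 2 / (a + b) * norm (u - 0)"
    by (rule field_differentiable_bound[of UNIV _ "trapezoid a b"])
       (use trapezoid_bounds DERIV_smooth_sgn in auto)
  then show ?thesis by (simp add: smooth_sgn_0)
qed

lemma smooth_abs_lipschitz: "\<bar>smooth_abs a b u - smooth_abs a b v\<bar> \<le> \<bar>u - v\<bar>"
proof -
  have "norm (smooth_abs a b u - smooth_abs a b v) \<le> 1 * norm (u - v)"
    by (rule field_differentiable_bound[of UNIV _ "smooth_sgn a b"])
       (use smooth_sgn_bound DERIV_smooth_abs in auto)
  then show ?thesis by simp
qed

lemma smooth_abs_outer: "b \<le> \<bar>u\<bar> \<Longrightarrow> smooth_abs a b u = \<bar>u\<bar>"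
proof -
  have nz: "(b - a) * (a + b) \<noteq> 0" using ab by auto
  assume "b \<le> \<bar>u\<bar>"
  then consider "b \<le> u" | "u \<le> - b" by linarith
  then show ?thesis
  proof cases
    case 1
    then show ?thesis
      using ab nz unfolding smooth_abs_def
      by (simp add: nonzero_divide_eq_eq) (simp add: power3_eq_cube field_simps)
  next
    case 2
    then have "\<bar>u + b\<bar> = - u - b" "\<bar>u + a\<bar> = - u - a" "\<bar>u - a\<bar> = a - u" "\<bar>u - b\<bar> = b - u" "\<bar>u\<bar> = - u"
      using ab by auto
    then show ?thesis
      using nz unfolding smooth_abs_def
      by (simp add: nonzero_divide_eq_eq) (simp add: power3_eq_cube field_simps)
  qed
qed

lemma smooth_abs_near_abs: "\<bar>smooth_abs a b u - \<bar>u\<bar>\<bar> \<le> 2 * b"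
proof (cases "b \<le> \<bar>u\<bar>")
  case False
  have "\<bar>smooth_abs a b u - smooth_abs a b b\<bar> \<le> \<bar>u - b\<bar>" by (rule smooth_abs_lipschitz)
  moreover have "smooth_abs a b b = b" using ab by (simp add: smooth_abs_outer)
  ultimately show ?thesis using False by linarith
qed (use ab in \<open>simp add: smooth_abs_outer\<close>)

end

lemma has_integral_indicator_Icc:
  fixes A :: "real set"
  assumes "A \<in> sets borel" "A \<subseteq> {s..t}"
  shows "((\<lambda>u. c * indicator A u) has_integral c * measure lborel A) {s..t}"
proof -
  have "emeasure lborel A \<le> emeasure lborel {s..t}" using assms by (intro emeasure_mono) auto
  also have "\<dots> < \<infinity>" by (cases "s \<le> t") auto
  finally have "((\<lambda>u. 1::real) has_integral measure lborel A) A"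
    using assms by (intro has_integral_measure_lborel) auto
  then have "((\<lambda>u. if u \<in> A then 1 else 0::real) has_integral measure lborel A) {s..t}"
    using has_integral_restrict[OF assms(2), of "\<lambda>u. 1 :: real"] by simp
  then have "((\<lambda>u. c * (if u \<in> A then 1 else 0::real)) has_integral c * measure lborel A) {s..t}"
    by (rule has_integral_mult_right)
  then show ?thesis by (simp add: indicator_def of_bool_def)
qed

text \<open>Half the trapezoid lies between \<open>1 / (a + b)\<close> times the indicators of
  \<open>\<bar>X\<bar> < a\<close> and of \<open>\<bar>X\<bar> < b\<close>. For \<open>a = e\<close>
  and \<open>b = e + e\<^sup>2\<close> the ratio \<open>b / a\<close> tends to 1 while
  \<open>a < b\<close> stays strict, so both bounds have the limit that defines the local
  time.\<close>

lemma trapezoid_integral_tendsto: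
  fixes X L :: "real \<Rightarrow> real"
  assumes L: "occupation_limit X L" and X: "continuous_on {0..} X" and st: "0 \<le> s" "s \<le> t"
  shows "((\<lambda>e. integral {s..t} (\<lambda>u. trapezoid e (e + e\<^sup>2) (X u) / 2)) \<longlongrightarrow> L t - L s) (at_right 0)"
proof (rule tendsto_sandwich)
  let ?m = "\<lambda>e. measure lborel ({s..t} \<inter> {u. \<bar>X u\<bar> < e})"
  note lim = occupation_limit_diff[OF L X st]
  have pos: "\<forall>\<^sub>F e in at_right (0::real). 0 < e"
    by (simp add: eventually_at_right_less)
  have b: "LIM e at_right (0::real). e + e\<^sup>2 :> at_right 0"
    unfolding filterlim_at
  proof
    show "\<forall>\<^sub>F e::real in at_right 0. e + e\<^sup>2 \<in> {0<..} \<and> e + e\<^sup>2 \<noteq> 0"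
      using pos
    proof eventually_elim
      case (elim e)
      then have "0 < e + e\<^sup>2" by (intro add_pos_pos) auto
      then show ?case by simp
    qed
  qed (auto intro!: tendsto_eq_intros)
  have "((\<lambda>e::real. 2 / (2 + e) * (?m e / (2 * e))) \<longlongrightarrow> 2 / (2 + 0) * (L t - L s)) (at_right 0)"
    by (intro tendsto_intros lim) auto
  then show "((\<lambda>e::real. 2 / (2 + e) * (?m e / (2 * e))) \<longlongrightarrow> L t - L s) (at_right 0)" by simp
  have "((\<lambda>e::real. (2 * (1 + e)) / (2 + e) * (?m (e + e\<^sup>2) / (2 * (e + e\<^sup>2)))) \<longlongrightarrow>
      (2 * (1 + 0)) / (2 + 0) * (L t - L s)) (at_right 0)"
    by (intro tendsto_intros filterlim_compose[OF lim b]) auto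
  then show "((\<lambda>e::real. (2 * (1 + e)) / (2 + e) * (?m (e + e\<^sup>2) / (2 * (e + e\<^sup>2)))) \<longlongrightarrow> L t - L s) (at_right 0)"
    by simp
  have trap: "((\<lambda>u. trapezoid e (e + e\<^sup>2) (X u) / 2) has_integral
      integral {s..t} (\<lambda>u. trapezoid e (e + e\<^sup>2) (X u) / 2)) {s..t}" if "0 < e" for e
    using st
    by (intro integrable_integral integrable_continuous_real continuous_intros continuous_on_subset[OF X])
       auto
  have ind: "((\<lambda>u. c * indicator ({s..t} \<inter> {u. \<bar>X u\<bar> < e}) u) has_integral c * ?m e) {s..t}" for c e
    using st by (intro has_integral_indicator_Icc occupation_measurable[OF X]) auto
  show "\<forall>\<^sub>F e in at_right 0. 2 / (2 + e) * (?m e / (2 * e)) \<le> integral {s..t} (\<lambda>u. trapezoid e (e + e\<^sup>2) (X u) / 2)"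
    using pos
  proof eventually_elim
    case (elim e)
    have ab: "0 < e" "e < e + e\<^sup>2" using elim by auto
    have "1 / (e + (e + e\<^sup>2)) * ?m e \<le> integral {s..t} (\<lambda>u. trapezoid e (e + e\<^sup>2) (X u) / 2)"
    proof (rule has_integral_le[OF ind trap[OF elim]])
      fix u assume "u \<in> {s..t}"
      show "1 / (e + (e + e\<^sup>2)) * indicator ({s..t} \<inter> {u. \<bar>X u\<bar> < e}) u \<le> trapezoid e (e + e\<^sup>2) (X u) / 2"
        using trapezoid_bounds(1)[OF ab, of "X u"] trapezoid_inner[OF ab, of "X u"]
        by (auto simp: indicator_def)
    qed
    also have "1 / (e + (e + e\<^sup>2)) * ?m e = 2 / (2 + e) * (?m e / (2 * e))"
    proof -
      have "e + (e + e\<^sup>2) = e * (2 + e)" by (simp add: power2_eq_square algebra_simps)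
      then show ?thesis using elim by simp
    qed
    finally show ?case .
  qed
  show "\<forall>\<^sub>F e in at_right 0. integral {s..t} (\<lambda>u. trapezoid e (e + e\<^sup>2) (X u) / 2) \<le>
      (2 * (1 + e)) / (2 + e) * (?m (e + e\<^sup>2) / (2 * (e + e\<^sup>2)))"
    using pos
  proof eventually_elim
    case (elim e)
    have ab: "0 < e" "e < e + e\<^sup>2" using elim by auto
    have "integral {s..t} (\<lambda>u. trapezoid e (e + e\<^sup>2) (X u) / 2) \<le> 1 / (e + (e + e\<^sup>2)) * ?m (e + e\<^sup>2)"
    proof (rule has_integral_le[OF trap[OF elim] ind])
      fix u assume "u \<in> {s..t}"
      then show "trapezoid e (e + e\<^sup>2) (X u) / 2 \<le> 1 / (e + (e + e\<^sup>2)) * indicator ({s..t} \<inter> {u. \<bar>X u\<bar> < e + e\<^sup>2}) u"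
        using trapezoid_bounds(2)[OF ab, of "X u"] trapezoid_outer[OF ab, of "X u"]
        by (auto simp: indicator_def)
    qed
    also have "\<dots> = (2 * (1 + e)) / (2 + e) * (?m (e + e\<^sup>2) / (2 * (e + e\<^sup>2)))"
    proof -
      have eq: "e + (e + e\<^sup>2) = e * (2 + e)" "e + e\<^sup>2 = e * (1 + e)"
        by (simp_all add: power2_eq_square algebra_simps)
      have "1 / (e * (2 + e)) * m = (2 * c) / (2 + e) * (m / (2 * (e * c)))" if "0 < c" for m c
        using elim that by simp
      from this[of "1 + e" "?m (e + e\<^sup>2)"] show ?thesis
        using elim unfolding eq(1) unfolding eq(2) by simp
    qed
    finally show ?case .
  qed
qed

text \<open>Pathwise inequality behind Doob's \<open>L\<^sup>2\<close> maximal inequality.\<close>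

fun running_max :: "(nat \<Rightarrow> real) \<Rightarrow> nat \<Rightarrow> real" where
  "running_max s 0 = max 0 (s 0)"
| "running_max s (Suc n) = max (running_max s n) (s (Suc n))"

lemma running_max_ge: "k \<le> n \<Longrightarrow> s k \<le> running_max s n"
  by (induction n) (auto simp: le_Suc_eq le_max_iff_disj)

lemma running_max_nonneg: "0 \<le> running_max s n"
  by (induction n) (auto simp: le_max_iff_disj)

text \<open>With \<open>m\<close> the running maximum, induction gives
  \<open>2 * m * s n - m\<^sup>2\<close> as a bound for twice the sum, because \<open>m\<close> only
  changes to the value just reached. The square \<open>(m - 2 * s n)\<^sup>2 \<ge> 0\<close> does
  the rest. For a martingale the sum has mean zero.\<close>

lemma running_max_sq_le:
  "(running_max s n)\<^sup>2 \<le> 4 * (s n)\<^sup>2 - 4 * (\<Sum>k<n. running_max s k * (s (Suc k) - s k))"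
proof -
  have "2 * (\<Sum>k<n. running_max s k * (s (Suc k) - s k)) \<le> 2 * running_max s n * s n - (running_max s n)\<^sup>2"
  proof (induction n)
    case 0
    then show ?case by (auto simp: power2_eq_square max_def)
  next
    case (Suc n)
    define m where "m = running_max s n"
    have "2 * (m * (s (Suc n) - s n)) \<le>
      (2 * max m (s (Suc n)) * s (Suc n) - (max m (s (Suc n)))\<^sup>2) - (2 * m * s n - m\<^sup>2)"
    proof (cases "s (Suc n) \<le> m")
      case False
      have "0 \<le> (s (Suc n) - m)\<^sup>2" by simp
      then show ?thesis using False by (simp add: power2_eq_square algebra_simps max_def)
    qed (simp add: max_def algebra_simps)
    then show ?case using Suc by (simp add: m_def distrib_left)
  qed
  moreover have "0 \<le> (running_max s n - 2 * s n)\<^sup>2" by simp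
  ultimately show ?thesis by (simp add: power2_eq_square algebra_simps)
qed

section \<open>Square integrable random variables\<close>

definition square_integrable :: "'a measure \<Rightarrow> ('a \<Rightarrow> real) \<Rightarrow> bool" where
  "square_integrable M f \<longleftrightarrow> f \<in> borel_measurable M \<and> integrable M (\<lambda>\<omega>. (f \<omega>)\<^sup>2)"

lemma square_integrableI:
  "f \<in> borel_measurable M \<Longrightarrow> integrable M (\<lambda>\<omega>. (f \<omega>)\<^sup>2) \<Longrightarrow> square_integrable M f"
  by (simp add: square_integrable_def)

lemma square_integrable_measurable [measurable_dest]: "square_integrable M f \<Longrightarrow> f \<in> borel_measurable M"
  by (simp add: square_integrable_def)

lemma square_integrable_power2: "square_integrable M f \<Longrightarrow> integrable M (\<lambda>\<omega>. (f \<omega>)\<^sup>2)"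
  by (simp add: square_integrable_def)

lemma square_integrable_mult:
  assumes f: "square_integrable M f" and g: "square_integrable M g"
  shows "integrable M (\<lambda>\<omega>. f \<omega> * g \<omega>)"
proof (rule Bochner_Integration.integrable_bound)
  show "integrable M (\<lambda>\<omega>. (f \<omega>)\<^sup>2 + (g \<omega>)\<^sup>2)"
    using assms by (intro Bochner_Integration.integrable_add square_integrable_power2)
  show "AE \<omega> in M. norm (f \<omega> * g \<omega>) \<le> norm ((f \<omega>)\<^sup>2 + (g \<omega>)\<^sup>2)"
  proof (rule AE_I2)
    fix \<omega>
    have "2 * (\<bar>f \<omega>\<bar> * \<bar>g \<omega>\<bar>) \<le> (f \<omega>)\<^sup>2 + (g \<omega>)\<^sup>2"
      using sum_squares_bound[of "\<bar>f \<omega>\<bar>" "\<bar>g \<omega>\<bar>"] by (simp add: mult.assoc)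
    moreover have "0 \<le> \<bar>f \<omega>\<bar> * \<bar>g \<omega>\<bar>" by simp
    ultimately show "norm (f \<omega> * g \<omega>) \<le> norm ((f \<omega>)\<^sup>2 + (g \<omega>)\<^sup>2)"
      by (simp only: real_norm_def abs_mult)
  qed
qed (use f g in measurable)

lemma square_integrable_bound:
  assumes "square_integrable M f" "g \<in> borel_measurable M" "AE \<omega> in M. \<bar>g \<omega>\<bar> \<le> \<bar>f \<omega>\<bar>"
  shows "square_integrable M g"
proof (rule square_integrableI)
  show "integrable M (\<lambda>\<omega>. (g \<omega>)\<^sup>2)"
  proof (rule Bochner_Integration.integrable_bound[OF square_integrable_power2[OF assms(1)]])
    show "AE \<omega> in M. norm ((g \<omega>)\<^sup>2) \<le> norm ((f \<omega>)\<^sup>2)"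
      using assms(3) by eventually_elim (simp add: abs_le_square_iff)
  qed (use assms in measurable)
qed fact

lemma square_integrable_add:
  assumes f: "square_integrable M f" and g: "square_integrable M g"
  shows "square_integrable M (\<lambda>\<omega>. f \<omega> + g \<omega>)"
proof (rule square_integrableI)
  have "integrable M (\<lambda>\<omega>. (f \<omega>)\<^sup>2 + (g \<omega>)\<^sup>2 + 2 * (f \<omega> * g \<omega>))"
    using assms by (intro Bochner_Integration.integrable_add square_integrable_power2
        integrable_mult_right square_integrable_mult)
  then show "integrable M (\<lambda>\<omega>. (f \<omega> + g \<omega>)\<^sup>2)" by (simp add: power2_sum mult.assoc)
qed (use f g in measurable)

lemma square_integrable_cmult: "square_integrable M f \<Longrightarrow> square_integrable M (\<lambda>\<omega>. c * f \<omega>)"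
  by (auto simp: square_integrable_def power_mult_distrib)

lemma square_integrable_diff:
  "square_integrable M f \<Longrightarrow> square_integrable M g \<Longrightarrow> square_integrable M (\<lambda>\<omega>. f \<omega> - g \<omega>)"
  using square_integrable_add[of M f "\<lambda>\<omega>. -1 * g \<omega>"] square_integrable_cmult[of M g "-1"] by simp

lemma square_integrable_abs: "square_integrable M f \<Longrightarrow> square_integrable M (\<lambda>\<omega>. \<bar>f \<omega>\<bar>)"
  by (auto simp: square_integrable_def)

lemma (in finite_measure) square_integrable_const: "square_integrable M (\<lambda>_. c)"
  by (simp add: square_integrable_def)

lemma (in finite_measure) square_integrable_sum:
  "(\<And>i. i \<in> I \<Longrightarrow> square_integrable M (f i)) \<Longrightarrow> square_integrable M (\<lambda>\<omega>. \<Sum>i\<in>I. f i \<omega>)"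
  by (induction I rule: infinite_finite_induct)
     (auto intro: square_integrable_add square_integrable_const)

lemma (in finite_measure) square_integrable_integrable: "square_integrable M f \<Longrightarrow> integrable M f"
  by (auto simp: square_integrable_def intro: square_integrable_imp_integrable)

lemma square_integrable_bounded_mult:
  assumes "square_integrable M f" "a \<in> borel_measurable M" "AE \<omega> in M. \<bar>a \<omega>\<bar> \<le> c"
  shows "square_integrable M (\<lambda>\<omega>. a \<omega> * f \<omega>)"
proof (rule square_integrable_bound)
  show "square_integrable M (\<lambda>\<omega>. c * f \<omega>)" by (rule square_integrable_cmult) fact
  show "AE \<omega> in M. \<bar>a \<omega> * f \<omega>\<bar> \<le> \<bar>c * f \<omega>\<bar>"
    using assms(3) by eventually_elim (auto simp: abs_mult intro!: mult_right_mono)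
qed (use assms in measurable)

lemma expectation_square_add_le:
  assumes f: "square_integrable M f" and g: "square_integrable M g"
  shows "(\<integral>\<omega>. (f \<omega> + g \<omega>)\<^sup>2 \<partial>M) \<le> 2 * (\<integral>\<omega>. (f \<omega>)\<^sup>2 \<partial>M) + 2 * (\<integral>\<omega>. (g \<omega>)\<^sup>2 \<partial>M)"
proof -
  have "(\<integral>\<omega>. (f \<omega> + g \<omega>)\<^sup>2 \<partial>M) \<le> (\<integral>\<omega>. 2 * (f \<omega>)\<^sup>2 + 2 * (g \<omega>)\<^sup>2 \<partial>M)"
  proof (rule integral_mono)
    show "(f \<omega> + g \<omega>)\<^sup>2 \<le> 2 * (f \<omega>)\<^sup>2 + 2 * (g \<omega>)\<^sup>2" for \<omega>
      using sum_squares_bound[of "f \<omega>" "g \<omega>"] by (simp add: power2_sum)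
  qed (use f g in \<open>auto intro!: square_integrable_power2 square_integrable_add\<close>)
  also have "\<dots> = 2 * (\<integral>\<omega>. (f \<omega>)\<^sup>2 \<partial>M) + 2 * (\<integral>\<omega>. (g \<omega>)\<^sup>2 \<partial>M)"
    using f g by (simp add: square_integrable_power2)
  finally show ?thesis .
qed

text \<open>Fatou's lemma. The slack \<open>e\<close> serves sequences that merely converge to
  \<open>W\<close>; \<open>e = 0\<close> serves sequences that eventually dominate it.\<close>

lemma square_integrable_liminf_le:
  assumes [measurable]: "\<And>n. N n \<in> borel_measurable M" "W \<in> borel_measurable M"
    and lim: "AE \<omega> in M. \<forall>\<^sub>F n in sequentially. (W \<omega>)\<^sup>2 \<le> (N n \<omega>)\<^sup>2 + e"
    and bd: "\<forall>\<^sub>F n in sequentially. integrable M (\<lambda>\<omega>. (N n \<omega>)\<^sup>2 + e) \<and> (\<integral>\<omega>. (N n \<omega>)\<^sup>2 + e \<partial>M) \<le> K"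
    and e: "0 \<le> e"
  shows "square_integrable M W" "(\<integral>\<omega>. (W \<omega>)\<^sup>2 \<partial>M) \<le> K"
proof -
  have K: "0 \<le> K"
  proof -
    obtain n where "(\<integral>\<omega>. (N n \<omega>)\<^sup>2 + e \<partial>M) \<le> K"
      using bd by (auto simp: eventually_sequentially)
    moreover have "0 \<le> (\<integral>\<omega>. (N n \<omega>)\<^sup>2 + e \<partial>M)" using e by (intro Bochner_Integration.integral_nonneg) auto
    ultimately show ?thesis by linarith
  qed
  have "(\<integral>\<^sup>+\<omega>. ennreal ((W \<omega>)\<^sup>2) \<partial>M) \<le> (\<integral>\<^sup>+\<omega>. liminf (\<lambda>n. ennreal ((N n \<omega>)\<^sup>2 + e)) \<partial>M)"
  proof (rule nn_integral_mono_AE, use lim in eventually_elim)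
    fix \<omega> assume "\<forall>\<^sub>F n in sequentially. (W \<omega>)\<^sup>2 \<le> (N n \<omega>)\<^sup>2 + e"
    then show "ennreal ((W \<omega>)\<^sup>2) \<le> liminf (\<lambda>n. ennreal ((N n \<omega>)\<^sup>2 + e))"
      by (intro Liminf_bounded) (auto elim!: eventually_mono intro: ennreal_leI)
  qed
  also have "\<dots> \<le> liminf (\<lambda>n. \<integral>\<^sup>+\<omega>. ennreal ((N n \<omega>)\<^sup>2 + e) \<partial>M)"
    by (rule nn_integral_liminf) measurable
  also have "\<dots> \<le> limsup (\<lambda>n. \<integral>\<^sup>+\<omega>. ennreal ((N n \<omega>)\<^sup>2 + e) \<partial>M)"
    by (rule Liminf_le_Limsup) simp
  also have "\<dots> \<le> ennreal K"
  proof (rule Limsup_bounded, use bd in eventually_elim)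
    fix n assume n: "integrable M (\<lambda>\<omega>. (N n \<omega>)\<^sup>2 + e) \<and> (\<integral>\<omega>. (N n \<omega>)\<^sup>2 + e \<partial>M) \<le> K"
    then show "(\<integral>\<^sup>+\<omega>. ennreal ((N n \<omega>)\<^sup>2 + e) \<partial>M) \<le> ennreal K"
      using e by (subst nn_integral_eq_integral) (auto intro!: ennreal_leI)
  qed
  finally have le: "(\<integral>\<^sup>+\<omega>. ennreal ((W \<omega>)\<^sup>2) \<partial>M) \<le> ennreal K" .
  have int: "integrable M (\<lambda>\<omega>. (W \<omega>)\<^sup>2)"
    by (rule integrableI_bounded) (use le in \<open>auto simp: le_less_trans[OF le]\<close>)
  then show "square_integrable M W" by (simp add: square_integrable_def)
  show "(\<integral>\<omega>. (W \<omega>)\<^sup>2 \<partial>M) \<le> K"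
    using le K int by (subst (asm) nn_integral_eq_integral) auto
qed

text \<open>Boundedness in \<open>L\<^sup>2\<close> supplies the uniform integrability that turns almost sure convergence
  into convergence of expectations.\<close>

lemma (in prob_space) L2_bounded_convergence:
  assumes meas[measurable]: "\<And>n. N n \<in> borel_measurable M" "W \<in> borel_measurable M"
    and lim: "AE \<omega> in M. (\<lambda>n. N n \<omega>) \<longlonglongrightarrow> W \<omega>"
    and bd: "\<forall>\<^sub>F n in sequentially. square_integrable M (N n) \<and> expectation (\<lambda>\<omega>. (N n \<omega>)\<^sup>2) \<le> K"
  shows "square_integrable M W" "expectation (\<lambda>\<omega>. (W \<omega>)\<^sup>2) \<le> K"
    and "\<And>a c. a \<in> borel_measurable M \<Longrightarrow> AE \<omega> in M. \<bar>a \<omega>\<bar> \<le> c \<Longrightarrow>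
      (\<lambda>n. expectation (\<lambda>\<omega>. a \<omega> * N n \<omega>)) \<longlonglongrightarrow> expectation (\<lambda>\<omega>. a \<omega> * W \<omega>)"
proof -
  have "square_integrable M W \<and> expectation (\<lambda>\<omega>. (W \<omega>)\<^sup>2) \<le> K + e" if e: "0 < e" for e
  proof -
    have 1: "AE \<omega> in M. \<forall>\<^sub>F n in sequentially. (W \<omega>)\<^sup>2 \<le> (N n \<omega>)\<^sup>2 + e"
      using lim
    proof eventually_elim
      case (elim \<omega>)
      then have "(\<lambda>n. (N n \<omega>)\<^sup>2 + e) \<longlonglongrightarrow> (W \<omega>)\<^sup>2 + e" by (intro tendsto_intros)
      then have "\<forall>\<^sub>F n in sequentially. (W \<omega>)\<^sup>2 < (N n \<omega>)\<^sup>2 + e"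
        by (rule order_tendstoD(1)) (use e in simp)
      then show ?case by (rule eventually_mono) simp
    qed
    have 2: "\<forall>\<^sub>F n in sequentially. integrable M (\<lambda>\<omega>. (N n \<omega>)\<^sup>2 + e) \<and> expectation (\<lambda>\<omega>. (N n \<omega>)\<^sup>2 + e) \<le> K + e"
      using bd by eventually_elim (auto simp: square_integrable_def prob_space)
    show ?thesis
      using square_integrable_liminf_le[OF meas 1 2] e by simp
  qed
  then show W: "square_integrable M W" and WK: "expectation (\<lambda>\<omega>. (W \<omega>)\<^sup>2) \<le> K"
    by (auto intro: zero_less_one field_le_epsilon)
  have "0 \<le> expectation (\<lambda>\<omega>. (W \<omega>)\<^sup>2)" by (rule Bochner_Integration.integral_nonneg) simp
  with WK have K: "0 \<le> K" by (rule order_trans[rotated])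
  fix a :: "'a \<Rightarrow> real" and c :: real
  assume a[measurable]: "a \<in> borel_measurable M" and ac: "AE \<omega> in M. \<bar>a \<omega>\<bar> \<le> c"
  have c: "0 \<le> c"
  proof -
    have "AE \<omega> in M. 0 \<le> c" using ac by eventually_elim auto
    then show ?thesis by simp
  qed
  have L1: "(\<lambda>n. expectation (\<lambda>\<omega>. \<bar>N n \<omega> - W \<omega>\<bar>)) \<longlonglongrightarrow> 0"
  proof (rule tendstoI)
    fix e :: real assume e: "0 < e"
    \<comment> \<open>Truncation level: the part above \<open>m\<close> is at most
      \<open>(N n - W)\<^sup>2 / m\<close>, whose mean is at most \<open>4 * K / m < e / 2\<close>.
      Below \<open>m\<close> bounded convergence applies.\<close>
    define m where "m = 8 * K / e + 1"
    have m: "0 < m" "4 * K / m < e / 2"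
    proof -
      show "0 < m" using K e by (auto simp: m_def add_nonneg_pos)
      then show "4 * K / m < e / 2"
        using K e by (simp add: m_def field_simps)
    qed
    have "(\<lambda>n. expectation (\<lambda>\<omega>. min \<bar>N n \<omega> - W \<omega>\<bar> m)) \<longlonglongrightarrow> expectation (\<lambda>\<omega>. 0)"
    proof (rule integral_dominated_convergence[where w="\<lambda>_. m"])
      show "AE \<omega> in M. (\<lambda>n. min \<bar>N n \<omega> - W \<omega>\<bar> m) \<longlonglongrightarrow> 0"
        using lim
      proof eventually_elim
        case (elim \<omega>)
        then have "(\<lambda>n. min \<bar>N n \<omega> - W \<omega>\<bar> m) \<longlonglongrightarrow> min \<bar>W \<omega> - W \<omega>\<bar> m" by (intro tendsto_intros)
        then show ?case using m by simp
      qed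
    qed (use m in \<open>auto intro!: AE_I2\<close>)
    then have "\<forall>\<^sub>F n in sequentially. expectation (\<lambda>\<omega>. min \<bar>N n \<omega> - W \<omega>\<bar> m) < e / 2"
      using e by (intro order_tendstoD(2)[of _ "0 :: real"]) auto
    with bd show "\<forall>\<^sub>F n in sequentially. dist (expectation (\<lambda>\<omega>. \<bar>N n \<omega> - W \<omega>\<bar>)) 0 < e"
    proof eventually_elim
      case (elim n)
      then have N: "square_integrable M (N n)" by simp
      have d: "square_integrable M (\<lambda>\<omega>. N n \<omega> - W \<omega>)" by (intro square_integrable_diff N W)
      have dK: "expectation (\<lambda>\<omega>. (N n \<omega> - W \<omega>)\<^sup>2) \<le> 4 * K"
        using expectation_square_add_le[OF N square_integrable_cmult[OF W, of "-1"]] elim WK by simp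
      have im: "integrable M (\<lambda>\<omega>. min \<bar>N n \<omega> - W \<omega>\<bar> m)"
        by (rule Bochner_Integration.integrable_bound[OF square_integrable_integrable[OF square_integrable_const[of m]]])
           (use m in \<open>auto intro!: AE_I2\<close>)
      have "expectation (\<lambda>\<omega>. \<bar>N n \<omega> - W \<omega>\<bar>) \<le>
          expectation (\<lambda>\<omega>. min \<bar>N n \<omega> - W \<omega>\<bar> m + (N n \<omega> - W \<omega>)\<^sup>2 / m)"
      proof (rule integral_mono)
        fix \<omega>
        show "\<bar>N n \<omega> - W \<omega>\<bar> \<le> min \<bar>N n \<omega> - W \<omega>\<bar> m + (N n \<omega> - W \<omega>)\<^sup>2 / m"
        proof (cases "\<bar>N n \<omega> - W \<omega>\<bar> \<le> m")
          case False
          then have "m * \<bar>N n \<omega> - W \<omega>\<bar> \<le> \<bar>N n \<omega> - W \<omega>\<bar> * \<bar>N n \<omega> - W \<omega>\<bar>"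
            by (intro mult_right_mono) auto
          then have "\<bar>N n \<omega> - W \<omega>\<bar> \<le> (N n \<omega> - W \<omega>)\<^sup>2 / m"
            using m by (simp add: pos_le_divide_eq power2_eq_square mult.commute)
          moreover have "0 \<le> min \<bar>N n \<omega> - W \<omega>\<bar> m" using m by simp
          ultimately show ?thesis by linarith
        qed (use m in auto)
      qed (use im square_integrable_power2[OF d] square_integrable_integrable[OF d] in auto)
      also have "\<dots> = expectation (\<lambda>\<omega>. min \<bar>N n \<omega> - W \<omega>\<bar> m) + expectation (\<lambda>\<omega>. (N n \<omega> - W \<omega>)\<^sup>2) / m"
        using im square_integrable_power2[OF d] by simp
      also have "\<dots> \<le> expectation (\<lambda>\<omega>. min \<bar>N n \<omega> - W \<omega>\<bar> m) + 4 * K / m"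
        using dK m by (intro add_left_mono divide_right_mono) auto
      also have "\<dots> < e" using m elim by linarith
      finally show ?case by (simp add: dist_real_def)
    qed
  qed
  have "(\<lambda>n. expectation (\<lambda>\<omega>. a \<omega> * N n \<omega>) - expectation (\<lambda>\<omega>. a \<omega> * W \<omega>)) \<longlonglongrightarrow> 0"
  proof (rule Lim_null_comparison)
    show "(\<lambda>n. c * expectation (\<lambda>\<omega>. \<bar>N n \<omega> - W \<omega>\<bar>)) \<longlonglongrightarrow> 0"
      using tendsto_mult_left[OF L1, of c] by simp
    show "\<forall>\<^sub>F n in sequentially. norm (expectation (\<lambda>\<omega>. a \<omega> * N n \<omega>) - expectation (\<lambda>\<omega>. a \<omega> * W \<omega>))
        \<le> c * expectation (\<lambda>\<omega>. \<bar>N n \<omega> - W \<omega>\<bar>)"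
      using bd
    proof eventually_elim
      case (elim n)
      then have N: "square_integrable M (N n)" by simp
      have aN: "integrable M (\<lambda>\<omega>. a \<omega> * N n \<omega>)" "integrable M (\<lambda>\<omega>. a \<omega> * W \<omega>)"
        using N W ac by (auto intro!: square_integrable_integrable square_integrable_bounded_mult)
      have d: "integrable M (\<lambda>\<omega>. N n \<omega> - W \<omega>)"
        by (intro square_integrable_integrable square_integrable_diff N W)
      have "norm (expectation (\<lambda>\<omega>. a \<omega> * N n \<omega>) - expectation (\<lambda>\<omega>. a \<omega> * W \<omega>)) =
          norm (expectation (\<lambda>\<omega>. a \<omega> * N n \<omega> - a \<omega> * W \<omega>))"
        using aN by simp
      also have "\<dots> \<le> expectation (\<lambda>\<omega>. norm (a \<omega> * N n \<omega> - a \<omega> * W \<omega>))"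
        by (rule integral_norm_bound)
      also have "\<dots> \<le> expectation (\<lambda>\<omega>. c * \<bar>N n \<omega> - W \<omega>\<bar>)"
      proof (rule integral_mono_AE)
        show "AE \<omega> in M. norm (a \<omega> * N n \<omega> - a \<omega> * W \<omega>) \<le> c * \<bar>N n \<omega> - W \<omega>\<bar>"
          using ac by eventually_elim (auto simp: abs_mult mult_right_mono simp flip: right_diff_distrib)
      qed (use aN d in auto)
      also have "\<dots> = c * expectation (\<lambda>\<omega>. \<bar>N n \<omega> - W \<omega>\<bar>)" by simp
      finally show ?case .
    qed
  qed
  then show "(\<lambda>n. expectation (\<lambda>\<omega>. a \<omega> * N n \<omega>)) \<longlonglongrightarrow> expectation (\<lambda>\<omega>. a \<omega> * W \<omega>)"
    by (rule LIM_zero_cancel)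
qed

section \<open>Increments of Brownian motion\<close>

context brownian_motion
begin

lemma measurable_F_M: "0 \<le> s \<Longrightarrow> u \<in> borel_measurable (F s) \<Longrightarrow> u \<in> borel_measurable M"
  by (rule measurable_from_subalg[OF subalgebra_F])

lemma measurable_F_mono:
  "s \<le> t \<Longrightarrow> u \<in> borel_measurable (F s) \<Longrightarrow> u \<in> borel_measurable (F t)"
  by (rule measurable_from_subalg[of "F t" "F s"]) (simp_all add: subalgebra_def space_F sets_F_mono)

lemma adapted_le: "0 \<le> s \<Longrightarrow> s \<le> t \<Longrightarrow> B s \<in> borel_measurable (F t)"
  using measurable_F_mono[OF _ adapted] by blast

lemma B_measurable: "0 \<le> t \<Longrightarrow> B t \<in> borel_measurable M"
  using measurable_F_M adapted by blast

context
  fixes s t :: real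
  assumes st: "0 \<le> s" "s < t"
begin

lemma increment_measurable: "(\<lambda>\<omega>. B t \<omega> - B s \<omega>) \<in> borel_measurable M"
proof -
  have [measurable]: "B t \<in> borel_measurable M" "B s \<in> borel_measurable M"
    using B_measurable[of t] B_measurable[of s] st by auto
  show ?thesis by measurable
qed

lemma increment_independent:
  assumes u: "u \<in> borel_measurable (F s)" and g: "g \<in> borel_measurable borel"
  shows "indep_var borel u borel (\<lambda>\<omega>. g (B t \<omega> - B s \<omega>) :: real)"
proof -
  have "indep_var borel u borel (\<lambda>\<omega>. B t \<omega> - B s \<omega>)"
    unfolding indep_var_def indep_vars_def2
  proof (intro conjI)
    show "\<forall>i\<in>UNIV. random_variable (case_bool borel borel i) (case_bool u (\<lambda>\<omega>. B t \<omega> - B s \<omega>) i)"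
      using measurable_F_M[OF st(1) u] increment_measurable by (auto split: bool.split)
    show "indep_sets (\<lambda>i. {case_bool u (\<lambda>\<omega>. B t \<omega> - B s \<omega>) i -` A \<inter> space M |A.
        A \<in> sets (case_bool borel borel i)}) UNIV"
    proof (rule indep_sets_mono_sets[OF indep_increments[OF st, unfolded indep_set_def]])
      fix i :: bool
      show "{case_bool u (\<lambda>\<omega>. B t \<omega> - B s \<omega>) i -` A \<inter> space M |A. A \<in> sets (case_bool borel borel i)}
        \<subseteq> case_bool (sets (F s)) {(\<lambda>\<omega>. B t \<omega> - B s \<omega>) -` A \<inter> space M |A. A \<in> sets borel} i"
        using measurable_sets[OF u] by (auto simp: space_F split: bool.split)
    qed
  qed
  from indep_var_compose[OF this measurable_ident g] show ?thesis by (simp add: comp_def)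
qed

text \<open>Takes the place of conditional expectation: a factor known at time \<open>s\<close>
  splits off from any function of the later increment. The discrete martingale arguments below all
  rest on it.\<close>

lemma increment_mult:
  assumes "u \<in> borel_measurable (F s)" "g \<in> borel_measurable borel"
    and "integrable M u" "integrable M (\<lambda>\<omega>. g (B t \<omega> - B s \<omega>) :: real)"
  shows "integrable M (\<lambda>\<omega>. u \<omega> * g (B t \<omega> - B s \<omega>))"
    and "expectation (\<lambda>\<omega>. u \<omega> * g (B t \<omega> - B s \<omega>)) =
      expectation u * expectation (\<lambda>\<omega>. g (B t \<omega> - B s \<omega>))"
  using indep_var_integrable[OF increment_independent] indep_var_lebesgue_integral[OF increment_independent]
    assms by auto

lemma increment_power_integrable: "integrable M (\<lambda>\<omega>. (B t \<omega> - B s \<omega>) ^ k)"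
  using integrable_normal_moment[of "sqrt (t - s)" 0 k] st
    distributed_integrable[OF normal_increments[OF st], of "\<lambda>z. z ^ k"] by simp

lemma increment_moment:
  "expectation (\<lambda>\<omega>. (B t \<omega> - B s \<omega>) ^ k) = (\<integral>x. normal_density 0 (sqrt (t - s)) x * (x - 0) ^ k \<partial>lborel)"
  using distributed_integral[OF normal_increments[OF st], of "\<lambda>z. z ^ k"] by simp

lemma increment_mean: "expectation (\<lambda>\<omega>. B t \<omega> - B s \<omega>) = 0"
  using increment_moment[of 1] integral_normal_moment_odd[of "sqrt (t - s)" 0 0] st by simp

text \<open>The second moment is for the isometry and Doob's inequality, the fourth for the variance
  of squared increments, the sixth for the square of a cubic Taylor remainder.\<close>

lemma increment_moments:
  "expectation (\<lambda>\<omega>. (B t \<omega> - B s \<omega>) ^ 2) = t - s"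
  "expectation (\<lambda>\<omega>. (B t \<omega> - B s \<omega>) ^ 4) = 3 * (t - s) ^ 2"
  "expectation (\<lambda>\<omega>. (B t \<omega> - B s \<omega>) ^ 6) = 15 * (t - s) ^ 3"
proof -
  have \<sigma>: "sqrt (t - s) > 0" using st by simp
  show "expectation (\<lambda>\<omega>. (B t \<omega> - B s \<omega>) ^ 2) = t - s"
    unfolding increment_moment using integral_normal_moment_even[OF \<sigma>, of 0 1] st by simp
  have f4: "fact 4 = (24::real)" by (simp add: fact_numeral)
  have f6: "fact 6 = (720::real)" by (simp add: fact_numeral)
  have "expectation (\<lambda>\<omega>. (B t \<omega> - B s \<omega>) ^ 4) = fact (2 * 2) / ((2 / (sqrt (t - s))\<^sup>2) ^ 2 * fact 2)"
    unfolding increment_moment using integral_normal_moment_even[OF \<sigma>, of 0 2] by simp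
  also have "\<dots> = 3 * (t - s) ^ 2"
    using st by (simp add: f4 power_divide)
  finally show "expectation (\<lambda>\<omega>. (B t \<omega> - B s \<omega>) ^ 4) = 3 * (t - s) ^ 2" .
  have "expectation (\<lambda>\<omega>. (B t \<omega> - B s \<omega>) ^ 6) = fact (2 * 3) / ((2 / (sqrt (t - s))\<^sup>2) ^ 3 * fact 3)"
    unfolding increment_moment using integral_normal_moment_even[OF \<sigma>, of 0 3] by simp
  also have "\<dots> = 15 * (t - s) ^ 3"
    using st by (simp add: f6 fact_numeral power_divide)
  finally show "expectation (\<lambda>\<omega>. (B t \<omega> - B s \<omega>) ^ 6) = 15 * (t - s) ^ 3" .
qed

lemma increment_square_integrable: "square_integrable M (\<lambda>\<omega>. B t \<omega> - B s \<omega>)"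
  using increment_measurable increment_power_integrable[of 2] by (rule square_integrableI)

end

text \<open>Distinct terms are orthogonal: \<open>b n * S n\<close> is known at time
  \<open>\<tau> n\<close>, and the next value of \<open>g\<close> is independent of it with mean
  zero. General \<open>g\<close> covers both the increments and the centred squared
  increments.\<close>

lemma martingale_transform_sq:
  fixes \<tau> :: "nat \<Rightarrow> real"
  assumes \<tau>: "0 \<le> \<tau> 0" "\<And>k. \<tau> k < \<tau> (Suc k)"
    and b: "\<And>k. b k \<in> borel_measurable (F (\<tau> k))" "\<And>k \<omega>. \<bar>b k \<omega>\<bar> \<le> C"
    and g: "g \<in> borel_measurable borel"
    and g2: "\<And>k. square_integrable M (\<lambda>\<omega>. g (B (\<tau> (Suc k)) \<omega> - B (\<tau> k) \<omega>))"
    and g0: "\<And>k. expectation (\<lambda>\<omega>. g (B (\<tau> (Suc k)) \<omega> - B (\<tau> k) \<omega>)) = 0"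
    and gv: "\<And>k. expectation (\<lambda>\<omega>. (g (B (\<tau> (Suc k)) \<omega> - B (\<tau> k) \<omega>))\<^sup>2) \<le> v"
  defines "S \<equiv> \<lambda>n \<omega>. \<Sum>k<n. b k \<omega> * g (B (\<tau> (Suc k)) \<omega> - B (\<tau> k) \<omega>)"
  shows "square_integrable M (S n)" "expectation (\<lambda>\<omega>. (S n \<omega>)\<^sup>2) \<le> real n * (C\<^sup>2 * v)"
proof -
  have mono: "\<tau> j \<le> \<tau> k" if "j \<le> k" for j k
    using that lift_Suc_mono_le[of \<tau>] \<tau>(2) less_imp_le by blast
  have pos: "0 \<le> \<tau> k" for k using \<tau>(1) mono[of 0 k] by simp
  have bM: "b k \<in> borel_measurable M" for k using b(1) pos measurable_F_M by blast
  have bg: "square_integrable M (\<lambda>\<omega>. b k \<omega> * g (B (\<tau> (Suc k)) \<omega> - B (\<tau> k) \<omega>))" for k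
    by (rule square_integrable_bounded_mult[OF g2 bM]) (use b in auto)
  then have S2: "square_integrable M (S n)" for n
    unfolding S_def by (intro square_integrable_sum)
  then show "square_integrable M (S n)" .
  have SF: "S n \<in> borel_measurable (F (\<tau> n))" for n
    unfolding S_def
  proof (rule borel_measurable_sum)
    fix k assume "k \<in> {..<n}"
    then have k: "\<tau> k \<le> \<tau> n" "\<tau> (Suc k) \<le> \<tau> n" by (auto intro!: mono)
    have [measurable]: "b k \<in> borel_measurable (F (\<tau> n))"
      "B (\<tau> k) \<in> borel_measurable (F (\<tau> n))" "B (\<tau> (Suc k)) \<in> borel_measurable (F (\<tau> n))"
      using measurable_F_mono[OF k(1) b(1)] adapted_le k pos by auto
    show "(\<lambda>\<omega>. b k \<omega> * g (B (\<tau> (Suc k)) \<omega> - B (\<tau> k) \<omega>)) \<in> borel_measurable (F (\<tau> n))"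
      using g by measurable
  qed
  show "expectation (\<lambda>\<omega>. (S n \<omega>)\<^sup>2) \<le> real n * (C\<^sup>2 * v)"
  proof (induction n)
    case 0
    then show ?case by (simp add: S_def)
  next
    case (Suc n)
    let ?G = "\<lambda>\<omega>. g (B (\<tau> (Suc n)) \<omega> - B (\<tau> n) \<omega>)"
    note [measurable] = square_integrable_measurable[OF S2[of n]] bM[of n]
    have bS: "square_integrable M (\<lambda>\<omega>. b n \<omega> * S n \<omega>)"
      by (rule square_integrable_bounded_mult[OF S2 bM]) (use b in auto)
    have cross: "expectation (\<lambda>\<omega>. (b n \<omega> * S n \<omega>) * ?G \<omega>) = 0"
      using SF[of n] b(1)[of n] bS g2[of n]
      by (subst increment_mult(2)[OF pos \<tau>(2) _ g])
         (auto simp: g0 intro: square_integrable_integrable)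
    have i1: "integrable M (\<lambda>\<omega>. (b n \<omega> * S n \<omega>) * ?G \<omega>)"
      by (rule square_integrable_mult[OF bS g2])
    have i2: "integrable M (\<lambda>\<omega>. (S n \<omega>)\<^sup>2)" by (rule square_integrable_power2[OF S2])
    have i3: "integrable M (\<lambda>\<omega>. (b n \<omega> * ?G \<omega>)\<^sup>2)" by (rule square_integrable_power2[OF bg])
    have "(S (Suc n) \<omega>)\<^sup>2 = (S n \<omega>)\<^sup>2 + 2 * ((b n \<omega> * S n \<omega>) * ?G \<omega>) + (b n \<omega> * ?G \<omega>)\<^sup>2" for \<omega>
      by (simp add: S_def power2_sum algebra_simps)
    then have "expectation (\<lambda>\<omega>. (S (Suc n) \<omega>)\<^sup>2) =
        expectation (\<lambda>\<omega>. (S n \<omega>)\<^sup>2) + expectation (\<lambda>\<omega>. (b n \<omega> * ?G \<omega>)\<^sup>2)"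
      using i1 i2 i3 cross by simp
    moreover have "expectation (\<lambda>\<omega>. (b n \<omega> * ?G \<omega>)\<^sup>2) \<le> expectation (\<lambda>\<omega>. C\<^sup>2 * (?G \<omega>)\<^sup>2)"
    proof (rule integral_mono[OF i3])
      show "integrable M (\<lambda>\<omega>. C\<^sup>2 * (?G \<omega>)\<^sup>2)" using square_integrable_power2[OF g2[of n]] by simp
      show "(b n \<omega> * ?G \<omega>)\<^sup>2 \<le> C\<^sup>2 * (?G \<omega>)\<^sup>2" for \<omega>
        using power_mono[OF b(2)[of n \<omega>], of 2] by (simp add: power_mult_distrib mult_right_mono)
    qed
    moreover have "expectation (\<lambda>\<omega>. C\<^sup>2 * (?G \<omega>)\<^sup>2) \<le> C\<^sup>2 * v"
      using gv[of n] by (simp add: mult_left_mono)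
    ultimately show ?case using Suc by (simp add: algebra_simps)
  qed
qed

text \<open>The sum in \<open>running_max_sq_le\<close> is a martingale transform and drops out in
  the mean. The bound is free of \<open>n\<close>, and the signs \<open>c = 1\<close> and
  \<open>c = -1\<close> together control \<open>\<bar>B - B 0\<bar>\<close>.\<close>

lemma doob_running_max:
  assumes t: "0 < t" and n: "0 < n" and c: "c\<^sup>2 = 1"
  defines "s \<equiv> \<lambda>\<omega> k. c * (B (grid 0 t n k) \<omega> - B 0 \<omega>)"
  shows "square_integrable M (\<lambda>\<omega>. running_max (s \<omega>) n)"
    and "expectation (\<lambda>\<omega>. (running_max (s \<omega>) n)\<^sup>2) \<le> 4 * t"
proof -
  let ?\<tau> = "grid 0 t n"
  have pos: "0 \<le> ?\<tau> k" for k using t by (simp add: grid_ge)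
  have less: "?\<tau> k < ?\<tau> (Suc k)" for k using t n by (simp add: grid_less_Suc)
  have sF: "(\<lambda>\<omega>. s \<omega> j) \<in> borel_measurable (F (?\<tau> k))" if "j \<le> k" for j k
    unfolding s_def using that t pos
    by (intro borel_measurable_times borel_measurable_diff adapted_le grid_mono) auto
  have mF: "(\<lambda>\<omega>. running_max (s \<omega>) j) \<in> borel_measurable (F (?\<tau> k))" if "j \<le> k" for j k
    using that by (induction j) (auto intro!: borel_measurable_max sF)
  have s2: "square_integrable M (\<lambda>\<omega>. s \<omega> k)" for k
  proof (cases "k = 0")
    case False
    then have "?\<tau> 0 < ?\<tau> k" using t n by (simp add: grid_def)
    then show ?thesis
      unfolding s_def by (intro square_integrable_cmult increment_square_integrable) auto
  qed (simp add: s_def square_integrable_const)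
  have m2: "square_integrable M (\<lambda>\<omega>. running_max (s \<omega>) k)" for k
  proof (induction k)
    case 0
    have "square_integrable M (\<lambda>\<omega>. max 0 (s \<omega> 0))"
      by (rule square_integrable_bound[OF s2[of 0]]) (use s2[of 0] in auto)
    then show ?case by simp
  next
    case (Suc k)
    have "square_integrable M (\<lambda>\<omega>. max (running_max (s \<omega>) k) (s \<omega> (Suc k)))"
      by (rule square_integrable_bound[OF square_integrable_add[OF square_integrable_abs[OF Suc]
            square_integrable_abs[OF s2[of "Suc k"]]]])
         (use Suc s2[of "Suc k"] in \<open>auto simp: square_integrable_def\<close>)
    then show ?case by simp
  qed
  then show "square_integrable M (\<lambda>\<omega>. running_max (s \<omega>) n)" .
  have inc: "s \<omega> (Suc k) - s \<omega> k = c * (B (?\<tau> (Suc k)) \<omega> - B (?\<tau> k) \<omega>)" for \<omega> k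
    by (simp add: s_def algebra_simps)
  have cross: "integrable M (\<lambda>\<omega>. running_max (s \<omega>) k * (s \<omega> (Suc k) - s \<omega> k))"
    "expectation (\<lambda>\<omega>. running_max (s \<omega>) k * (s \<omega> (Suc k) - s \<omega> k)) = 0" for k
  proof -
    have inci: "integrable M (\<lambda>\<omega>. c * (B (?\<tau> (Suc k)) \<omega> - B (?\<tau> k) \<omega>))"
      using increment_square_integrable[OF pos less, of k]
      by (intro integrable_mult_right square_integrable_integrable) auto
    have g: "(\<lambda>z. c * z) \<in> borel_measurable borel" by simp
    note * = increment_mult[OF pos less mF[OF order_refl] g square_integrable_integrable[OF m2] inci]
    show "integrable M (\<lambda>\<omega>. running_max (s \<omega>) k * (s \<omega> (Suc k) - s \<omega> k))"
      unfolding inc by (rule *(1))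
    show "expectation (\<lambda>\<omega>. running_max (s \<omega>) k * (s \<omega> (Suc k) - s \<omega> k)) = 0"
      unfolding inc *(2) by (simp add: increment_mean[OF pos less])
  qed
  have "expectation (\<lambda>\<omega>. (running_max (s \<omega>) n)\<^sup>2) \<le>
      expectation (\<lambda>\<omega>. 4 * (s \<omega> n)\<^sup>2 - 4 * (\<Sum>k<n. running_max (s \<omega>) k * (s \<omega> (Suc k) - s \<omega> k)))"
    using square_integrable_power2[OF m2] square_integrable_power2[OF s2] cross
    by (intro integral_mono running_max_sq_le) auto
  also have "\<dots> = 4 * expectation (\<lambda>\<omega>. (s \<omega> n)\<^sup>2)"
    using square_integrable_power2[OF s2] cross by simp
  also have "expectation (\<lambda>\<omega>. (s \<omega> n)\<^sup>2) = t"
    using n c increment_moments(1)[of 0 t] t by (simp add: s_def power_mult_distrib)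
  finally show "expectation (\<lambda>\<omega>. (running_max (s \<omega>) n)\<^sup>2) \<le> 4 * t" .
qed

end

text \<open>Orthogonality to every bounded variable known at the starting time is the form in which
  martingale properties are expressed from here on.\<close>

lemma (in brownian_motion) martingale_transform_mean:
  fixes \<tau> :: "nat \<Rightarrow> real" and b :: "nat \<Rightarrow> _ \<Rightarrow> real" and g :: "real \<Rightarrow> real"
  assumes \<tau>: "0 \<le> \<tau> 0" "\<And>k. \<tau> k < \<tau> (Suc k)"
    and a: "a \<in> borel_measurable (F (\<tau> 0))" "AE \<omega> in M. \<bar>a \<omega>\<bar> \<le> c"
    and b: "\<And>k. b k \<in> borel_measurable (F (\<tau> k))" "\<And>k \<omega>. \<bar>b k \<omega>\<bar> \<le> C"
    and g: "g \<in> borel_measurable borel"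
    and gi: "\<And>k. integrable M (\<lambda>\<omega>. g (B (\<tau> (Suc k)) \<omega> - B (\<tau> k) \<omega>))"
    and g0: "\<And>k. expectation (\<lambda>\<omega>. g (B (\<tau> (Suc k)) \<omega> - B (\<tau> k) \<omega>)) = 0"
  shows "integrable M (\<lambda>\<omega>. a \<omega> * (\<Sum>k<n. b k \<omega> * g (B (\<tau> (Suc k)) \<omega> - B (\<tau> k) \<omega>)))"
    and "expectation (\<lambda>\<omega>. a \<omega> * (\<Sum>k<n. b k \<omega> * g (B (\<tau> (Suc k)) \<omega> - B (\<tau> k) \<omega>))) = 0"
proof -
  have mono: "\<tau> j \<le> \<tau> k" if "j \<le> k" for j k
    using that lift_Suc_mono_le[of \<tau>] \<tau>(2) less_imp_le by blast
  have pos: "0 \<le> \<tau> k" for k using \<tau>(1) mono[of 0 k] by simp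
  have ab: "(\<lambda>\<omega>. a \<omega> * b k \<omega>) \<in> borel_measurable (F (\<tau> k))" for k
  proof -
    have "a \<in> borel_measurable (F (\<tau> k))" using measurable_F_mono[OF mono a(1), of k] by simp
    then show ?thesis using b(1)[of k] by (rule borel_measurable_times)
  qed
  have abi: "integrable M (\<lambda>\<omega>. a \<omega> * b k \<omega>)" for k
  proof (rule integrable_const_bound[where B="\<bar>c\<bar> * \<bar>C\<bar>"])
    show "AE \<omega> in M. norm (a \<omega> * b k \<omega>) \<le> \<bar>c\<bar> * \<bar>C\<bar>"
      using a(2)
    proof eventually_elim
      case (elim \<omega>)
      have "\<bar>b k \<omega>\<bar> \<le> \<bar>C\<bar>" using b(2)[of k \<omega>] by linarith
      then show ?case using elim by (simp add: abs_mult mult_mono)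
    qed
  qed (rule measurable_F_M[OF pos ab])
  note * = increment_mult[OF pos \<tau>(2) ab g abi gi]
  have eq: "a \<omega> * (\<Sum>k<n. b k \<omega> * g (B (\<tau> (Suc k)) \<omega> - B (\<tau> k) \<omega>)) =
      (\<Sum>k<n. (a \<omega> * b k \<omega>) * g (B (\<tau> (Suc k)) \<omega> - B (\<tau> k) \<omega>))" for \<omega>
    by (simp add: sum_distrib_left mult.assoc)
  show "integrable M (\<lambda>\<omega>. a \<omega> * (\<Sum>k<n. b k \<omega> * g (B (\<tau> (Suc k)) \<omega> - B (\<tau> k) \<omega>)))"
    unfolding eq using * by (intro Bochner_Integration.integrable_sum) auto
  show "expectation (\<lambda>\<omega>. a \<omega> * (\<Sum>k<n. b k \<omega> * g (B (\<tau> (Suc k)) \<omega> - B (\<tau> k) \<omega>))) = 0"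
    unfolding eq by (subst Bochner_Integration.integral_sum) (auto simp: * g0)
qed

text \<open>\<open>smooth_abs\<close> has only a Lipschitz second derivative, so the cubic remainder
  comes from applying the mean value inequality twice; the constant is not optimal.\<close>

lemma smooth_abs_taylor:
  assumes ab: "0 < a" "a < b"
  shows "\<bar>smooth_abs a b (u + z) - smooth_abs a b u - smooth_sgn a b u * z - trapezoid a b u / 2 * z\<^sup>2\<bar>
    \<le> 4 / ((b - a) * (a + b)) * \<bar>z\<bar> ^ 3"
proof -
  define K where "K = 4 / ((b - a) * (a + b))"
  have K: "0 \<le> K" using ab by (simp add: K_def)
  have d1: "\<bar>smooth_sgn a b (u + w) - smooth_sgn a b u - trapezoid a b u * w\<bar> \<le> K * \<bar>w\<bar> * \<bar>w\<bar>" for w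
  proof -
    let ?p = "\<lambda>v. smooth_sgn a b (u + v) - smooth_sgn a b u - trapezoid a b u * v"
    have "norm (?p w - ?p 0) \<le> (K * \<bar>w\<bar>) * norm (w - 0)"
    proof (rule field_differentiable_bound[of "cball (0::real) \<bar>w\<bar>" _ "\<lambda>v. trapezoid a b (u + v) - trapezoid a b u"])
      fix v :: real assume v: "v \<in> cball 0 \<bar>w\<bar>"
      show "(?p has_field_derivative trapezoid a b (u + v) - trapezoid a b u) (at v within cball 0 \<bar>w\<bar>)"
        by (rule has_field_derivative_at_within)
           (auto intro!: derivative_eq_intros DERIV_chain2[OF DERIV_smooth_sgn])
      have "norm (trapezoid a b (u + v) - trapezoid a b u) \<le> K * \<bar>v\<bar>"
        using trapezoid_lipschitz[OF ab, of "u + v" u] by (simp add: K_def)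
      also have "\<dots> \<le> K * \<bar>w\<bar>" using v K by (intro mult_left_mono) auto
      finally show "norm (trapezoid a b (u + v) - trapezoid a b u) \<le> K * \<bar>w\<bar>" .
    qed auto
    then show ?thesis by simp
  qed
  let ?q = "\<lambda>v. smooth_abs a b (u + v) - smooth_abs a b u - smooth_sgn a b u * v - trapezoid a b u / 2 * v\<^sup>2"
  have "norm (?q z - ?q 0) \<le> (K * \<bar>z\<bar> * \<bar>z\<bar>) * norm (z - 0)"
  proof (rule field_differentiable_bound[of "cball (0::real) \<bar>z\<bar>" _
        "\<lambda>w. smooth_sgn a b (u + w) - smooth_sgn a b u - trapezoid a b u * w"])
    fix w :: real assume w: "w \<in> cball 0 \<bar>z\<bar>"
    show "(?q has_field_derivative smooth_sgn a b (u + w) - smooth_sgn a b u - trapezoid a b u * w)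
        (at w within cball 0 \<bar>z\<bar>)"
      by (rule has_field_derivative_at_within)
         (auto intro!: derivative_eq_intros DERIV_chain2[OF DERIV_smooth_abs])
    have "norm (smooth_sgn a b (u + w) - smooth_sgn a b u - trapezoid a b u * w) \<le> K * \<bar>w\<bar> * \<bar>w\<bar>"
      using d1 by simp
    also have "\<dots> \<le> K * \<bar>z\<bar> * \<bar>z\<bar>" using w K by (intro mult_mono) auto
    finally show "norm (smooth_sgn a b (u + w) - smooth_sgn a b u - trapezoid a b u * w) \<le> K * \<bar>z\<bar> * \<bar>z\<bar>" .
  qed auto
  then show ?thesis by (simp add: K_def power3_eq_cube mult.assoc)
qed

text \<open>The smoothed sign vanishes at the origin. A push by the local time, which acts at zeros
  of \<open>X\<close>, therefore changes \<open>smooth_abs\<close> by a quantity of second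
  order.\<close>

lemma smooth_abs_local_lipschitz:
  assumes ab: "0 < a" "a < b" and pq: "\<bar>p\<bar> \<le> r" "\<bar>q\<bar> \<le> r"
  shows "\<bar>smooth_abs a b p - smooth_abs a b q\<bar> \<le> 2 / (a + b) * r * \<bar>p - q\<bar>"
proof -
  have "norm (smooth_abs a b p - smooth_abs a b q) \<le> (2 / (a + b) * r) * norm (p - q)"
  proof (rule field_differentiable_bound[of "cball (0::real) r" _ "smooth_sgn a b"])
    fix v :: real assume v: "v \<in> cball 0 r"
    show "(smooth_abs a b has_field_derivative smooth_sgn a b v) (at v within cball 0 r)"
      by (rule has_field_derivative_at_within[OF DERIV_smooth_abs])
    have "\<bar>smooth_sgn a b v\<bar> \<le> 2 / (a + b) * \<bar>v\<bar>" by (rule smooth_sgn_le[OF ab])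
    also have "\<dots> \<le> 2 / (a + b) * r" using v ab by (intro mult_left_mono) auto
    finally show "norm (smooth_sgn a b v) \<le> 2 / (a + b) * r" by simp
  qed (use pq in auto)
  then show ?thesis by simp
qed

section \<open>Tanaka's formula for skew Brownian motion\<close>

text \<open>A single deterministic path. Pathwise arguments are carried out here and then
  interpreted at almost every \<open>\<omega>\<close>.\<close>

locale skew_path =
  fixes \<beta> x :: real and X B L :: "real \<Rightarrow> real"
  assumes X_cont: "continuous_on {0..} X" and B_cont: "continuous_on {0..} B"
    and L_cont: "continuous_on {0..} L" and L_mono: "mono_on {0..} L"
    and occ: "occupation_limit X L"
    and eq: "\<And>t. 0 \<le> t \<Longrightarrow> X t = x + B t + \<beta> * L t"
    and X_0: "X 0 = x"
begin

lemma L_0: "L 0 = 0"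
  by (rule occupation_limit_zero[OF occ])

lemma L_le: "0 \<le> s \<Longrightarrow> s \<le> t \<Longrightarrow> L s \<le> L t"
  using L_mono by (auto simp: mono_on_def)

lemma L_nonneg: "0 \<le> t \<Longrightarrow> 0 \<le> L t"
  using L_le[of 0 t] L_0 by simp

lemma cont: "0 \<le> s \<Longrightarrow> continuous_on {s..t} X" "0 \<le> s \<Longrightarrow> continuous_on {s..t} L"
  "0 \<le> s \<Longrightarrow> continuous_on {s..t} B"
  by (auto intro: continuous_on_subset[OF X_cont] continuous_on_subset[OF L_cont] continuous_on_subset[OF B_cont])

lemma zero_between: "0 \<le> s \<Longrightarrow> s \<le> t \<Longrightarrow> L s \<noteq> L t \<Longrightarrow> \<exists>u\<in>{s..t}. X u = 0"
  using local_time_flat[OF occ X_cont] by blast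

lemma shifted: "0 \<le> s \<Longrightarrow> s \<le> t \<Longrightarrow> X s + (B t - B s) = X t - \<beta> * (L t - L s)"
  using eq[of s] eq[of t] by (simp add: algebra_simps)

context
  fixes a b s t :: real
  assumes ab: "0 < a" "a < b" and st: "0 \<le> s" "s < t"
begin

text \<open>\<open>smooth_abs\<close> is 1-Lipschitz and the increments of \<open>L\<close>
  telescope. The bound is independent of the grid and serves as dominating function.\<close>

lemma local_time_error_le:
  assumes n: "0 < n"
  shows "(\<Sum>k<n. \<bar>smooth_abs a b (X (grid s t n (Suc k))) - smooth_abs a b (X (grid s t n k)
      + (B (grid s t n (Suc k)) - B (grid s t n k)))\<bar>) \<le> \<bar>\<beta>\<bar> * (L t - L s)"
proof -
  have "(\<Sum>k<n. \<bar>smooth_abs a b (X (grid s t n (Suc k))) - smooth_abs a b (X (grid s t n k)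
      + (B (grid s t n (Suc k)) - B (grid s t n k)))\<bar>)
    \<le> (\<Sum>k<n. \<bar>\<beta>\<bar> * (L (grid s t n (Suc k)) - L (grid s t n k)))"
  proof (rule sum_mono)
    fix k assume "k \<in> {..<n}"
    let ?a = "grid s t n k" and ?b = "grid s t n (Suc k)"
    have 1: "0 \<le> ?a" "?a \<le> ?b"
      using st n grid_ge[of s t n k] by (auto intro: grid_mono)
    have 2: "X ?a + (B ?b - B ?a) = X ?b - \<beta> * (L ?b - L ?a)" by (rule shifted[OF 1])
    have "\<bar>smooth_abs a b (X ?b) - smooth_abs a b (X ?a + (B ?b - B ?a))\<bar> \<le> \<bar>\<beta> * (L ?b - L ?a)\<bar>"
      unfolding 2 by (rule order_trans[OF smooth_abs_lipschitz[OF ab]]) simp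
    then show "\<bar>smooth_abs a b (X ?b) - smooth_abs a b (X ?a + (B ?b - B ?a))\<bar> \<le> \<bar>\<beta>\<bar> * (L ?b - L ?a)"
      using L_le[OF 1] by (simp add: abs_mult)
  qed
  also have "\<dots> = \<bar>\<beta>\<bar> * (L t - L s)"
    using n by (simp add: sum_distrib_left[symmetric] sum_grid_diff)
  finally show ?thesis .
qed

text \<open>Only cells on which \<open>L\<close> grows contribute. Such a cell contains a zero of
  \<open>X\<close>, so on a fine grid \<open>X\<close> is at most \<open>2 * e\<close> there and the
  slope of \<open>smooth_abs\<close> is of order \<open>e\<close>; what remains sums to the
  increment of \<open>L\<close>. Hence the term with \<open>\<beta>\<close> leaves no trace in
  Tanaka's formula.\<close>

lemma local_time_error_tendsto:
  "(\<lambda>n. \<Sum>k<n. smooth_abs a b (X (grid s t n (Suc k))) - smooth_abs a b (X (grid s t n k)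
      + (B (grid s t n (Suc k)) - B (grid s t n k)))) \<longlonglongrightarrow> 0"
proof (rule LIMSEQ_I)
  fix r :: real assume r: "0 < r"
  define V where "V = 2 / (a + b) * (2 + \<bar>\<beta>\<bar>) * (\<bar>\<beta>\<bar> * (L t - L s))"
  have V: "0 \<le> V" using ab st L_le[of s t] by (simp add: V_def)
  define e where "e = r / (V + 1)"
  have e: "0 < e" "e * V < r"
  proof -
    show "0 < e" using r V by (simp add: e_def)
    then have "e * V < e * (V + 1)" by simp
    also have "\<dots> = r" using V by (simp add: e_def)
    finally show "e * V < r" .
  qed
  have "\<forall>\<^sub>F n in sequentially. norm ((\<Sum>k<n. smooth_abs a b (X (grid s t n (Suc k))) -
      smooth_abs a b (X (grid s t n k) + (B (grid s t n (Suc k)) - B (grid s t n k)))) - 0) < r"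
    using eventually_grid_oscillation[OF less_imp_le[OF st(2)] cont(1)[OF st(1)] e(1)]
      eventually_grid_oscillation[OF less_imp_le[OF st(2)] cont(2)[OF st(1)] e(1)]
  proof eventually_elim
    case (elim n)
    then have n: "0 < n" by simp
    let ?E = "\<lambda>k. smooth_abs a b (X (grid s t n (Suc k))) -
      smooth_abs a b (X (grid s t n k) + (B (grid s t n (Suc k)) - B (grid s t n k)))"
    have "\<bar>?E k\<bar> \<le> 2 / (a + b) * ((2 + \<bar>\<beta>\<bar>) * e) * (\<bar>\<beta>\<bar> * (L (grid s t n (Suc k)) - L (grid s t n k)))"
      if "k < n" for k
    proof -
      let ?a = "grid s t n k" and ?b = "grid s t n (Suc k)"
      have 1: "0 \<le> ?a" "?a \<le> ?b"
        using st n grid_ge[of s t n k] by (auto intro: grid_mono)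
      have 2: "X ?a + (B ?b - B ?a) = X ?b - \<beta> * (L ?b - L ?a)" by (rule shifted[OF 1])
      show ?thesis
      proof (cases "L ?a = L ?b")
        case False
        then obtain u where u: "u \<in> {?a..?b}" "X u = 0" using zero_between[OF 1] by blast
        have osc: "\<bar>X v - X ?a\<bar> \<le> e" "\<bar>L v - L ?a\<bar> \<le> e" if "v \<in> {?a..?b}" for v
          using elim \<open>k < n\<close> that by blast+
        have "\<bar>X u - X ?a\<bar> \<le> e" "\<bar>X ?b - X ?a\<bar> \<le> e" "\<bar>L ?b - L ?a\<bar> \<le> e"
          using osc[of u] osc[of ?b] u(1) 1 by auto
        then have Xb: "\<bar>X ?b\<bar> \<le> 2 * e" and bL: "\<bar>\<beta> * (L ?b - L ?a)\<bar> \<le> \<bar>\<beta>\<bar> * e"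
          using u(2) by (auto simp: abs_mult intro: mult_left_mono)
        have "\<bar>X ?b - \<beta> * (L ?b - L ?a)\<bar> \<le> (2 + \<bar>\<beta>\<bar>) * e"
          using Xb bL by (simp add: distrib_right)
        moreover have "0 \<le> \<bar>\<beta>\<bar> * e" using e by simp
        then have "\<bar>X ?b\<bar> \<le> (2 + \<bar>\<beta>\<bar>) * e" using Xb unfolding distrib_right by linarith
        ultimately have "\<bar>?E k\<bar> \<le> 2 / (a + b) * ((2 + \<bar>\<beta>\<bar>) * e) * \<bar>\<beta> * (L ?b - L ?a)\<bar>"
          unfolding 2 using smooth_abs_local_lipschitz[OF ab, of "X ?b" _ "X ?b - \<beta> * (L ?b - L ?a)"] by simp
        then show ?thesis using L_le[OF 1] by (simp add: abs_mult)
      qed (use 2 in simp)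
    qed
    then have "(\<Sum>k<n. \<bar>?E k\<bar>) \<le>
        (\<Sum>k<n. 2 / (a + b) * ((2 + \<bar>\<beta>\<bar>) * e) * (\<bar>\<beta>\<bar> * (L (grid s t n (Suc k)) - L (grid s t n k))))"
      by (intro sum_mono) auto
    also have "\<dots> = 2 / (a + b) * ((2 + \<bar>\<beta>\<bar>) * e) * (\<bar>\<beta>\<bar> * (L t - L s))"
      using n by (simp only: sum_distrib_left[symmetric] sum_grid_diff)
    also have "\<dots> = e * V" by (simp add: V_def)
    finally have "(\<Sum>k<n. \<bar>?E k\<bar>) < r" using e by simp
    with sum_abs[of ?E "{..<n}"] show ?case unfolding real_norm_def diff_0_right by (rule le_less_trans)
  qed
  then show "\<exists>N. \<forall>n\<ge>N. norm ((\<Sum>k<n. smooth_abs a b (X (grid s t n (Suc k))) -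
      smooth_abs a b (X (grid s t n k) + (B (grid s t n (Suc k)) - B (grid s t n k)))) - 0) < r"
    by (simp add: eventually_sequentially)
qed

end

text \<open>Moves the unknown time of \<open>local_time_bound\<close> to a grid point, at the price
  of an oscillation of at most 1, so that the discrete Doob inequality can be used.\<close>

lemma local_time_le_running_max:
  assumes t: "0 < t"
  shows "\<forall>\<^sub>F n in sequentially. \<bar>\<beta> * L t\<bar> \<le> \<bar>x\<bar> + \<bar>B 0\<bar> + 1
    + running_max (\<lambda>k. 1 * (B (grid 0 t n k) - B 0)) n + running_max (\<lambda>k. -1 * (B (grid 0 t n k) - B 0)) n"
proof -
  obtain u where u: "u \<in> {0..t}" "\<bar>\<beta> * L t\<bar> \<le> \<bar>x + B u\<bar>"
    using local_time_bound[OF occ X_cont L_cont, of x B \<beta> t] eq t by auto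
  have "0 \<le> t" using t by simp
  from eventually_grid_oscillation[OF this cont(3)[OF order_refl] zero_less_one] show ?thesis
  proof eventually_elim
    case (elim n)
    then obtain k where k: "k < n" "u \<in> {grid 0 t n k..grid 0 t n (Suc k)}"
      using grid_cell[of n 0 u t] u by auto
    let ?p = "running_max (\<lambda>k. 1 * (B (grid 0 t n k) - B 0)) n"
    let ?m = "running_max (\<lambda>k. -1 * (B (grid 0 t n k) - B 0)) n"
    have "\<bar>B u - B (grid 0 t n k)\<bar> \<le> 1" using elim k by blast
    moreover have "B (grid 0 t n k) - B 0 \<le> ?p" "- (B (grid 0 t n k) - B 0) \<le> ?m"
    proof -
      have "1 * (B (grid 0 t n k) - B 0) \<le> ?p" "-1 * (B (grid 0 t n k) - B 0) \<le> ?m"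
        by (rule running_max_ge[OF less_imp_le[OF k(1)]])+
      then show "B (grid 0 t n k) - B 0 \<le> ?p" "- (B (grid 0 t n k) - B 0) \<le> ?m" by simp_all
    qed
    moreover have "0 \<le> ?p" "0 \<le> ?m" by (rule running_max_nonneg)+
    ultimately have "\<bar>B u\<bar> \<le> \<bar>B 0\<bar> + 1 + ?p + ?m" by linarith
    then show ?case using u(2) abs_triangle_ineq[of x "B u"] by linarith
  qed
qed

end

locale skew_process = brownian_motion M F B
  for M :: "'w measure" and F and B +
  fixes \<beta> x :: real and X L\<^sub>0 :: "real \<Rightarrow> 'w \<Rightarrow> real"
  assumes skew: "skew_brownian_motion M F B \<beta> x X L\<^sub>0" and \<beta>: "\<beta> \<noteq> 0"
begin

text \<open>The given local time is only almost surely adapted; reading it off the equation gives a version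
  that is adapted everywhere.\<close>

definition L :: "real \<Rightarrow> 'w \<Rightarrow> real" where
  "L t \<omega> = (X t \<omega> - x - B t \<omega>) / \<beta>"

lemma X_eq: "X t \<omega> = x + B t \<omega> + \<beta> * L t \<omega>"
  using \<beta> by (simp add: L_def)

lemma X_adapted: "0 \<le> t \<Longrightarrow> X t \<in> borel_measurable (F t)"
  using skew by (simp add: skew_brownian_motion_def)

lemma L_adapted: "0 \<le> t \<Longrightarrow> L t \<in> borel_measurable (F t)"
  unfolding L_def[abs_def]
  by (intro borel_measurable_divide borel_measurable_diff X_adapted adapted borel_measurable_const)

lemma X_measurable: "0 \<le> t \<Longrightarrow> X t \<in> borel_measurable M"
  using X_adapted measurable_F_M by blast

lemma L_measurable: "0 \<le> t \<Longrightarrow> L t \<in> borel_measurable M"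
  using L_adapted measurable_F_M by blast

lemma AE_path: "AE \<omega> in M. skew_path \<beta> x (\<lambda>t. X t \<omega>) (\<lambda>t. B t \<omega>) (\<lambda>t. L t \<omega>)"
proof -
  have X: "AE \<omega> in M. continuous_on {0..} (\<lambda>t. X t \<omega>)"
    and L0: "AE \<omega> in M. continuous_on {0..} (\<lambda>t. L\<^sub>0 t \<omega>) \<and> mono_on {0..} (\<lambda>t. L\<^sub>0 t \<omega>) \<and>
      (\<forall>t\<ge>0. ((\<lambda>\<epsilon>. 1 / (2 * \<epsilon>) * (LINT s:{0..t}|lborel. indicator {s. \<bar>X s \<omega>\<bar> < \<epsilon>} s))
        \<longlongrightarrow> L\<^sub>0 t \<omega>) (at_right 0))"
    and eq: "AE \<omega> in M. \<forall>t\<ge>0. X t \<omega> = x + B t \<omega> + \<beta> * L\<^sub>0 t \<omega>"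
    using skew by (auto simp: skew_brownian_motion_def symmetric_local_time_def)
  show ?thesis
    using X L0 eq start continuous_paths
  proof eventually_elim
    case (elim \<omega>)
    have LL: "L t \<omega> = L\<^sub>0 t \<omega>" if "0 \<le> t" for t
      using elim(3) that \<beta> by (simp add: L_def)
    have occ: "occupation_limit (\<lambda>t. X t \<omega>) (\<lambda>t. L t \<omega>)"
      using elim(2) by (simp add: occupation_limit_def occupation_eq_measure LL)
    show ?case
    proof
      show "continuous_on {0..} (\<lambda>t. L t \<omega>)"
      proof -
        have "continuous_on {0..} (\<lambda>t. L t \<omega>) \<longleftrightarrow> continuous_on {0..} (\<lambda>t. L\<^sub>0 t \<omega>)"
          by (rule continuous_on_cong) (auto simp: LL)
        then show ?thesis using elim(2) by simp
      qed
      show "mono_on {0..} (\<lambda>t. L t \<omega>)"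
        using elim(2) by (auto simp: LL mono_on_def)
      show "X 0 \<omega> = x"
        using X_eq[of 0 \<omega>] elim(4) occupation_limit_zero[OF occ] by simp
    qed (use elim occ X_eq in auto)
  qed
qed

text \<open>Almost surely \<open>\<bar>\<beta> * L t\<bar>\<close> is eventually below
  \<open>N n\<close>, whose second moment is bounded uniformly in \<open>n\<close> by Doob's
  inequality; Fatou's lemma concludes.\<close>

lemma L_square_integrable:
  assumes t: "0 \<le> t"
  shows "square_integrable M (L t)"
proof (cases "t = 0")
  case True
  show ?thesis
  proof (rule square_integrable_bound[OF square_integrable_const[of 0] L_measurable[OF t]])
    show "AE \<omega> in M. \<bar>L t \<omega>\<bar> \<le> \<bar>0\<bar>"
      using AE_path by eventually_elim (auto simp: True dest: skew_path.L_0)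
  qed
next
  case False
  then have t: "0 < t" using t by simp
  let ?p = "\<lambda>n \<omega>. running_max (\<lambda>k. 1 * (B (grid 0 t n k) \<omega> - B 0 \<omega>)) n"
  let ?m = "\<lambda>n \<omega>. running_max (\<lambda>k. -1 * (B (grid 0 t n k) \<omega> - B 0 \<omega>)) n"
  have p: "square_integrable M (?p n)" "expectation (\<lambda>\<omega>. (?p n \<omega>)\<^sup>2) \<le> 4 * t"
    and m: "square_integrable M (?m n)" "expectation (\<lambda>\<omega>. (?m n \<omega>)\<^sup>2) \<le> 4 * t" if "0 < n" for n
    using doob_running_max[OF t that, of 1] doob_running_max[OF t that, of "-1"] by simp_all
  define N where "N n \<omega> = (if n = 0 then 0 else (\<bar>x\<bar> + 1) + (?p n \<omega> + ?m n \<omega>))" for n \<omega>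
  have N2: "square_integrable M (N n)" for n
    unfolding N_def using p(1) m(1)
    by (cases "n = 0") (auto intro!: square_integrable_add square_integrable_const)
  have [measurable]: "\<And>n. N n \<in> borel_measurable M" "L t \<in> borel_measurable M"
    using N2 L_measurable t by (auto simp: square_integrable_def)
  have "square_integrable M (\<lambda>\<omega>. \<beta> * L t \<omega>)"
  proof (rule square_integrable_liminf_le(1)[where N=N and e=0])
    show "AE \<omega> in M. \<forall>\<^sub>F n in sequentially. (\<beta> * L t \<omega>)\<^sup>2 \<le> (N n \<omega>)\<^sup>2 + 0"
      using AE_path start
    proof eventually_elim
      case (elim \<omega>)
      from skew_path.local_time_le_running_max[OF elim(1) t] eventually_gt_at_top[of 0]
      show ?case
      proof eventually_elim
        case (elim n)
        then have "\<bar>\<beta> * L t \<omega>\<bar> \<le> N n \<omega>"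
          using \<open>B 0 \<omega> = 0\<close> by (simp add: N_def)
        then show ?case using abs_le_square_iff[of "\<beta> * L t \<omega>" "N n \<omega>"] by simp
      qed
    qed
    show "\<forall>\<^sub>F n in sequentially. integrable M (\<lambda>\<omega>. (N n \<omega>)\<^sup>2 + 0) \<and>
        expectation (\<lambda>\<omega>. (N n \<omega>)\<^sup>2 + 0) \<le> 2 * (\<bar>x\<bar> + 1)\<^sup>2 + 2 * (2 * (4 * t) + 2 * (4 * t))"
      using eventually_gt_at_top[of 0]
    proof eventually_elim
      case (elim n)
      have "expectation (\<lambda>\<omega>. (N n \<omega>)\<^sup>2) = expectation (\<lambda>\<omega>. ((\<bar>x\<bar> + 1) + (?p n \<omega> + ?m n \<omega>))\<^sup>2)"
        using elim by (simp add: N_def)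
      also have "\<dots> \<le> 2 * expectation (\<lambda>\<omega>. (\<bar>x\<bar> + 1)\<^sup>2) + 2 * expectation (\<lambda>\<omega>. (?p n \<omega> + ?m n \<omega>)\<^sup>2)"
        using elim p(1) m(1) by (intro expectation_square_add_le square_integrable_const square_integrable_add) auto
      also have "\<dots> \<le> 2 * (\<bar>x\<bar> + 1)\<^sup>2 + 2 * (2 * (4 * t) + 2 * (4 * t))"
        using expectation_square_add_le[OF p(1)[OF elim] m(1)[OF elim]] p(2)[OF elim] m(2)[OF elim]
        by (simp only: prob_space lebesgue_integral_const) (simp add: prob_space)
      finally show ?case using square_integrable_power2[OF N2] by simp
    qed
  qed auto
  from square_integrable_cmult[OF this, of "1 / \<beta>"] show ?thesis using \<beta> by simp
qed

lemma B_square_integrable: "0 \<le> t \<Longrightarrow> square_integrable M (B t)"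
proof (cases "t = 0")
  case True
  show ?thesis
    by (rule square_integrable_bound[OF square_integrable_const[of 0] B_measurable])
       (use start True in auto)
next
  case False
  assume "0 \<le> t"
  with False have t: "0 < t" by simp
  show ?thesis
    by (rule square_integrable_bound[OF increment_square_integrable[OF order_refl t] B_measurable])
       (use start t in auto)
qed

lemma X_square_integrable: "0 \<le> t \<Longrightarrow> square_integrable M (X t)"
proof -
  assume t: "0 \<le> t"
  have "square_integrable M (\<lambda>\<omega>. x + B t \<omega> + \<beta> * L t \<omega>)"
    using t by (intro square_integrable_add square_integrable_cmult square_integrable_const
        B_square_integrable L_square_integrable)
  then show ?thesis by (simp flip: X_eq)
qed

end

text \<open>Nonnegativity of the variance gives the Cauchy-Schwarz bound: the squared mean of
  \<open>a * T n\<close> is at most \<open>c\<^sup>2\<close> times the second moment of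
  \<open>T n\<close>.\<close>

lemma (in prob_space) expectation_mult_tendsto_0:
  assumes T: "\<forall>\<^sub>F n in sequentially. square_integrable M (T n)"
    and lim: "(\<lambda>n. expectation (\<lambda>\<omega>. (T n \<omega>)\<^sup>2)) \<longlonglongrightarrow> 0"
    and a[measurable]: "a \<in> borel_measurable M" and ac: "AE \<omega> in M. \<bar>a \<omega>\<bar> \<le> c"
  shows "(\<lambda>n. expectation (\<lambda>\<omega>. a \<omega> * T n \<omega>)) \<longlonglongrightarrow> 0"
proof (rule Lim_null_comparison)
  have "(\<lambda>n. sqrt (c\<^sup>2 * expectation (\<lambda>\<omega>. (T n \<omega>)\<^sup>2))) \<longlonglongrightarrow> sqrt (c\<^sup>2 * 0)"
    by (intro tendsto_intros lim)
  then show "(\<lambda>n. sqrt (c\<^sup>2 * expectation (\<lambda>\<omega>. (T n \<omega>)\<^sup>2))) \<longlonglongrightarrow> 0" by simp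
  show "\<forall>\<^sub>F n in sequentially. norm (expectation (\<lambda>\<omega>. a \<omega> * T n \<omega>))
      \<le> sqrt (c\<^sup>2 * expectation (\<lambda>\<omega>. (T n \<omega>)\<^sup>2))"
    using T
  proof eventually_elim
    case (elim n)
    have aT: "square_integrable M (\<lambda>\<omega>. a \<omega> * T n \<omega>)"
      by (rule square_integrable_bounded_mult[OF elim a ac])
    have "(expectation (\<lambda>\<omega>. a \<omega> * T n \<omega>))\<^sup>2 \<le> expectation (\<lambda>\<omega>. (a \<omega> * T n \<omega>)\<^sup>2)"
      using variance_eq[OF square_integrable_integrable[OF aT] square_integrable_power2[OF aT]]
        variance_positive[of "\<lambda>\<omega>. a \<omega> * T n \<omega>"] by simp
    also have "\<dots> \<le> expectation (\<lambda>\<omega>. c\<^sup>2 * (T n \<omega>)\<^sup>2)"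
    proof (rule integral_mono_AE)
      show "AE \<omega> in M. (a \<omega> * T n \<omega>)\<^sup>2 \<le> c\<^sup>2 * (T n \<omega>)\<^sup>2"
        using ac
      proof eventually_elim
        case (elim \<omega>)
        from power_mono[OF this, of 2] show ?case by (simp add: power_mult_distrib mult_right_mono)
      qed
    qed (use aT elim in \<open>auto simp: square_integrable_power2\<close>)
    finally have "(expectation (\<lambda>\<omega>. a \<omega> * T n \<omega>))\<^sup>2 \<le> c\<^sup>2 * expectation (\<lambda>\<omega>. (T n \<omega>)\<^sup>2)" by simp
    then show ?case by (simp add: real_le_rsqrt)
  qed
qed

context skew_process
begin

context
  fixes a b s t :: real
  assumes ab: "0 < a" "a < b" and st: "0 \<le> s" "s < t"
begin

text \<open>Ito's formula for the smoothed absolute value: the two terms other than the martingale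
  part and the local time error are of second order.\<close>

lemma smooth_tanaka:
  "\<exists>W. W \<in> borel_measurable M
    \<and> (AE \<omega> in M. W \<omega> = smooth_abs a b (X t \<omega>) - smooth_abs a b (X s \<omega>)
        - integral {s..t} (\<lambda>u. trapezoid a b (X u \<omega>) / 2))
    \<and> square_integrable M W
    \<and> expectation (\<lambda>\<omega>. (W \<omega>)\<^sup>2) \<le> 4 * (t - s) + 4 * (\<beta>\<^sup>2 * expectation (\<lambda>\<omega>. (L t \<omega>)\<^sup>2)) + 1
    \<and> (\<forall>u c. u \<in> borel_measurable (F s) \<longrightarrow> (AE \<omega> in M. \<bar>u \<omega>\<bar> \<le> c) \<longrightarrow>
        expectation (\<lambda>\<omega>. u \<omega> * W \<omega>) = 0)"
proof -
  define \<tau> where "\<tau> n k = grid s t n k" for n k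
  define h where "h n = (t - s) / real n" for n
  define \<Delta> where "\<Delta> n k \<omega> = B (\<tau> n (Suc k)) \<omega> - B (\<tau> n k) \<omega>" for n k \<omega>
  define f where "f = smooth_abs a b"
  define f1 where "f1 = smooth_sgn a b"
  define f2 where "f2 u = trapezoid a b u / 2" for u
  \<comment> \<open>Each step from \<open>X (\<tau> n k)\<close> is split into a Brownian move and a
    push by the local time. \<open>T1\<close> is the martingale part, \<open>T2\<close> the
    fluctuation of squared increments about the mesh, \<open>T3\<close> the Taylor remainder,
    \<open>T4\<close> the effect of the pushes.\<close>
  define T1 where "T1 n \<omega> = (\<Sum>k<n. f1 (X (\<tau> n k) \<omega>) * \<Delta> n k \<omega>)" for n \<omega>
  define T2 where "T2 n \<omega> = (\<Sum>k<n. f2 (X (\<tau> n k) \<omega>) * ((\<Delta> n k \<omega>)\<^sup>2 - h n))" for n \<omega>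
  define T3 where "T3 n \<omega> = (\<Sum>k<n. f (X (\<tau> n k) \<omega> + \<Delta> n k \<omega>) - f (X (\<tau> n k) \<omega>)
      - f1 (X (\<tau> n k) \<omega>) * \<Delta> n k \<omega> - f2 (X (\<tau> n k) \<omega>) * (\<Delta> n k \<omega>)\<^sup>2)" for n \<omega>
  define T4 where "T4 n \<omega> = (\<Sum>k<n. f (X (\<tau> n (Suc k)) \<omega>) - f (X (\<tau> n k) \<omega> + \<Delta> n k \<omega>))" for n \<omega>
  define N where "N n \<omega> = f (X t \<omega>) - f (X s \<omega>) - (\<Sum>k<n. f2 (X (\<tau> n k) \<omega>) * h n)" for n \<omega>
  \<comment> \<open>Taking \<open>W\<close> as a limit of measurable functions makes it measurable
    at once; the path integral is identified with it only almost surely.\<close>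
  define W where "W \<omega> = lim (\<lambda>n. N n \<omega>)" for \<omega>
  define c2 where "c2 = 1 / (a + b)"
  define c3 where "c3 = 4 / ((b - a) * (a + b))"
  have h: "0 < h n" "real n * h n = t - s" if "0 < n" for n
    using that st by (auto simp: h_def)
  have \<tau>0: "0 \<le> \<tau> n k" for n k using st grid_ge[of s t n k] by (simp add: \<tau>_def)
  have \<tau>s: "\<tau> n 0 = s" for n by (simp add: \<tau>_def)
  have \<tau>less: "\<tau> n k < \<tau> n (Suc k)" and \<tau>d: "\<tau> n (Suc k) - \<tau> n k = h n" if "0 < n" for n k
    using that st by (auto simp: \<tau>_def grid_less_Suc grid_Suc h_def)
  have [measurable]: "f \<in> borel_measurable borel" "f1 \<in> borel_measurable borel" "f2 \<in> borel_measurable borel"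
  proof -
    have "continuous_on UNIV f" "continuous_on UNIV f1"
      unfolding f_def f1_def
      by (auto intro!: continuous_at_imp_continuous_on DERIV_isCont[OF DERIV_smooth_abs]
          DERIV_isCont[OF DERIV_smooth_sgn])
    moreover have "continuous_on UNIV f2" unfolding f2_def by (intro continuous_intros) auto
    ultimately
    show "f \<in> borel_measurable borel" "f1 \<in> borel_measurable borel" "f2 \<in> borel_measurable borel"
      by (auto intro: borel_measurable_continuous_onI)
  qed
  have XM[measurable]: "X (\<tau> n k) \<in> borel_measurable M" for n k by (rule X_measurable[OF \<tau>0])
  have XtsM[measurable]: "X t \<in> borel_measurable M" "X s \<in> borel_measurable M"
    using st by (auto intro: X_measurable)
  have BM[measurable]: "B (\<tau> n k) \<in> borel_measurable M" for n k by (rule B_measurable[OF \<tau>0])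
  have [measurable]: "\<Delta> n k \<in> borel_measurable M" for n k unfolding \<Delta>_def by measurable
  have NM[measurable]: "N n \<in> borel_measurable M" for n unfolding N_def by measurable
  have [measurable]: "T3 n \<in> borel_measurable M" "T4 n \<in> borel_measurable M" for n
    unfolding T3_def T4_def by measurable
  have [measurable]: "W \<in> borel_measurable M" unfolding W_def by measurable
  have LT: "square_integrable M (L t)" using st by (intro L_square_integrable) auto
  have f1X: "(\<lambda>\<omega>. f1 (X (\<tau> n k) \<omega>)) \<in> borel_measurable (F (\<tau> n k))"
    and f2X: "(\<lambda>\<omega>. f2 (X (\<tau> n k) \<omega>)) \<in> borel_measurable (F (\<tau> n k))" for n k
    by (rule measurable_compose[OF X_adapted[OF \<tau>0]]; measurable)+
  have f1b: "\<bar>f1 u\<bar> \<le> 1" and f2b: "\<bar>f2 u\<bar> \<le> c2" for u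
    using smooth_sgn_bound[OF ab, of u] trapezoid_bounds[OF ab, of u] by (auto simp: f1_def f2_def c2_def)

  have decomp: "N n \<omega> = (T1 n \<omega> + T2 n \<omega>) + (T3 n \<omega> + T4 n \<omega>)" if "0 < n" for n \<omega>
  proof -
    have "f (X t \<omega>) - f (X s \<omega>) = (\<Sum>k<n. f (X (\<tau> n (Suc k)) \<omega>) - f (X (\<tau> n k) \<omega>))"
      using sum_grid_diff[OF that, of "\<lambda>u. f (X u \<omega>)" s t] by (simp add: \<tau>_def)
    then show ?thesis
      unfolding N_def T1_def T2_def T3_def T4_def
      by (simp only: sum.distrib[symmetric] sum_subtractf[symmetric]) (simp add: algebra_simps)
  qed

  have T1: "square_integrable M (T1 n)" "expectation (\<lambda>\<omega>. (T1 n \<omega>)\<^sup>2) \<le> t - s" if n: "0 < n" for n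
  proof -
    have "square_integrable M (\<lambda>\<omega>. \<Sum>k<n. f1 (X (\<tau> n k) \<omega>) * (\<lambda>z. z) (B (\<tau> n (Suc k)) \<omega> - B (\<tau> n k) \<omega>))
      \<and> expectation (\<lambda>\<omega>. (\<Sum>k<n. f1 (X (\<tau> n k) \<omega>) * (\<lambda>z. z) (B (\<tau> n (Suc k)) \<omega> - B (\<tau> n k) \<omega>))\<^sup>2)
        \<le> real n * (1\<^sup>2 * h n)"
    proof (intro conjI; rule martingale_transform_sq[of "\<tau> n" "\<lambda>k \<omega>. f1 (X (\<tau> n k) \<omega>)" 1 "\<lambda>z. z"])
    qed (use n f1X f1b \<tau>0 \<tau>less increment_square_integrable[OF \<tau>0 \<tau>less[OF n]]
        increment_mean[OF \<tau>0 \<tau>less[OF n]] increment_moments(1)[OF \<tau>0 \<tau>less[OF n]] \<tau>d[OF n] in auto)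
    then show "square_integrable M (T1 n)" "expectation (\<lambda>\<omega>. (T1 n \<omega>)\<^sup>2) \<le> t - s"
      using h(2)[OF n] unfolding T1_def \<Delta>_def by simp_all
  qed

  \<comment> \<open>A squared increment has variance \<open>2 * (h n)\<^sup>2\<close>;
    \<open>n\<close> orthogonal terms of this size add up to order \<open>1 / n\<close>.\<close>
  have T2: "square_integrable M (T2 n)" "expectation (\<lambda>\<omega>. (T2 n \<omega>)\<^sup>2) \<le> 2 * c2\<^sup>2 * (t - s)\<^sup>2 / real n"
    if n: "0 < n" for n
  proof -
    let ?z = "\<lambda>k \<omega>. B (\<tau> n (Suc k)) \<omega> - B (\<tau> n k) \<omega>"
    note i2 = increment_power_integrable[OF \<tau>0 \<tau>less[OF n], of _ 2]
    note i4 = increment_power_integrable[OF \<tau>0 \<tau>less[OF n], of _ 4]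
    have sq: "((?z k \<omega>)\<^sup>2 - h n)\<^sup>2 = (?z k \<omega>) ^ 4 - 2 * h n * (?z k \<omega>)\<^sup>2 + (h n)\<^sup>2" for k \<omega>
      by (simp add: power2_eq_square power4_eq_xxxx algebra_simps)
    have "square_integrable M (\<lambda>\<omega>. (?z k \<omega>)\<^sup>2 - h n)" for k
      unfolding square_integrable_def sq using i2 i4 by auto
    moreover have "expectation (\<lambda>\<omega>. (?z k \<omega>)\<^sup>2 - h n) = 0" for k
      using i2 increment_moments(1)[OF \<tau>0 \<tau>less[OF n]] \<tau>d[OF n] by (simp add: prob_space)
    moreover have "expectation (\<lambda>\<omega>. ((?z k \<omega>)\<^sup>2 - h n)\<^sup>2) \<le> 2 * (h n)\<^sup>2" for k
      unfolding sq using i2 i4 increment_moments(1,2)[OF \<tau>0 \<tau>less[OF n]] \<tau>d[OF n]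
      by (simp add: prob_space power2_eq_square)
    ultimately have "square_integrable M (\<lambda>\<omega>. \<Sum>k<n. f2 (X (\<tau> n k) \<omega>) * (\<lambda>z. z\<^sup>2 - h n) (?z k \<omega>))
      \<and> expectation (\<lambda>\<omega>. (\<Sum>k<n. f2 (X (\<tau> n k) \<omega>) * (\<lambda>z. z\<^sup>2 - h n) (?z k \<omega>))\<^sup>2)
        \<le> real n * (c2\<^sup>2 * (2 * (h n)\<^sup>2))"
    proof (intro conjI; rule_tac martingale_transform_sq[of "\<tau> n" "\<lambda>k \<omega>. f2 (X (\<tau> n k) \<omega>)" c2 "\<lambda>z. z\<^sup>2 - h n"])
    qed (use n f2X f2b \<tau>0 \<tau>less in auto)
    moreover have "real n * (c2\<^sup>2 * (2 * (h n)\<^sup>2)) = 2 * c2\<^sup>2 * (t - s)\<^sup>2 / real n"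
      using n by (simp add: h_def power_divide power2_eq_square)
    ultimately show "square_integrable M (T2 n)"
      "expectation (\<lambda>\<omega>. (T2 n \<omega>)\<^sup>2) \<le> 2 * c2\<^sup>2 * (t - s)\<^sup>2 / real n"
      unfolding T2_def \<Delta>_def by simp_all
  qed

  \<comment> \<open>Cauchy-Schwarz for the sum costs a factor \<open>n\<close>, and \<open>n\<close>
    sixth moments \<open>15 * (h n) ^ 3\<close> leave order \<open>1 / n\<close>.\<close>
  have T3: "square_integrable M (T3 n)" "expectation (\<lambda>\<omega>. (T3 n \<omega>)\<^sup>2) \<le> 15 * c3\<^sup>2 * (t - s) ^ 3 / real n"
    if n: "0 < n" for n
  proof -
    let ?V = "\<lambda>\<omega>. c3\<^sup>2 * (real n * (\<Sum>k<n. (\<Delta> n k \<omega>) ^ 6))"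
    have V: "integrable M ?V"
      using increment_power_integrable[OF \<tau>0 \<tau>less[OF n]] by (auto simp: \<Delta>_def)
    have EV: "expectation ?V = 15 * c3\<^sup>2 * (t - s) ^ 3 / real n"
    proof -
      have "expectation ?V = c3\<^sup>2 * (real n * (\<Sum>k<n. 15 * (h n) ^ 3))"
        using increment_power_integrable[OF \<tau>0 \<tau>less[OF n]]
        by (simp add: \<Delta>_def increment_moments(3)[OF \<tau>0 \<tau>less[OF n]] \<tau>d[OF n])
      also have "\<dots> = 15 * c3\<^sup>2 * (t - s) ^ 3 / real n"
        using n by (simp add: h_def power_divide power3_eq_cube)
      finally show ?thesis .
    qed
    have le: "(T3 n \<omega>)\<^sup>2 \<le> ?V \<omega>" for \<omega>
    proof -
      have "\<bar>T3 n \<omega>\<bar> \<le> (\<Sum>k<n. c3 * \<bar>\<Delta> n k \<omega>\<bar> ^ 3)"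
        unfolding T3_def
      proof (rule order_trans[OF sum_abs], rule sum_mono)
        fix k
        show "\<bar>f (X (\<tau> n k) \<omega> + \<Delta> n k \<omega>) - f (X (\<tau> n k) \<omega>) - f1 (X (\<tau> n k) \<omega>) * \<Delta> n k \<omega>
            - f2 (X (\<tau> n k) \<omega>) * (\<Delta> n k \<omega>)\<^sup>2\<bar> \<le> c3 * \<bar>\<Delta> n k \<omega>\<bar> ^ 3"
          unfolding f_def f1_def f2_def c3_def by (rule smooth_abs_taylor[OF ab])
      qed
      also have "\<dots> = c3 * (\<Sum>k<n. \<bar>\<Delta> n k \<omega>\<bar> ^ 3)" by (simp add: sum_distrib_left)
      finally have "\<bar>T3 n \<omega>\<bar>\<^sup>2 \<le> (c3 * (\<Sum>k<n. \<bar>\<Delta> n k \<omega>\<bar> ^ 3))\<^sup>2" by (rule power_mono) simp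
      also have "\<dots> = c3\<^sup>2 * (\<Sum>k<n. \<bar>\<Delta> n k \<omega>\<bar> ^ 3)\<^sup>2" by (simp add: power_mult_distrib)
      also have "\<dots> \<le> c3\<^sup>2 * ((\<Sum>k<n. (\<bar>\<Delta> n k \<omega>\<bar> ^ 3)\<^sup>2) * real (card {..<n}))"
        by (intro mult_left_mono sum_squared_le_sum_of_squares) auto
      also have "\<dots> = ?V \<omega>" by (simp flip: power_mult add: mult.commute)
      finally show ?thesis by simp
    qed
    have int: "integrable M (\<lambda>\<omega>. (T3 n \<omega>)\<^sup>2)"
      by (rule Bochner_Integration.integrable_bound[OF V])
         (use le in \<open>auto intro!: AE_I2 order_trans[OF _ abs_ge_self]\<close>)
    then show "square_integrable M (T3 n)" by (simp add: square_integrable_def)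
    have "expectation (\<lambda>\<omega>. (T3 n \<omega>)\<^sup>2) \<le> expectation ?V"
      by (rule integral_mono[OF int V le])
    then show "expectation (\<lambda>\<omega>. (T3 n \<omega>)\<^sup>2) \<le> 15 * c3\<^sup>2 * (t - s) ^ 3 / real n"
      unfolding EV .
  qed

  have T4le: "AE \<omega> in M. \<bar>T4 n \<omega>\<bar> \<le> \<bar>\<beta> * L t \<omega>\<bar>" for n
    using AE_path
  proof eventually_elim
    case (elim \<omega>)
    then interpret skew_path \<beta> x "\<lambda>t. X t \<omega>" "\<lambda>t. B t \<omega>" "\<lambda>t. L t \<omega>" .
    show ?case
    proof (cases "n = 0")
      case False
      have "\<bar>T4 n \<omega>\<bar> \<le> \<bar>\<beta>\<bar> * (L t \<omega> - L s \<omega>)"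
        unfolding T4_def \<Delta>_def \<tau>_def f_def using False
        by (intro order_trans[OF sum_abs] local_time_error_le[OF ab st]) simp
      also have "\<dots> \<le> \<bar>\<beta>\<bar> * L t \<omega>" using L_nonneg[OF st(1)] by (intro mult_left_mono) auto
      finally show ?thesis using L_nonneg[of t] st by (simp add: abs_mult)
    qed (simp add: T4_def)
  qed
  have \<beta>L: "square_integrable M (\<lambda>\<omega>. \<beta> * L t \<omega>)" by (rule square_integrable_cmult[OF LT])
  have T4: "square_integrable M (T4 n)" "expectation (\<lambda>\<omega>. (T4 n \<omega>)\<^sup>2) \<le> \<beta>\<^sup>2 * expectation (\<lambda>\<omega>. (L t \<omega>)\<^sup>2)" for n
  proof -
    show T4: "square_integrable M (T4 n)"
      by (rule square_integrable_bound[OF \<beta>L _ T4le]) measurable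
    have "expectation (\<lambda>\<omega>. (T4 n \<omega>)\<^sup>2) \<le> expectation (\<lambda>\<omega>. (\<beta> * L t \<omega>)\<^sup>2)"
    proof (rule integral_mono_AE[OF square_integrable_power2[OF T4] square_integrable_power2[OF \<beta>L]])
      show "AE \<omega> in M. (T4 n \<omega>)\<^sup>2 \<le> (\<beta> * L t \<omega>)\<^sup>2"
        using T4le[of n] by eventually_elim (simp add: abs_le_square_iff)
    qed
    then show "expectation (\<lambda>\<omega>. (T4 n \<omega>)\<^sup>2) \<le> \<beta>\<^sup>2 * expectation (\<lambda>\<omega>. (L t \<omega>)\<^sup>2)"
      by (simp add: power_mult_distrib)
  qed

  have N2: "square_integrable M (N n)" if "0 < n" for n
  proof -
    have "square_integrable M (\<lambda>\<omega>. (T1 n \<omega> + T2 n \<omega>) + (T3 n \<omega> + T4 n \<omega>))"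
      by (intro square_integrable_add T1 T2 T3 T4 that)
    then show ?thesis by (simp flip: decomp[OF that])
  qed
  \<comment> \<open>The constants \<open>c2\<close> and \<open>c3\<close> depend on the smoothing,
    but their terms fade as \<open>n\<close> grows and are eventually absorbed in the summand 1 of
    \<open>K\<close>. So \<open>K\<close> is independent of \<open>a\<close> and \<open>b\<close>,
    which allows the smoothing to be removed later.\<close>
  have "(\<lambda>n. 4 * (2 * c2\<^sup>2 * (t - s)\<^sup>2 / real n) + 4 * (15 * c3\<^sup>2 * (t - s) ^ 3 / real n)) \<longlonglongrightarrow> 4 * 0 + 4 * 0"
    by (intro tendsto_intros lim_const_over_n)
  then have ev: "\<forall>\<^sub>F n in sequentially.
      4 * (2 * c2\<^sup>2 * (t - s)\<^sup>2 / real n) + 4 * (15 * c3\<^sup>2 * (t - s) ^ 3 / real n) < 1"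
    by (rule order_tendstoD) simp
  define K where "K = 4 * (t - s) + 4 * (\<beta>\<^sup>2 * expectation (\<lambda>\<omega>. (L t \<omega>)\<^sup>2)) + 1"
  have bd: "\<forall>\<^sub>F n in sequentially. square_integrable M (N n) \<and> expectation (\<lambda>\<omega>. (N n \<omega>)\<^sup>2) \<le> K"
    using ev eventually_gt_at_top[of 0]
  proof eventually_elim
    case (elim n)
    then have n: "0 < n" by simp
    have "expectation (\<lambda>\<omega>. (N n \<omega>)\<^sup>2) \<le>
        2 * expectation (\<lambda>\<omega>. (T1 n \<omega> + T2 n \<omega>)\<^sup>2) + 2 * expectation (\<lambda>\<omega>. (T3 n \<omega> + T4 n \<omega>)\<^sup>2)"
      unfolding decomp[OF n]
      by (intro expectation_square_add_le square_integrable_add T1 T2 T3 T4 n)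
    moreover have "expectation (\<lambda>\<omega>. (T1 n \<omega> + T2 n \<omega>)\<^sup>2) \<le>
        2 * expectation (\<lambda>\<omega>. (T1 n \<omega>)\<^sup>2) + 2 * expectation (\<lambda>\<omega>. (T2 n \<omega>)\<^sup>2)"
      by (intro expectation_square_add_le T1 T2 n)
    moreover have "expectation (\<lambda>\<omega>. (T3 n \<omega> + T4 n \<omega>)\<^sup>2) \<le>
        2 * expectation (\<lambda>\<omega>. (T3 n \<omega>)\<^sup>2) + 2 * expectation (\<lambda>\<omega>. (T4 n \<omega>)\<^sup>2)"
      by (intro expectation_square_add_le T3 T4 n)
    moreover have "e \<le> 4 * p1 + 4 * p4 + 1"
      if "e \<le> 2 * e12 + 2 * e34" "e12 \<le> 2 * e1 + 2 * e2" "e34 \<le> 2 * e3 + 2 * e4"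
        "e1 \<le> p1" "e2 \<le> p2" "e3 \<le> p3" "e4 \<le> p4" "4 * p2 + 4 * p3 < 1"
      for e e12 e34 e1 e2 e3 e4 p1 p2 p3 p4 :: real
      using that by linarith
    ultimately have "expectation (\<lambda>\<omega>. (N n \<omega>)\<^sup>2) \<le> K"
      using T1(2)[OF n] T2(2)[OF n] T3(2)[OF n] T4(2)[of n] elim(1) unfolding K_def by blast
    then show ?case using N2[OF n] by simp
  qed

  have limN: "AE \<omega> in M. (\<lambda>n. N n \<omega>) \<longlonglongrightarrow> f (X t \<omega>) - f (X s \<omega>) - integral {s..t} (\<lambda>u. f2 (X u \<omega>))"
    using AE_path
  proof eventually_elim
    case (elim \<omega>)
    then interpret skew_path \<beta> x "\<lambda>t. X t \<omega>" "\<lambda>t. B t \<omega>" "\<lambda>t. L t \<omega>" .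
    have "continuous_on {s..t} (\<lambda>u. f2 (X u \<omega>))"
      unfolding f2_def using cont(1)[OF st(1)] by (intro continuous_intros) auto
    from riemann_sums_tendsto[OF less_imp_le[OF st(2)] this] show ?case
      unfolding N_def \<tau>_def h_def by (intro tendsto_intros)
  qed
  then have W: "AE \<omega> in M. W \<omega> = f (X t \<omega>) - f (X s \<omega>) - integral {s..t} (\<lambda>u. f2 (X u \<omega>))"
    unfolding W_def by eventually_elim (rule limI)
  from limN W have limW: "AE \<omega> in M. (\<lambda>n. N n \<omega>) \<longlonglongrightarrow> W \<omega>"
    by eventually_elim simp
  note conv = L2_bounded_convergence[OF NM \<open>W \<in> borel_measurable M\<close> limW bd]
  have "expectation (\<lambda>\<omega>. u \<omega> * W \<omega>) = 0"
    if u: "u \<in> borel_measurable (F s)" and uc: "AE \<omega> in M. \<bar>u \<omega>\<bar> \<le> c" for u c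
  proof (rule LIMSEQ_unique)
    have uM[measurable]: "u \<in> borel_measurable M" by (rule measurable_F_M[OF st(1) u])
    show "(\<lambda>n. expectation (\<lambda>\<omega>. u \<omega> * N n \<omega>)) \<longlonglongrightarrow> expectation (\<lambda>\<omega>. u \<omega> * W \<omega>)"
      by (rule conv(3)[OF uM uc])
    have uT: "integrable M (\<lambda>\<omega>. u \<omega> * T \<omega>)" if "square_integrable M T" for T
      by (rule square_integrable_integrable[OF square_integrable_bounded_mult[OF that uM uc]])
    \<comment> \<open>\<open>T1\<close> is exactly orthogonal to \<open>u\<close>, \<open>T2\<close>
      and \<open>T3\<close> vanish in mean square, and \<open>T4\<close> vanishes by dominated
      convergence.\<close>
    have 1: "expectation (\<lambda>\<omega>. u \<omega> * T1 n \<omega>) = 0" if n: "0 < n" for n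
    proof -
      have "expectation (\<lambda>\<omega>. u \<omega> * (\<Sum>k<n. f1 (X (\<tau> n k) \<omega>) * (\<lambda>z. z) (B (\<tau> n (Suc k)) \<omega> - B (\<tau> n k) \<omega>))) = 0"
        by (rule martingale_transform_mean(2)[of "\<tau> n" u c "\<lambda>k \<omega>. f1 (X (\<tau> n k) \<omega>)" 1 "\<lambda>z. z"])
           (use n u uc st(1) f1X f1b \<tau>0 \<tau>s \<tau>less square_integrable_integrable[OF increment_square_integrable[OF \<tau>0 \<tau>less[OF n]]]
             increment_mean[OF \<tau>0 \<tau>less[OF n]] in auto)
      then show ?thesis by (simp add: T1_def \<Delta>_def)
    qed
    have 2: "(\<lambda>n. expectation (\<lambda>\<omega>. u \<omega> * T2 n \<omega>)) \<longlonglongrightarrow> 0"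
    proof (rule expectation_mult_tendsto_0[OF _ _ uM uc])
      show "\<forall>\<^sub>F n in sequentially. square_integrable M (T2 n)"
        using eventually_gt_at_top[of 0] by eventually_elim (rule T2)
      show "(\<lambda>n. expectation (\<lambda>\<omega>. (T2 n \<omega>)\<^sup>2)) \<longlonglongrightarrow> 0"
      proof (rule tendsto_sandwich[OF _ _ tendsto_const lim_const_over_n])
        show "\<forall>\<^sub>F n in sequentially. expectation (\<lambda>\<omega>. (T2 n \<omega>)\<^sup>2) \<le> 2 * c2\<^sup>2 * (t - s)\<^sup>2 / real n"
          using eventually_gt_at_top[of 0] by eventually_elim (rule T2)
      qed (auto intro!: always_eventually Bochner_Integration.integral_nonneg)
    qed
    have 3: "(\<lambda>n. expectation (\<lambda>\<omega>. u \<omega> * T3 n \<omega>)) \<longlonglongrightarrow> 0"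
    proof (rule expectation_mult_tendsto_0[OF _ _ uM uc])
      show "\<forall>\<^sub>F n in sequentially. square_integrable M (T3 n)"
        using eventually_gt_at_top[of 0] by eventually_elim (rule T3)
      show "(\<lambda>n. expectation (\<lambda>\<omega>. (T3 n \<omega>)\<^sup>2)) \<longlonglongrightarrow> 0"
      proof (rule tendsto_sandwich[OF _ _ tendsto_const lim_const_over_n])
        show "\<forall>\<^sub>F n in sequentially. expectation (\<lambda>\<omega>. (T3 n \<omega>)\<^sup>2) \<le> 15 * c3\<^sup>2 * (t - s) ^ 3 / real n"
          using eventually_gt_at_top[of 0] by eventually_elim (rule T3)
      qed (auto intro!: always_eventually Bochner_Integration.integral_nonneg)
    qed
    have 4: "(\<lambda>n. expectation (\<lambda>\<omega>. u \<omega> * T4 n \<omega>)) \<longlonglongrightarrow> expectation (\<lambda>\<omega>. 0)"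
    proof (rule integral_dominated_convergence[where w="\<lambda>\<omega>. c * \<bar>\<beta> * L t \<omega>\<bar>"])
      show "integrable M (\<lambda>\<omega>. c * \<bar>\<beta> * L t \<omega>\<bar>)"
        using integrable_abs[OF square_integrable_integrable[OF \<beta>L]] by (rule integrable_mult_right)
      show "AE \<omega> in M. norm (u \<omega> * T4 n \<omega>) \<le> c * \<bar>\<beta> * L t \<omega>\<bar>" for n
        using uc T4le[of n] by eventually_elim (auto simp: abs_mult intro!: mult_mono)
      show "AE \<omega> in M. (\<lambda>n. u \<omega> * T4 n \<omega>) \<longlonglongrightarrow> 0"
        using AE_path
      proof eventually_elim
        case (elim \<omega>)
        then interpret skew_path \<beta> x "\<lambda>t. X t \<omega>" "\<lambda>t. B t \<omega>" "\<lambda>t. L t \<omega>" .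
        from tendsto_mult_left[OF local_time_error_tendsto[OF ab st], of "u \<omega>"] show ?case
          by (simp add: T4_def \<Delta>_def \<tau>_def f_def)
      qed
    qed measurable
    have "(\<lambda>n. expectation (\<lambda>\<omega>. u \<omega> * T2 n \<omega>) + (expectation (\<lambda>\<omega>. u \<omega> * T3 n \<omega>)
        + expectation (\<lambda>\<omega>. u \<omega> * T4 n \<omega>))) \<longlonglongrightarrow> 0"
      using tendsto_add[OF 2 tendsto_add[OF 3 4]] by simp
    then show "(\<lambda>n. expectation (\<lambda>\<omega>. u \<omega> * N n \<omega>)) \<longlonglongrightarrow> 0"
    proof (rule Lim_transform_eventually)
      show "\<forall>\<^sub>F n in sequentially. expectation (\<lambda>\<omega>. u \<omega> * T2 n \<omega>) + (expectation (\<lambda>\<omega>. u \<omega> * T3 n \<omega>)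
        + expectation (\<lambda>\<omega>. u \<omega> * T4 n \<omega>)) = expectation (\<lambda>\<omega>. u \<omega> * N n \<omega>)"
        using eventually_gt_at_top[of 0]
      proof eventually_elim
        case (elim n)
        then show ?case
          using uT[OF T1(1)] uT[OF T2(1)] uT[OF T3(1)] uT[OF T4(1)]
          by (simp add: decomp distrib_left 1)
      qed
    qed
  qed
  then show ?thesis
    using conv(1,2) W unfolding f_def f2_def K_def
    by (intro exI[of _ W]) auto
qed

end

end

section \<open>Removal of the smoothing\<close>

context skew_process
begin

lemma abs_minus_local_time_square_integrable:
  "0 \<le> t \<Longrightarrow> square_integrable M (\<lambda>\<omega>. \<bar>X t \<omega>\<bar> - L t \<omega>)"
  by (intro square_integrable_diff square_integrable_abs X_square_integrable L_square_integrable)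

text \<open>The second moment bound in \<open>smooth_tanaka\<close> does not involve the smoothing
  parameters, so \<open>L2_bounded_convergence\<close> carries orthogonality to \<open>u\<close>
  over to the limit, in which \<open>smooth_abs\<close> becomes the absolute value and the trapezoid
  integral becomes the local time.\<close>

lemma tanaka:
  assumes st: "0 \<le> s" "s \<le> t" and u: "u \<in> borel_measurable (F s)" and uc: "AE \<omega> in M. \<bar>u \<omega>\<bar> \<le> c"
  shows "expectation (\<lambda>\<omega>. u \<omega> * ((\<bar>X t \<omega>\<bar> - L t \<omega>) - (\<bar>X s \<omega>\<bar> - L s \<omega>))) = 0"
proof (cases "s < t")
  case True
  define e where "e j = inverse (real (Suc j))" for j
  have e0: "0 < e j" for j by (simp add: e_def)
  have e_lim: "e \<longlonglongrightarrow> 0" unfolding e_def by (rule LIMSEQ_inverse_real_of_nat)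
  have e_right: "filterlim e (at_right 0) sequentially"
    unfolding filterlim_at using e_lim e0 by (auto simp: less_imp_neq[OF e0, symmetric])
  \<comment> \<open>The pair of widths for which \<open>trapezoid_integral_tendsto\<close>
    identifies the limit.\<close>
  define b where "b j = e j + (e j)\<^sup>2" for j
  have eb: "e j < b j" for j using e0[of j] by (simp add: b_def)
  have b_lim: "(\<lambda>j. 2 * b j) \<longlonglongrightarrow> 0"
    unfolding b_def using e_lim by (auto intro!: tendsto_eq_intros)
  define K where "K = 4 * (t - s) + 4 * (\<beta>\<^sup>2 * expectation (\<lambda>\<omega>. (L t \<omega>)\<^sup>2)) + 1"
  define P where "P j V \<longleftrightarrow> V \<in> borel_measurable M
    \<and> (AE \<omega> in M. V \<omega> = smooth_abs (e j) (b j) (X t \<omega>) - smooth_abs (e j) (b j) (X s \<omega>)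
        - integral {s..t} (\<lambda>u. trapezoid (e j) (b j) (X u \<omega>) / 2))
    \<and> square_integrable M V \<and> expectation (\<lambda>\<omega>. (V \<omega>)\<^sup>2) \<le> K
    \<and> (\<forall>u c. u \<in> borel_measurable (F s) \<longrightarrow> (AE \<omega> in M. \<bar>u \<omega>\<bar> \<le> c) \<longrightarrow>
        expectation (\<lambda>\<omega>. u \<omega> * V \<omega>) = 0)" for j V
  have "\<forall>j. \<exists>V. P j V"
    unfolding P_def K_def by (rule allI, rule smooth_tanaka[OF e0 eb st(1) True])
  from choice[OF this] obtain V where "\<forall>j. P j (V j)" ..
  then have V: "\<And>j. V j \<in> borel_measurable M"
    "\<And>j. AE \<omega> in M. V j \<omega> = smooth_abs (e j) (b j) (X t \<omega>) - smooth_abs (e j) (b j) (X s \<omega>)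
        - integral {s..t} (\<lambda>u. trapezoid (e j) (b j) (X u \<omega>) / 2)"
    "\<And>j. square_integrable M (V j)" "\<And>j. expectation (\<lambda>\<omega>. (V j \<omega>)\<^sup>2) \<le> K"
    "\<And>j u c. u \<in> borel_measurable (F s) \<Longrightarrow> AE \<omega> in M. \<bar>u \<omega>\<bar> \<le> c \<Longrightarrow>
        expectation (\<lambda>\<omega>. u \<omega> * V j \<omega>) = 0"
    unfolding P_def by blast+
  define W where "W \<omega> = (\<bar>X t \<omega>\<bar> - L t \<omega>) - (\<bar>X s \<omega>\<bar> - L s \<omega>)" for \<omega>
  have t: "0 \<le> t" using st by simp
  have [measurable]: "X t \<in> borel_measurable M" "X s \<in> borel_measurable M"
    "L t \<in> borel_measurable M" "L s \<in> borel_measurable M"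
    using st t by (auto intro: X_measurable L_measurable)
  have W: "W \<in> borel_measurable M" unfolding W_def by measurable
  have "AE \<omega> in M. \<forall>j. V j \<omega> = smooth_abs (e j) (b j) (X t \<omega>) - smooth_abs (e j) (b j) (X s \<omega>)
        - integral {s..t} (\<lambda>u. trapezoid (e j) (b j) (X u \<omega>) / 2)"
    unfolding AE_all_countable using V(2) by blast
  with AE_path have lim: "AE \<omega> in M. (\<lambda>j. V j \<omega>) \<longlonglongrightarrow> W \<omega>"
  proof eventually_elim
    case (elim \<omega>)
    then interpret skew_path \<beta> x "\<lambda>t. X t \<omega>" "\<lambda>t. B t \<omega>" "\<lambda>t. L t \<omega>" by simp
    have abs_lim: "(\<lambda>j. smooth_abs (e j) (b j) v) \<longlonglongrightarrow> \<bar>v\<bar>" for v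
    proof (rule LIM_zero_cancel, rule Lim_null_comparison[OF _ b_lim])
      show "\<forall>\<^sub>F j in sequentially. norm (smooth_abs (e j) (b j) v - \<bar>v\<bar>) \<le> 2 * b j"
        using smooth_abs_near_abs[OF e0 eb, of _ v] by simp
    qed
    have "(\<lambda>j. integral {s..t} (\<lambda>u. trapezoid (e j) (b j) (X u \<omega>) / 2)) \<longlonglongrightarrow> L t \<omega> - L s \<omega>"
      unfolding b_def
      by (rule filterlim_compose[OF trapezoid_integral_tendsto[OF occ X_cont st] e_right])
    with abs_lim have "(\<lambda>j. smooth_abs (e j) (b j) (X t \<omega>) - smooth_abs (e j) (b j) (X s \<omega>)
        - integral {s..t} (\<lambda>u. trapezoid (e j) (b j) (X u \<omega>) / 2))
        \<longlonglongrightarrow> \<bar>X t \<omega>\<bar> - \<bar>X s \<omega>\<bar> - (L t \<omega> - L s \<omega>)"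
      by (intro tendsto_diff)
    moreover have "(\<lambda>j. V j \<omega>) = (\<lambda>j. smooth_abs (e j) (b j) (X t \<omega>) - smooth_abs (e j) (b j) (X s \<omega>)
        - integral {s..t} (\<lambda>u. trapezoid (e j) (b j) (X u \<omega>) / 2))"
      by (intro ext) (rule elim(2)[rule_format])
    moreover have "W \<omega> = \<bar>X t \<omega>\<bar> - \<bar>X s \<omega>\<bar> - (L t \<omega> - L s \<omega>)" by (simp add: W_def)
    ultimately show ?case by (simp only:)
  qed
  have uM: "u \<in> borel_measurable M" by (rule measurable_F_M[OF st(1) u])
  have "(\<lambda>j. expectation (\<lambda>\<omega>. u \<omega> * V j \<omega>)) \<longlonglongrightarrow> expectation (\<lambda>\<omega>. u \<omega> * W \<omega>)"
    by (rule L2_bounded_convergence(3)[where K=K, OF V(1) W lim _ uM uc]) (use V(3,4) in auto)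
  then have "expectation (\<lambda>\<omega>. u \<omega> * W \<omega>) = 0"
    using V(5)[OF u uc] by (simp add: LIMSEQ_const_iff)
  then show ?thesis by (simp add: W_def)
qed (use st in simp)

end

section \<open>Unboundedness of the local time\<close>

lemma exp_minus_le: "0 \<le> d \<Longrightarrow> exp (- d) \<le> 1 - d + d\<^sup>2" for d :: real
proof -
  assume d: "0 \<le> d"
  have "exp (- d) \<le> 1 / (1 + d)"
    using exp_ge_add_one_self[of d] d by (simp add: exp_minus inverse_eq_divide frac_le)
  \<comment> \<open>The product equals \<open>1 + d ^ 3\<close>.\<close>
  also have "1 \<le> (1 - d + d\<^sup>2) * (1 + d)"
    using d by (simp add: algebra_simps power2_eq_square)
  then have "1 / (1 + d) \<le> 1 - d + d\<^sup>2" using d by (simp add: pos_divide_le_eq)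
  finally show ?thesis .
qed

lemma (in skew_path) sum_sq_le:
  assumes "0 < t" "0 < n"
  shows "(\<Sum>k<n. (L (grid 0 t n (Suc k)) - L (grid 0 t n k))\<^sup>2) \<le> (L t)\<^sup>2"
proof -
  have "(\<Sum>k<n. (L (grid 0 t n (Suc k)) - L (grid 0 t n k))\<^sup>2)
      \<le> (\<Sum>k<n. L t * (L (grid 0 t n (Suc k)) - L (grid 0 t n k)))"
  proof (rule sum_mono)
    fix k assume "k \<in> {..<n}"
    then have k: "0 \<le> grid 0 t n k" "grid 0 t n k \<le> grid 0 t n (Suc k)" "grid 0 t n (Suc k) \<le> t"
      using assms by (auto intro: grid_ge grid_mono grid_le)
    have "L (grid 0 t n (Suc k)) - L (grid 0 t n k) \<le> L t"
      using L_le[of "grid 0 t n (Suc k)" t] L_nonneg[OF k(1)] k by simp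
    then show "(L (grid 0 t n (Suc k)) - L (grid 0 t n k))\<^sup>2 \<le> L t * (L (grid 0 t n (Suc k)) - L (grid 0 t n k))"
      using L_le[OF k(1,2)] by (simp add: power2_eq_square mult_right_mono)
  qed
  also have "\<dots> = (L t)\<^sup>2"
    using assms by (simp add: sum_distrib_left[symmetric] sum_grid_diff L_0 power2_eq_square)
  finally show ?thesis .
qed

text \<open>A continuous monotone path has zero quadratic variation. These sums are the
  discretisation error of the exponential supermartingale, and \<open>sum_sq_le\<close> dominates
  them.\<close>

lemma (in skew_path) sum_sq_tendsto_0:
  assumes t: "0 < t"
  shows "(\<lambda>n. \<Sum>k<n. (L (grid 0 t n (Suc k)) - L (grid 0 t n k))\<^sup>2) \<longlonglongrightarrow> 0"
proof (rule LIMSEQ_I)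
  fix r :: real assume r: "0 < r"
  define e where "e = r / (L t + 1)"
  have Lt: "0 \<le> L t" using t by (intro L_nonneg) simp
  have e: "0 < e" "e * L t < r"
  proof -
    show "0 < e" using r Lt by (simp add: e_def)
    then have "e * L t < e * (L t + 1)" by simp
    also have "\<dots> = r" using Lt by (simp add: e_def)
    finally show "e * L t < r" .
  qed
  have "\<forall>\<^sub>F n in sequentially. norm ((\<Sum>k<n. (L (grid 0 t n (Suc k)) - L (grid 0 t n k))\<^sup>2) - 0) < r"
    using eventually_grid_oscillation[OF less_imp_le[OF t] cont(2)[OF order_refl] e(1)]
  proof eventually_elim
    case (elim n)
    have "(\<Sum>k<n. (L (grid 0 t n (Suc k)) - L (grid 0 t n k))\<^sup>2)
        \<le> (\<Sum>k<n. e * (L (grid 0 t n (Suc k)) - L (grid 0 t n k)))"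
    proof (rule sum_mono)
      fix k assume "k \<in> {..<n}"
      then have k: "k < n" "0 \<le> grid 0 t n k" "grid 0 t n k \<le> grid 0 t n (Suc k)"
        using t by (auto intro: grid_ge grid_mono)
      then have "\<bar>L (grid 0 t n (Suc k)) - L (grid 0 t n k)\<bar> \<le> e" using elim by auto
      then show "(L (grid 0 t n (Suc k)) - L (grid 0 t n k))\<^sup>2 \<le> e * (L (grid 0 t n (Suc k)) - L (grid 0 t n k))"
        using L_le[OF k(2,3)] by (simp add: power2_eq_square mult_right_mono)
    qed
    also have "\<dots> = e * L t"
      using elim by (simp add: sum_distrib_left[symmetric] sum_grid_diff L_0)
    finally show ?case using e by (simp add: sum_nonneg)
  qed
  then show "\<exists>N. \<forall>n\<ge>N. norm ((\<Sum>k<n. (L (grid 0 t n (Suc k)) - L (grid 0 t n k))\<^sup>2) - 0) < r"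
    by (simp add: eventually_sequentially)
qed

context skew_process
begin

text \<open>The process \<open>(1 + \<bar>X\<bar>) exp (- L)\<close> is a supermartingale because \<open>\<bar>X\<bar> - L\<close> is a martingale.\<close>

lemma exp_local_time_supermartingale:
  assumes t: "0 < t"
  shows "integrable M (\<lambda>\<omega>. (1 + \<bar>X t \<omega>\<bar>) * exp (- L t \<omega>))"
    and "expectation (\<lambda>\<omega>. (1 + \<bar>X t \<omega>\<bar>) * exp (- L t \<omega>)) \<le> 1 + \<bar>x\<bar>"
proof -
  define \<tau> where "\<tau> n k = grid 0 t n k" for n k
  define W where "W s \<omega> = \<bar>X s \<omega>\<bar> - L s \<omega>" for s \<omega>
  define Q where "Q n \<omega> = (\<Sum>k<n. (L (\<tau> n (Suc k)) \<omega> - L (\<tau> n k) \<omega>)\<^sup>2)" for n \<omega>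
  define Z where "Z s \<omega> = (1 + \<bar>X s \<omega>\<bar>) * exp (- L s \<omega>)" for s \<omega>
  have t0: "0 \<le> t" using t by simp
  have \<tau>0: "0 \<le> \<tau> n k" for n k using t grid_ge[of 0 t n k] by (simp add: \<tau>_def)
  have \<tau>mono: "\<tau> n k \<le> \<tau> n (Suc k)" for n k using t by (simp add: \<tau>_def grid_mono)
  have [measurable]: "X t \<in> borel_measurable M" "L t \<in> borel_measurable M"
    using t by (auto intro: X_measurable L_measurable)
  have [measurable]: "L (\<tau> n k) \<in> borel_measurable M" for n k by (rule L_measurable[OF \<tau>0])
  have expb: "AE \<omega> in M. \<bar>exp (- L s \<omega>)\<bar> \<le> 1" if "0 \<le> s" for s
    using AE_path by eventually_elim (use that skew_path.L_nonneg in auto)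
  have "square_integrable M (\<lambda>\<omega>. exp (- L t \<omega>) * (1 + \<bar>X t \<omega>\<bar>))"
    by (rule square_integrable_bounded_mult[OF _ _ expb])
       (use t0 in \<open>auto intro!: square_integrable_add square_integrable_const square_integrable_abs X_square_integrable\<close>)
  then show Zi: "integrable M (\<lambda>\<omega>. (1 + \<bar>X t \<omega>\<bar>) * exp (- L t \<omega>))"
    using square_integrable_integrable by (simp add: mult.commute)
  have W2: "square_integrable M (\<lambda>\<omega>. W (\<tau> n (Suc k)) \<omega> - W (\<tau> n k) \<omega>)" for n k
    unfolding W_def by (intro square_integrable_diff square_integrable_abs \<tau>0
        X_square_integrable L_square_integrable)
  have eF: "(\<lambda>\<omega>. exp (- L (\<tau> n k) \<omega>)) \<in> borel_measurable (F (\<tau> n k))" for n k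
    by (rule measurable_compose[OF L_adapted[OF \<tau>0]]) measurable
  have mi: "integrable M (\<lambda>\<omega>. exp (- L (\<tau> n k) \<omega>) * (W (\<tau> n (Suc k)) \<omega> - W (\<tau> n k) \<omega>))" for n k
    by (rule square_integrable_integrable[OF square_integrable_bounded_mult[OF W2
            measurable_F_M[OF \<tau>0 eF] expb[OF \<tau>0]]])
  have m0: "expectation (\<lambda>\<omega>. exp (- L (\<tau> n k) \<omega>) * (W (\<tau> n (Suc k)) \<omega> - W (\<tau> n k) \<omega>)) = 0" for n k
    unfolding W_def by (rule tanaka[OF \<tau>0 \<tau>mono eF expb[OF \<tau>0]])
  have QL: "AE \<omega> in M. norm (Q n \<omega>) \<le> (L t \<omega>)\<^sup>2" for n
    using AE_path
  proof eventually_elim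
    case (elim \<omega>)
    then interpret skew_path \<beta> x "\<lambda>t. X t \<omega>" "\<lambda>t. B t \<omega>" "\<lambda>t. L t \<omega>" .
    show ?case
      using sum_sq_le[OF t, of n] by (cases "n = 0") (auto simp: Q_def \<tau>_def sum_nonneg)
  qed
  have L2: "integrable M (\<lambda>\<omega>. (L t \<omega>)\<^sup>2)" by (rule square_integrable_power2[OF L_square_integrable[OF t0]])
  have [measurable]: "Q n \<in> borel_measurable M" for n unfolding Q_def by measurable
  have Qi: "integrable M (Q n)" for n
    by (rule Bochner_Integration.integrable_bound[OF L2]) (use QL[of n] in auto)
  have Qlim: "(\<lambda>n. expectation (Q n)) \<longlonglongrightarrow> expectation (\<lambda>\<omega>. 0)"
  proof (rule integral_dominated_convergence[OF _ _ L2 _ QL])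
    show "AE \<omega> in M. (\<lambda>n. Q n \<omega>) \<longlonglongrightarrow> 0"
      using AE_path by eventually_elim (use skew_path.sum_sq_tendsto_0[OF _ t] in \<open>auto simp: Q_def \<tau>_def\<close>)
  qed auto
  have bound: "expectation (Z t) \<le> 1 + \<bar>x\<bar> + expectation (Q n)" if n: "0 < n" for n
  proof -
    let ?m = "\<lambda>\<omega>. \<Sum>k<n. exp (- L (\<tau> n k) \<omega>) * (W (\<tau> n (Suc k)) \<omega> - W (\<tau> n k) \<omega>)"
    have "expectation (Z t) \<le> expectation (\<lambda>\<omega>. (1 + \<bar>x\<bar>) + ?m \<omega> + Q n \<omega>)"
    proof (rule integral_mono_AE)
      show "AE \<omega> in M. Z t \<omega> \<le> (1 + \<bar>x\<bar>) + ?m \<omega> + Q n \<omega>"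
        using AE_path
      proof eventually_elim
        case (elim \<omega>)
        then interpret skew_path \<beta> x "\<lambda>t. X t \<omega>" "\<lambda>t. B t \<omega>" "\<lambda>t. L t \<omega>" .
        \<comment> \<open>The summand 1 in \<open>1 + \<bar>X\<bar>\<close> pays for the local time:
          weighted by \<open>p\<close>, the growth of \<open>\<bar>X\<bar>\<close> beyond the
          martingale is \<open>p * d\<close>, while the summand 1 loses \<open>p * d\<close> up to
          the quadratic error \<open>d\<^sup>2\<close>.\<close>
        have step: "Z (\<tau> n (Suc k)) \<omega> - Z (\<tau> n k) \<omega> \<le>
          exp (- L (\<tau> n k) \<omega>) * (W (\<tau> n (Suc k)) \<omega> - W (\<tau> n k) \<omega>) + (L (\<tau> n (Suc k)) \<omega> - L (\<tau> n k) \<omega>)\<^sup>2" for k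
        proof -
          define p where "p = exp (- L (\<tau> n k) \<omega>)"
          define d where "d = L (\<tau> n (Suc k)) \<omega> - L (\<tau> n k) \<omega>"
          have d: "0 \<le> d" using L_le[OF \<tau>0 \<tau>mono] by (simp add: d_def)
          have p: "0 \<le> p" "p \<le> 1" using L_nonneg[OF \<tau>0] by (auto simp: p_def)
          have e: "exp (- L (\<tau> n (Suc k)) \<omega>) = p * exp (- d)"
            by (simp add: p_def d_def flip: exp_add)
          have "\<bar>X (\<tau> n (Suc k)) \<omega>\<bar> * (p * exp (- d)) \<le> \<bar>X (\<tau> n (Suc k)) \<omega>\<bar> * p"
            using d p by (intro mult_left_mono) (auto simp: mult_left_le)
          moreover have "p * exp (- d) \<le> p * (1 - d + d\<^sup>2)"
            using exp_minus_le[OF d] p by (intro mult_left_mono)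
          moreover have "p * d\<^sup>2 \<le> d\<^sup>2" using p by (simp add: mult_left_le_one_le)
          moreover have "p * (W (\<tau> n (Suc k)) \<omega> - W (\<tau> n k) \<omega>) =
              \<bar>X (\<tau> n (Suc k)) \<omega>\<bar> * p - \<bar>X (\<tau> n k) \<omega>\<bar> * p - p * d"
            by (simp add: W_def d_def algebra_simps)
          ultimately show ?thesis
            unfolding Z_def e by (simp add: p_def[symmetric] d_def[symmetric] distrib_right distrib_left right_diff_distrib)
        qed
        have "Z t \<omega> - Z 0 \<omega> = (\<Sum>k<n. Z (\<tau> n (Suc k)) \<omega> - Z (\<tau> n k) \<omega>)"
          using sum_grid_diff[OF n, of "\<lambda>s. Z s \<omega>" 0 t] by (simp add: \<tau>_def)
        also have "\<dots> \<le> ?m \<omega> + Q n \<omega>"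
          unfolding Q_def sum.distrib[symmetric] by (intro sum_mono step)
        finally show ?case by (simp add: Z_def X_0 L_0)
      qed
    qed (use Zi mi Qi in \<open>auto simp: Z_def[abs_def]\<close>)
    also have "\<dots> = 1 + \<bar>x\<bar> + expectation (Q n)"
      using mi Qi m0 by (simp add: prob_space)
    finally show ?thesis .
  qed
  have "(\<lambda>n. 1 + \<bar>x\<bar> + expectation (Q n)) \<longlonglongrightarrow> 1 + \<bar>x\<bar> + 0"
    using Qlim by (intro tendsto_add tendsto_const) simp
  then have "expectation (Z t) \<le> 1 + \<bar>x\<bar> + 0"
    by (rule tendsto_lowerbound[OF _ eventually_mono[OF eventually_gt_at_top[of 0] bound]]) auto
  then show "expectation (\<lambda>\<omega>. (1 + \<bar>X t \<omega>\<bar>) * exp (- L t \<omega>)) \<le> 1 + \<bar>x\<bar>" by (simp add: Z_def[abs_def])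
qed

text \<open>The normal density is bounded by \<open>1 / sqrt t\<close>, and the interval has length
  \<open>2 * m\<close>.\<close>

lemma prob_B_small:
  assumes t: "0 < t" and m: "0 \<le> m"
  shows "prob {\<omega> \<in> space M. \<bar>B t \<omega> - B 0 \<omega>\<bar> \<le> m} \<le> 2 * m / sqrt t"
proof -
  have "(\<lambda>\<omega>. B t \<omega> - B 0 \<omega>) -` {-m..m} \<inter> space M = {\<omega> \<in> space M. \<bar>B t \<omega> - B 0 \<omega>\<bar> \<le> m}"
    by (auto simp: abs_le_iff)
  then have "emeasure M {\<omega> \<in> space M. \<bar>B t \<omega> - B 0 \<omega>\<bar> \<le> m} =
      (\<integral>\<^sup>+z. ennreal (normal_density 0 (sqrt (t - 0)) z) * indicator {-m..m} z \<partial>lborel)"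
    using distributed_emeasure[OF normal_increments[OF order_refl t], of "{-m..m}"] by simp
  also have "\<dots> \<le> (\<integral>\<^sup>+z. ennreal (1 / sqrt t) * indicator {-m..m} z \<partial>lborel)"
  proof (intro nn_integral_mono mult_right_mono ennreal_leI)
    fix z :: real
    have "1 / sqrt (2 * pi * t) * exp (- (z - 0)\<^sup>2 / (2 * t)) \<le> 1 / sqrt t * 1"
    proof (intro mult_mono frac_le)
      have "1 * t \<le> (2 * pi) * t" using t pi_ge_two by (intro mult_right_mono) auto
      then show "sqrt t \<le> sqrt (2 * pi * t)" by simp
    qed (use t in auto)
    then show "normal_density 0 (sqrt (t - 0)) z \<le> 1 / sqrt t"
      using t by (simp add: normal_density_def)
  qed auto
  also have "\<dots> = ennreal (1 / sqrt t) * ennreal (2 * m)"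
    using m by (subst nn_integral_cmult_indicator) auto
  also have "\<dots> = ennreal (2 * m / sqrt t)"
    using t m by (simp flip: ennreal_mult)
  finally show ?thesis using t m by (simp add: emeasure_eq_measure)
qed

text \<open>If \<open>L \<le> K\<close> while \<open>\<bar>B\<bar>\<close> is large, then
  \<open>\<bar>X\<bar> \<ge> q\<close> and the supermartingale is at least
  \<open>q * exp (- K)\<close>; Markov's inequality makes this unlikely, and
  \<open>\<bar>B\<bar>\<close> is rarely small at late times.\<close>

lemma local_time_unbounded:
  "(\<lambda>n. prob {\<omega> \<in> space M. L (real n) \<omega> \<le> K}) \<longlonglongrightarrow> 0"
proof (rule tendstoI)
  fix e :: real assume e: "0 < e"
  \<comment> \<open>\<open>q\<close> brings the Markov term below \<open>e / 2\<close>;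
    \<open>m\<close> is large enough for \<open>\<bar>B t\<bar> > m\<close> and
    \<open>0 \<le> L t \<le> K\<close> to force \<open>\<bar>X t\<bar> \<ge> q\<close>.\<close>
  define q where "q = 2 * exp K * (1 + \<bar>x\<bar>) / e + 1"
  define m where "m = q + \<bar>x\<bar> + \<bar>\<beta>\<bar> * \<bar>K\<bar>"
  have q: "0 < q" "exp K * (1 + \<bar>x\<bar>) / q < e / 2"
  proof -
    show "0 < q" using e by (simp add: q_def add_nonneg_pos)
    then show "exp K * (1 + \<bar>x\<bar>) / q < e / 2"
      using e by (simp add: q_def field_simps)
  qed
  have m: "0 \<le> m" using q by (simp add: m_def)
  have "((\<lambda>n. 2 * m / sqrt (real n)) \<longlongrightarrow> 0) sequentially"
    by (intro tendsto_divide_0[OF tendsto_const] filterlim_at_top_imp_at_infinity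
        filterlim_compose[OF sqrt_at_top filterlim_real_sequentially])
  then have "\<forall>\<^sub>F n in sequentially. 2 * m / sqrt (real n) < e / 2"
    by (rule order_tendstoD) (use e in simp)
  with eventually_gt_at_top[of 0]
  show "\<forall>\<^sub>F n in sequentially. dist (prob {\<omega> \<in> space M. L (real n) \<omega> \<le> K}) 0 < e"
  proof eventually_elim
    case (elim n)
    define t where "t = real n"
    have t: "0 < t" "0 \<le> t" using elim by (auto simp: t_def)
    have [measurable]: "L t \<in> borel_measurable M" "X t \<in> borel_measurable M"
      "B t \<in> borel_measurable M" "B 0 \<in> borel_measurable M"
      using t by (auto intro: L_measurable X_measurable B_measurable)
    let ?S = "{\<omega> \<in> space M. \<bar>B t \<omega> - B 0 \<omega>\<bar> \<le> m}"
    let ?Z = "\<lambda>\<omega>. (1 + \<bar>X t \<omega>\<bar>) * exp (- L t \<omega>)"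
    note Z = exp_local_time_supermartingale[OF t(1)]
    have "prob {\<omega> \<in> space M. L t \<omega> \<le> K} = expectation (indicator {\<omega> \<in> space M. L t \<omega> \<le> K})"
      by simp
    also have "\<dots> \<le> expectation (\<lambda>\<omega>. indicator ?S \<omega> + exp K / q * ?Z \<omega>)"
    proof (rule integral_mono_AE)
      show "AE \<omega> in M. indicator {\<omega> \<in> space M. L t \<omega> \<le> K} \<omega> \<le> indicator ?S \<omega> + exp K / q * ?Z \<omega>"
        using AE_path start
      proof eventually_elim
        case (elim \<omega>)
        then interpret skew_path \<beta> x "\<lambda>t. X t \<omega>" "\<lambda>t. B t \<omega>" "\<lambda>t. L t \<omega>" by simp
        have Z0: "0 \<le> exp K / q * ?Z \<omega>" using q by simp
        show ?case
        proof (cases "L t \<omega> \<le> K \<and> \<not> \<bar>B t \<omega> - B 0 \<omega>\<bar> \<le> m")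
          case True
          have "\<bar>\<beta> * L t \<omega>\<bar> \<le> \<bar>\<beta>\<bar> * \<bar>K\<bar>"
            using True L_nonneg[OF t(2)] by (auto simp: abs_mult intro!: mult_left_mono)
          moreover have "q + \<bar>x\<bar> + \<bar>\<beta>\<bar> * \<bar>K\<bar> < \<bar>B t \<omega>\<bar>"
            using True elim(2) by (simp add: m_def)
          ultimately have "q \<le> \<bar>X t \<omega>\<bar>"
            unfolding eq[OF t(2)] by linarith
          then have "q * exp (- K) \<le> ?Z \<omega>"
            using True q by (intro mult_mono) auto
          then have "exp K / q * (q * exp (- K)) \<le> exp K / q * ?Z \<omega>"
            using q by (intro mult_left_mono) auto
          also have "exp K / q * (q * exp (- K)) = 1"
            using q by (simp flip: exp_add)
          finally show ?thesis using True by (simp add: indicator_def)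
        qed (use Z0 in \<open>auto simp: indicator_def\<close>)
      qed
    qed (use Z(1) in \<open>auto simp: emeasure_eq_measure\<close>)
    also have "\<dots> = prob ?S + exp K / q * expectation ?Z"
      using Z(1) by (simp add: emeasure_eq_measure)
    also have "\<dots> \<le> 2 * m / sqrt t + exp K / q * (1 + \<bar>x\<bar>)"
      using q by (intro add_mono prob_B_small t m mult_left_mono Z) auto
    also have "\<dots> = 2 * m / sqrt (real n) + exp K * (1 + \<bar>x\<bar>) / q" by (simp add: t_def)
    also have "\<dots> < e" using elim(2) q(2) by linarith
    finally show ?case by (simp add: t_def)
  qed
qed

end

section \<open>Coalescence\<close>

lemma sqrt_add_le: "0 < z \<Longrightarrow> 0 \<le> h \<Longrightarrow> sqrt (z + h) - sqrt z \<le> h / (2 * sqrt z)" for z h :: real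
proof -
  assume z: "0 < z" and h: "0 \<le> h"
  have "z + h \<le> (sqrt z + h / (2 * sqrt z))\<^sup>2"
    using z by (simp add: power2_sum)
  then have "sqrt (z + h) \<le> sqrt z + h / (2 * sqrt z)"
    using z h by (intro real_le_lsqrt) auto
  then show ?thesis by simp
qed

text \<open>One step of the Lyapunov function \<open>\<surd>D - \<beta> R / (2 \<surd>D) + \<bar>\<beta>\<bar> / 12 * U\<close>, with its martingale part
  removed and killed when \<open>D\<close> falls below \<open>d\<close>. Here \<open>D = Y - X\<close>, \<open>R = \<bar>Y\<bar> - \<bar>X\<bar>\<close>, and \<open>lx\<close>, \<open>ly\<close>
  are the increments of the two local times. The first local time grows only where \<open>R = D\<close> and the
  second only where \<open>R = - D\<close>, so that \<open>R (ly - lx)\<close> is close to \<open>- D (lx + ly)\<close>.\<close>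

lemma lyapunov_step:
  fixes \<beta> d D D' R R' lx ly U U' :: real
  assumes d: "0 < d" "d \<le> D" and \<beta>: "\<bar>\<beta>\<bar> \<le> 1" and l: "0 \<le> lx" "0 \<le> ly"
    and DD: "D' - D = \<beta> * (ly - lx)" and R: "\<bar>R'\<bar> \<le> \<bar>D'\<bar>"
    and U: "U' - U \<le> \<bar>\<beta>\<bar> * (lx + ly) / (2 * sqrt D)" "0 \<le> U"
  defines "e \<equiv> (if d \<le> D' then sqrt D' - \<beta> * R' / (2 * sqrt D') + \<bar>\<beta>\<bar> / 12 * U' else 0)
      - (sqrt D - \<beta> * R / (2 * sqrt D) + \<bar>\<beta>\<bar> / 12 * U) + \<beta> / (2 * sqrt D) * ((R' - R) - (ly - lx))"
  shows "e \<le> (lx + ly) / sqrt d"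
    and "0 \<le> \<eta> \<Longrightarrow> 12 * \<eta> \<le> d \<Longrightarrow> \<bar>D' - D\<bar> \<le> 2 * \<eta> \<Longrightarrow> (0 < lx \<longrightarrow> D - 6 * \<eta> \<le> R') \<Longrightarrow>
      (0 < ly \<longrightarrow> R' \<le> - (D - 6 * \<eta>)) \<Longrightarrow> e \<le> 0"
proof -
  define r where "r = sqrt D"
  have r: "0 < r" "r * r = D" "sqrt d \<le> r" "0 < sqrt d" using d by (auto simp: r_def)
  define s where "s = lx + ly"
  have s: "0 \<le> s" "\<bar>ly - lx\<bar> \<le> s" using l by (auto simp: s_def)
  have cU: "\<bar>\<beta>\<bar> / 12 * (U' - U) \<le> \<beta>\<^sup>2 * s / (24 * r)"
  proof -
    have "\<bar>\<beta>\<bar> / 12 * (U' - U) \<le> \<bar>\<beta>\<bar> / 12 * (\<bar>\<beta>\<bar> * s / (2 * r))"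
      using U(1) by (intro mult_left_mono) (auto simp: s_def r_def)
    also have "\<dots> = (\<bar>\<beta>\<bar> * \<bar>\<beta>\<bar>) * s / (24 * r)" by simp
    finally show ?thesis by (simp only: abs_mult_self_eq power2_eq_square)
  qed
  have \<beta>2: "\<beta>\<^sup>2 \<le> 1" using \<beta> by (simp add: abs_square_le_1)
  have frac: "s / r \<le> s / sqrt d" using r s by (intro frac_le) auto
  \<comment> \<open>Survival. Concavity of \<open>sqrt\<close> gives a nonpositive second order
    term, which is dropped. The change of the weight \<open>1 / (2 * sqrt D)\<close>, multiplied by
    the end value \<open>R'\<close> and by \<open>D' - D = \<beta> * (ly - lx)\<close>, is the
    discrete drift; the last summand is the growth of \<open>U\<close>.\<close>
  have high: "e \<le> \<beta>\<^sup>2 * (R' * (ly - lx) / (2 * r * r' * (r + r'))) + \<beta>\<^sup>2 * s / (24 * r)"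
    and r'_pos: "0 < r'" and r'_sq: "r' * r' = D'"
    if D': "d \<le> D'" and r': "r' = sqrt D'" for r'
  proof -
    show r'0: "0 < r'" and r'2: "r' * r' = D'" using d D' by (auto simp: r')
    have e: "e = (r' - r - (D' - D) / (2 * r)) + \<beta> * R' * (1 / (2 * r) - 1 / (2 * r')) + \<bar>\<beta>\<bar> / 12 * (U' - U)"
    proof -
      define p p' where "p = 1 / (2 * r)" and "p' = 1 / (2 * r')"
      have p: "v / (2 * r) = v * p" "v / (2 * r') = v * p'" for v by (simp_all add: p_def p'_def)
      show ?thesis
        using D' unfolding e_def DD r'[symmetric] r_def[symmetric] p
        by (simp add: algebra_simps diff_divide_distrib)
    qed
    have "r' - r - (D' - D) / (2 * r) = - ((r' - r)\<^sup>2 / (2 * r))"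
      using r(1) by (simp add: field_simps power2_eq_square flip: r(2) r'2)
    then have 1: "r' - r - (D' - D) / (2 * r) \<le> 0" using r(1) by simp
    have "1 / (2 * r) - 1 / (2 * r') = (D' - D) / (2 * r * r' * (r + r'))"
      using r(1) r'0 by (simp add: divide_simps flip: r(2) r'2) (simp add: algebra_simps)
    then have "\<beta> * R' * (1 / (2 * r) - 1 / (2 * r')) = \<beta>\<^sup>2 * (R' * (ly - lx) / (2 * r * r' * (r + r')))"
      by (simp add: DD power2_eq_square)
    with e 1 cU show "e \<le> \<beta>\<^sup>2 * (R' * (ly - lx) / (2 * r * r' * (r + r'))) + \<beta>\<^sup>2 * s / (24 * r)"
      by linarith
  qed
  \<comment> \<open>Killing. The value \<open>r\<close> is given up, and by
    \<open>\<bar>\<beta> * R'\<bar> \<le> \<bar>D'\<bar>\<close> only \<open>r / 2\<close> of it can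
    return, apart from a term that vanishes unless the step overshoots below 0.\<close>
  have low: "e \<le> - r / 2 + (\<bar>D'\<bar> - D') / (2 * r)" if D': "\<not> d \<le> D'"
  proof -
    have "e = - r - \<bar>\<beta>\<bar> / 12 * U + (\<beta> * R' - D' + D) / (2 * r)"
    proof -
      define p where "p = 1 / (2 * r)"
      have p: "v / (2 * r) = v * p" for v by (simp add: p_def)
      have DD': "\<beta> * R' - D' + D = \<beta> * R' - \<beta> * (ly - lx)" using DD by simp
      show ?thesis
        using D' unfolding DD' e_def r_def[symmetric] p by (simp add: algebra_simps)
    qed
    moreover have "\<bar>\<beta> * R'\<bar> \<le> 1 * \<bar>D'\<bar>"
      unfolding abs_mult using \<beta> R by (intro mult_mono) auto
    then have "\<beta> * R' \<le> \<bar>D'\<bar>" by linarith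
    then have "(\<beta> * R' - D' + D) / (2 * r) \<le> (\<bar>D'\<bar> - D' + D) / (2 * r)"
      using r(1) by (intro divide_right_mono) auto
    moreover have "(\<bar>D'\<bar> - D' + D) / (2 * r) = (\<bar>D'\<bar> - D') / (2 * r) + r / 2"
      using r(1) by (simp add: add_divide_distrib flip: r(2))
    moreover have "0 \<le> \<bar>\<beta>\<bar> / 12 * U" using U(2) by simp
    ultimately show ?thesis by linarith
  qed
  show "e \<le> (lx + ly) / sqrt d"
  proof (cases "d \<le> D'")
    case True
    define r' where "r' = sqrt D'"
    have r': "0 < r'" "r' * r' = D'" using r'_pos[OF True r'_def] r'_sq[OF True r'_def] by auto
    have "R' * (ly - lx) / (2 * r * r' * (r + r')) \<le> (r' * r') * s / (2 * r * r' * (r + r'))"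
    proof (rule divide_right_mono)
      have "\<bar>R'\<bar> * \<bar>ly - lx\<bar> \<le> (r' * r') * s"
        using R s r' True d by (intro mult_mono) auto
      then show "R' * (ly - lx) \<le> (r' * r') * s"
        by (simp only: abs_mult[symmetric])
    qed (use r(1) r'(1) in auto)
    also have "\<dots> = (r' * s) / (2 * r * (r + r'))" using r'(1) by simp
    also have "\<dots> \<le> ((r + r') * s) / (2 * r * (r + r'))"
      using r(1) r'(1) s by (intro divide_right_mono mult_right_mono) auto
    also have "\<dots> = s / (2 * r)" using r(1) r'(1) by simp
    finally have "\<beta>\<^sup>2 * (R' * (ly - lx) / (2 * r * r' * (r + r'))) \<le> \<beta>\<^sup>2 * (s / (2 * r))"
      by (intro mult_left_mono) auto
    also have "\<dots> \<le> 1 * (s / (2 * r))" using \<beta>2 s r(1) by (intro mult_right_mono) auto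
    finally have 1: "\<beta>\<^sup>2 * (R' * (ly - lx) / (2 * r * r' * (r + r'))) \<le> s / r / 2" by simp
    have "\<beta>\<^sup>2 * (s / (24 * r)) \<le> 1 * (s / (24 * r))" using \<beta>2 s r(1) by (intro mult_right_mono) auto
    then have 2: "\<beta>\<^sup>2 * s / (24 * r) \<le> s / r / 24" by simp
    have "0 \<le> s / r" using s r(1) by simp
    then show ?thesis using high[OF True r'_def] 1 2 frac by (simp add: s_def[symmetric])
  next
    case False
    \<comment> \<open>As \<open>D\<close> is positive, a negative \<open>D'\<close> is no larger in
      size than the step \<open>\<bar>D' - D\<bar> \<le> s\<close>.\<close>
    have "(\<bar>D'\<bar> - D') / (2 * r) \<le> (2 * s) / (2 * r)"
    proof (intro divide_right_mono)
      have "\<bar>D' - D\<bar> \<le> 1 * s" unfolding DD abs_mult using \<beta> s by (intro mult_mono) auto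
      then show "\<bar>D'\<bar> - D' \<le> 2 * s" using d s by linarith
    qed (use r(1) in auto)
    then show ?thesis using low[OF False] frac r(1) by (simp add: s_def[symmetric])
  qed
  assume \<eta>: "0 \<le> \<eta>" "12 * \<eta> \<le> d" "\<bar>D' - D\<bar> \<le> 2 * \<eta>" and Rx: "0 < lx \<longrightarrow> D - 6 * \<eta> \<le> R'"
    and Ry: "0 < ly \<longrightarrow> R' \<le> - (D - 6 * \<eta>)"
  show "e \<le> 0"
  proof (cases "d \<le> D'")
    case True
    define r' where "r' = sqrt D'"
    have r': "0 < r'" "r' * r' = D'" using r'_pos[OF True r'_def] r'_sq[OF True r'_def] by auto
    \<comment> \<open>Origin of 24: small oscillation gives \<open>r' \<le> 2 * r\<close>, the loss
      \<open>6 * \<eta> \<le> D / 2\<close> leaves half of the drift, and \<open>D / 2\<close> over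
      \<open>2 * r * (2 * r) * (3 * r)\<close> is \<open>1 / (24 * r)\<close>. This cancels the
      bound \<open>cU\<close> for the growth of \<open>U\<close> exactly.\<close>
    have "D' \<le> 2\<^sup>2 * D" using \<eta> d by simp
    then have r'2: "r' \<le> 2 * r" 
      using real_sqrt_le_mono[OF \<open>D' \<le> 2\<^sup>2 * D\<close>] unfolding r'_def r_def real_sqrt_mult by simp
    have D2: "D / 2 \<le> D - 6 * \<eta>" using \<eta> d by simp
    have "D / 2 * lx \<le> R' * lx"
    proof (cases "lx = 0")
      case False
      then have "D / 2 \<le> R'" using Rx D2 l by simp
      then show ?thesis using l by (intro mult_right_mono)
    qed simp
    moreover have "R' * ly \<le> - (D / 2) * ly"
    proof (cases "ly = 0")
      case False
      then have "R' \<le> - (D / 2)" using Ry D2 l by simp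
      then show ?thesis using l by (intro mult_right_mono)
    qed simp
    ultimately have "R' * (ly - lx) \<le> - (D / 2 * s)"
      unfolding s_def right_diff_distrib distrib_left minus_mult_left[symmetric] by linarith
    then have "R' * (ly - lx) / (2 * r * r' * (r + r')) \<le> - (D / 2 * s) / (2 * r * r' * (r + r'))"
      using r(1) r'(1) by (intro divide_right_mono) auto
    also have "\<dots> \<le> - (D / 2 * s) / (2 * r * (2 * r) * (r + 2 * r))"
    proof -
      have "2 * r * r' * (r + r') \<le> 2 * r * (2 * r) * (r + 2 * r)"
        using r(1) r'(1) r'2 by (intro mult_mono) auto
      then have "(D / 2 * s) / (2 * r * (2 * r) * (r + 2 * r)) \<le> (D / 2 * s) / (2 * r * r' * (r + r'))"
        using r(1) r'(1) s d by (intro divide_left_mono) auto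
      then show ?thesis by simp
    qed
    also have "\<dots> = - (s / (24 * r))"
      using r(1) by (simp flip: r(2))
    finally have "\<beta>\<^sup>2 * (R' * (ly - lx) / (2 * r * r' * (r + r'))) \<le> \<beta>\<^sup>2 * - (s / (24 * r))"
      by (intro mult_left_mono) auto
    then show ?thesis using high[OF True r'_def] by simp
  next
    case False
    have "0 \<le> D'" using \<eta> d by linarith
    then show ?thesis using low[OF False] r(1) by simp
  qed
qed

section \<open>Two coupled paths, one \<omega> at a time\<close>

locale coupled_paths =
  X: skew_path \<beta> x X B Lx + Y: skew_path \<beta> y Y B Ly
  for \<beta> x y X Y B Lx Ly +
  assumes beta_le: "\<bar>\<beta>\<bar> \<le> 1" and xy: "x < y"
begin

text \<open>The square root of an upper bound for \<open>D\<close> that is monotone in time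
  (\<open>diff_le\<close>). By concavity its increments are charged to the weight
  \<open>1 / (2 * sqrt D)\<close>, as \<open>U_diff_le\<close> shows.\<close>

definition U :: "real \<Rightarrow> real" where
  "U t = sqrt ((y - x) + \<bar>\<beta>\<bar> * (Lx t + Ly t))"

lemma diff_eq: "0 \<le> t \<Longrightarrow> Y t - X t = (y - x) + \<beta> * (Ly t - Lx t)"
  using X.eq[of t] Y.eq[of t] by (simp add: algebra_simps)

lemma diff_le: "0 \<le> t \<Longrightarrow> Y t - X t \<le> (y - x) + \<bar>\<beta>\<bar> * (Lx t + Ly t)"
proof -
  assume t: "0 \<le> t"
  have "\<beta> * (Ly t - Lx t) \<le> \<bar>\<beta> * (Ly t - Lx t)\<bar>" by simp
  also have "\<dots> \<le> \<bar>\<beta>\<bar> * (Lx t + Ly t)"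
    unfolding abs_mult using X.L_nonneg[OF t] Y.L_nonneg[OF t] by (intro mult_left_mono) auto
  finally show ?thesis using diff_eq[OF t] by simp
qed

lemma U_nonneg: "0 \<le> t \<Longrightarrow> 0 \<le> U t"
  using xy X.L_nonneg[of t] Y.L_nonneg[of t] by (simp add: U_def)

lemma U_diff_le:
  assumes "0 \<le> s" "s \<le> t" "0 < Y s - X s"
  shows "U t - U s \<le> \<bar>\<beta>\<bar> * ((Lx t - Lx s) + (Ly t - Ly s)) / (2 * sqrt (Y s - X s))"
proof -
  define z where "z = (y - x) + \<bar>\<beta>\<bar> * (Lx s + Ly s)"
  define h where "h = \<bar>\<beta>\<bar> * ((Lx t - Lx s) + (Ly t - Ly s))"
  have h: "0 \<le> h" using X.L_le[OF assms(1,2)] Y.L_le[OF assms(1,2)] by (simp add: h_def)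
  have z: "Y s - X s \<le> z" using diff_le[OF assms(1)] by (simp add: z_def)
  have "U t - U s = sqrt (z + h) - sqrt z" by (simp add: U_def z_def h_def algebra_simps)
  also have "\<dots> \<le> h / (2 * sqrt z)" using z h assms(3) by (intro sqrt_add_le) auto
  also have "\<dots> \<le> h / (2 * sqrt (Y s - X s))" using z h assms(3) by (intro divide_left_mono) auto
  finally show ?thesis by (simp add: h_def)
qed

text \<open>The quantity \<open>e\<close> of \<open>lyapunov_step\<close> between times
  \<open>s\<close> and \<open>t\<close>: the increment of the killed Lyapunov function without its
  martingale part.\<close>

definition residual :: "real \<Rightarrow> real \<Rightarrow> real \<Rightarrow> real" where
  "residual d s t =
    (if d \<le> Y t - X t then sqrt (Y t - X t) - \<beta> * (\<bar>Y t\<bar> - \<bar>X t\<bar>) / (2 * sqrt (Y t - X t)) + \<bar>\<beta>\<bar> / 12 * U t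
      else 0)
    - (sqrt (Y s - X s) - \<beta> * (\<bar>Y s\<bar> - \<bar>X s\<bar>) / (2 * sqrt (Y s - X s)) + \<bar>\<beta>\<bar> / 12 * U s)
    + \<beta> / (2 * sqrt (Y s - X s)) *
      (((\<bar>Y t\<bar> - \<bar>X t\<bar>) - (\<bar>Y s\<bar> - \<bar>X s\<bar>)) - ((Ly t - Ly s) - (Lx t - Lx s)))"

context
  fixes d s t :: real
  assumes d: "0 < d" and st: "0 \<le> s" "s \<le> t" and D: "d \<le> Y s - X s"
begin

lemma residual_le: "residual d s t \<le> ((Lx t - Lx s) + (Ly t - Ly s)) / sqrt d"
  unfolding residual_def
proof (rule lyapunov_step(1)[OF d D beta_le])
  show "(Y t - X t) - (Y s - X s) = \<beta> * ((Ly t - Ly s) - (Lx t - Lx s))"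
    using diff_eq[of s] diff_eq[of t] st by (simp add: algebra_simps)
qed (use st X.L_le[OF st] Y.L_le[OF st] U_nonneg[OF st(1)] U_diff_le[OF st] d D in auto)

text \<open>If a local time grows on the interval, its path has a zero there, and small oscillation
  carries the relation \<open>R = D\<close> or \<open>R = - D\<close> from that zero to the end
  point with a small loss.\<close>

lemma residual_nonpos:
  assumes osc: "\<And>u. u \<in> {s..t} \<Longrightarrow> \<bar>X u - X s\<bar> \<le> d / 12" "\<And>u. u \<in> {s..t} \<Longrightarrow> \<bar>Y u - Y s\<bar> \<le> d / 12"
  shows "residual d s t \<le> 0"
  unfolding residual_def
\<comment> \<open>With \<open>\<eta> = d / 12\<close> the permitted loss \<open>6 * \<eta>\<close>
  is \<open>d / 2\<close>, at most half of \<open>D\<close>.\<close>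
proof (rule lyapunov_step(2)[OF d D beta_le, where \<eta> = "d / 12"])
  show "(Y t - X t) - (Y s - X s) = \<beta> * ((Ly t - Ly s) - (Lx t - Lx s))"
    using diff_eq[of s] diff_eq[of t] st by (simp add: algebra_simps)
  have end_osc: "\<bar>X t - X s\<bar> \<le> d / 12" "\<bar>Y t - Y s\<bar> \<le> d / 12" using osc[of t] st by auto
  then show "\<bar>Y t - X t - (Y s - X s)\<bar> \<le> 2 * (d / 12)" by linarith
  show "0 < Lx t - Lx s \<longrightarrow> Y s - X s - 6 * (d / 12) \<le> \<bar>Y t\<bar> - \<bar>X t\<bar>"
  proof
    assume "0 < Lx t - Lx s"
    then obtain u where u: "u \<in> {s..t}" "X u = 0" using X.zero_between[OF st] by auto
    show "Y s - X s - 6 * (d / 12) \<le> \<bar>Y t\<bar> - \<bar>X t\<bar>"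
      using osc[OF u(1)] u(2) end_osc by linarith
  qed
  show "0 < Ly t - Ly s \<longrightarrow> \<bar>Y t\<bar> - \<bar>X t\<bar> \<le> - (Y s - X s - 6 * (d / 12))"
  proof
    assume "0 < Ly t - Ly s"
    then obtain u where u: "u \<in> {s..t}" "Y u = 0" using Y.zero_between[OF st] by auto
    show "\<bar>Y t\<bar> - \<bar>X t\<bar> \<le> - (Y s - X s - 6 * (d / 12))"
      using osc[OF u(1)] u(2) end_osc by linarith
  qed
qed (use st X.L_le[OF st] Y.L_le[OF st] U_nonneg[OF st(1)] U_diff_le[OF st] d D in auto)

end

lemma eventually_residual_nonpos:
  assumes "0 < T" "0 < d"
  shows "\<forall>\<^sub>F n in sequentially. \<forall>k<n. d \<le> Y (grid 0 T n k) - X (grid 0 T n k) \<longrightarrow>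
    residual d (grid 0 T n k) (grid 0 T n (Suc k)) \<le> 0"
proof -
  have "0 \<le> T" "0 < d / 12" using assms by auto
  from eventually_grid_oscillation[OF this(1) X.cont(1)[OF order_refl] this(2)]
    eventually_grid_oscillation[OF this(1) Y.cont(1)[OF order_refl] this(2)]
  show ?thesis
  proof eventually_elim
    case (elim n)
    show ?case
    proof (intro allI impI)
      fix k assume k: "k < n" and D: "d \<le> Y (grid 0 T n k) - X (grid 0 T n k)"
      show "residual d (grid 0 T n k) (grid 0 T n (Suc k)) \<le> 0"
        by (rule residual_nonpos[OF assms(2) _ _ D])
           (use elim k assms in \<open>auto intro!: grid_ge grid_mono\<close>)
    qed
  qed
qed

end

section \<open>Expectations for the coupled processes\<close>

locale coupled_processes =
  brownian_motion M F B + X: skew_process M F B \<beta> x X Lx + Y: skew_process M F B \<beta> y Y Ly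
  for M :: "'w measure" and F B \<beta> x y X Y Lx Ly +
  assumes beta_le: "\<bar>\<beta>\<bar> \<le> 1" and xy: "x < y"
begin

lemma AE_paths: "AE \<omega> in M. coupled_paths \<beta> x y (\<lambda>t. X t \<omega>) (\<lambda>t. Y t \<omega>) (\<lambda>t. B t \<omega>)
    (\<lambda>t. X.L t \<omega>) (\<lambda>t. Y.L t \<omega>)"
  using X.AE_path Y.AE_path
  by eventually_elim (simp add: coupled_paths_def coupled_paths_axioms_def beta_le xy)

definition U :: "real \<Rightarrow> 'w \<Rightarrow> real" where
  "U t \<omega> = sqrt ((y - x) + \<bar>\<beta>\<bar> * (X.L t \<omega> + Y.L t \<omega>))"

text \<open>Only grid times enter, for all meshes at once: countably many conditions, so the event
  is measurable, and on it no grid on \<open>[0, N]\<close> triggers the killing at level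
  \<open>d\<close>.\<close>

definition apart :: "nat \<Rightarrow> real \<Rightarrow> 'w set" where
  "apart N d = {\<omega> \<in> space M. \<forall>n k. d \<le> Y (grid 0 (real N) n k) \<omega> - X (grid 0 (real N) n k) \<omega> \<or> n < k}"

lemma apart_sets [measurable]: "apart N d \<in> events"
proof -
  have [measurable]: "X (grid 0 (real N) n k) \<in> borel_measurable M"
    "Y (grid 0 (real N) n k) \<in> borel_measurable M" for n k
    using grid_ge[of 0 "real N"] by (auto intro: X.X_measurable Y.X_measurable)
  show ?thesis unfolding apart_def by measurable
qed

text \<open>Almost surely \<open>(U t)\<^sup>2\<close> is affine in the local times, hence
  integrable.\<close>

lemma U_square_integrable:
  assumes t: "0 \<le> t"
  shows "square_integrable M (U t)"
proof (rule square_integrableI)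
  have [measurable]: "X.L t \<in> borel_measurable M" "Y.L t \<in> borel_measurable M"
    using t by (auto intro: X.L_measurable Y.L_measurable)
  show "U t \<in> borel_measurable M" unfolding U_def[abs_def] by measurable
  have "integrable M (\<lambda>\<omega>. (y - x) + \<bar>\<beta>\<bar> * (X.L t \<omega> + Y.L t \<omega>))"
    using t by (intro Bochner_Integration.integrable_add integrable_mult_right integrable_const
        square_integrable_integrable X.L_square_integrable Y.L_square_integrable)
  then show "integrable M (\<lambda>\<omega>. (U t \<omega>)\<^sup>2)"
  proof (rule integrable_cong_AE_imp)
    show "AE \<omega> in M. (y - x) + \<bar>\<beta>\<bar> * (X.L t \<omega> + Y.L t \<omega>) = (U t \<omega>)\<^sup>2"
      using X.AE_path Y.AE_path
    proof eventually_elim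
      case (elim \<omega>)
      have "0 \<le> (y - x) + \<bar>\<beta>\<bar> * (X.L t \<omega> + Y.L t \<omega>)"
        using xy skew_path.L_nonneg[OF elim(1) t] skew_path.L_nonneg[OF elim(2) t] by simp
      then show ?case by (simp add: U_def)
    qed
  qed (simp add: U_def[abs_def])
qed

text \<open>The killed process is nonnegative, starts below \<open>2 * sqrt (y - x)\<close>, and on
  \<open>apart N d\<close> ends above the \<open>U\<close> term. Its mean increases by at most the
  mean of the positive residuals, which tends to 0 with the mesh. The bound is free of
  \<open>N\<close> and \<open>d\<close>.\<close>

lemma lyapunov_bound:
  assumes N: "0 < N" and d: "0 < d"
  shows "expectation (\<lambda>\<omega>. indicator (apart N d) \<omega> * (\<bar>\<beta>\<bar> / 12 * U (real N) \<omega>)) \<le> 2 * sqrt (y - x)"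
proof -
  define T where "T = real N"
  have T: "0 < T" "0 \<le> T" using N by (auto simp: T_def)
  define \<tau> where "\<tau> n k = grid 0 T n k" for n k
  define D where "D t \<omega> = Y t \<omega> - X t \<omega>" for t \<omega>
  define R where "R t \<omega> = \<bar>Y t \<omega>\<bar> - \<bar>X t \<omega>\<bar>" for t \<omega>
  define W where "W t \<omega> = (\<bar>Y t \<omega>\<bar> - Y.L t \<omega>) - (\<bar>X t \<omega>\<bar> - X.L t \<omega>)" for t \<omega>
  define Z where "Z t \<omega> = sqrt (D t \<omega>) - \<beta> * R t \<omega> / (2 * sqrt (D t \<omega>)) + \<bar>\<beta>\<bar> / 12 * U t \<omega>" for t \<omega>
  \<comment> \<open>Survival up to the \<open>k\<close>-th grid time, as an adapted factor. It also
    bounds the weight \<open>u\<close> by \<open>\<bar>\<beta>\<bar> / (2 * sqrt d)\<close>, as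
    \<open>tanaka\<close> requires.\<close>
  define g where "g n k \<omega> = (\<Prod>j\<le>k. if d \<le> D (\<tau> n j) \<omega> then 1 else 0 :: real)" for n k \<omega>
  define u where "u n k \<omega> = g n k \<omega> * (\<beta> / (2 * sqrt (D (\<tau> n k) \<omega>)))" for n k \<omega>
  define e where "e n k \<omega> = g n (Suc k) \<omega> * Z (\<tau> n (Suc k)) \<omega> - g n k \<omega> * Z (\<tau> n k) \<omega>
      + u n k \<omega> * (W (\<tau> n (Suc k)) \<omega> - W (\<tau> n k) \<omega>)" for n k \<omega>
  define S where "S n \<omega> = (\<Sum>k<n. max 0 (e n k \<omega>))" for n \<omega>
  have \<tau>0: "0 \<le> \<tau> n k" for n k using T grid_ge[of 0 T n k] by (simp add: \<tau>_def)
  have \<tau>mono: "j \<le> k \<Longrightarrow> \<tau> n j \<le> \<tau> n k" for n j k using T by (simp add: \<tau>_def grid_mono)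
  have g01: "g n k \<omega> = 0 \<or> g n k \<omega> = 1 \<and> d \<le> D (\<tau> n k) \<omega>" for n k \<omega>
  proof (cases "\<forall>j\<le>k. d \<le> D (\<tau> n j) \<omega>")
    case False
    then show ?thesis by (auto simp: g_def)
  qed (simp add: g_def)
  have g_Suc: "g n (Suc k) \<omega> = g n k \<omega> * (if d \<le> D (\<tau> n (Suc k)) \<omega> then 1 else 0)" for n k \<omega>
    by (simp add: g_def mult.commute)
  have DF: "D (\<tau> n j) \<in> borel_measurable (F (\<tau> n k))" if "j \<le> k" for n j k
    unfolding D_def
    by (intro borel_measurable_diff measurable_F_mono[OF \<tau>mono[OF that]] X.X_adapted Y.X_adapted \<tau>0)
  have gF: "g n k \<in> borel_measurable (F (\<tau> n k))" for n k
    unfolding g_def[abs_def]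
  proof (rule borel_measurable_prod)
    fix j assume "j \<in> {..k}"
    then have [measurable]: "D (\<tau> n j) \<in> borel_measurable (F (\<tau> n k))" by (simp add: DF)
    show "(\<lambda>\<omega>. if d \<le> D (\<tau> n j) \<omega> then 1 else 0 :: real) \<in> borel_measurable (F (\<tau> n k))" by measurable
  qed
  have uF: "u n k \<in> borel_measurable (F (\<tau> n k))" for n k
  proof -
    have [measurable]: "D (\<tau> n k) \<in> borel_measurable (F (\<tau> n k))" "g n k \<in> borel_measurable (F (\<tau> n k))"
      by (simp_all add: DF gF)
    show ?thesis unfolding u_def[abs_def] by measurable
  qed
  have ub: "AE \<omega> in M. \<bar>u n k \<omega>\<bar> \<le> \<bar>\<beta>\<bar> / (2 * sqrt d)" for n k
  proof (rule AE_I2)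
    fix \<omega>
    show "\<bar>u n k \<omega>\<bar> \<le> \<bar>\<beta>\<bar> / (2 * sqrt d)"
      using g01[of n k \<omega>] d by (auto simp: u_def abs_mult intro!: divide_left_mono)
  qed
  have WX: "square_integrable M (\<lambda>\<omega>. (\<bar>X t \<omega>\<bar> - X.L t \<omega>) - (\<bar>X s \<omega>\<bar> - X.L s \<omega>))"
    and WY: "square_integrable M (\<lambda>\<omega>. (\<bar>Y t \<omega>\<bar> - Y.L t \<omega>) - (\<bar>Y s \<omega>\<bar> - Y.L s \<omega>))"
    if "0 \<le> s" "0 \<le> t" for s t
    using that by (auto intro!: square_integrable_diff X.abs_minus_local_time_square_integrable
        Y.abs_minus_local_time_square_integrable)
  have ui: "integrable M (\<lambda>\<omega>. u n k \<omega> * (W (\<tau> n (Suc k)) \<omega> - W (\<tau> n k) \<omega>))"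
    and u0: "expectation (\<lambda>\<omega>. u n k \<omega> * (W (\<tau> n (Suc k)) \<omega> - W (\<tau> n k) \<omega>)) = 0" for n k
  proof -
    let ?s = "\<tau> n k" and ?t = "\<tau> n (Suc k)"
    have st: "0 \<le> ?s" "?s \<le> ?t" by (simp_all add: \<tau>0 \<tau>mono)
    have uM: "u n k \<in> borel_measurable M" by (rule measurable_F_M[OF \<tau>0 uF])
    let ?wx = "\<lambda>\<omega>. (\<bar>X ?t \<omega>\<bar> - X.L ?t \<omega>) - (\<bar>X ?s \<omega>\<bar> - X.L ?s \<omega>)"
    let ?wy = "\<lambda>\<omega>. (\<bar>Y ?t \<omega>\<bar> - Y.L ?t \<omega>) - (\<bar>Y ?s \<omega>\<bar> - Y.L ?s \<omega>)"
    have i: "integrable M (\<lambda>\<omega>. u n k \<omega> * ?wx \<omega>)" "integrable M (\<lambda>\<omega>. u n k \<omega> * ?wy \<omega>)"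
      by (intro square_integrable_integrable square_integrable_bounded_mult[OF _ uM ub] WX WY \<tau>0)+
    have eq: "u n k \<omega> * (W ?t \<omega> - W ?s \<omega>) = u n k \<omega> * ?wy \<omega> - u n k \<omega> * ?wx \<omega>" for \<omega>
      by (simp add: W_def algebra_simps)
    show "integrable M (\<lambda>\<omega>. u n k \<omega> * (W ?t \<omega> - W ?s \<omega>))"
      unfolding eq using i by (intro Bochner_Integration.integrable_diff)
    show "expectation (\<lambda>\<omega>. u n k \<omega> * (W ?t \<omega> - W ?s \<omega>)) = 0"
      unfolding eq using i X.tanaka[OF st uF ub] Y.tanaka[OF st uF ub] by simp
  qed
  have XM: "X (\<tau> n k) \<in> borel_measurable M" and YM: "Y (\<tau> n k) \<in> borel_measurable M"
    and LXM: "X.L (\<tau> n k) \<in> borel_measurable M" and LYM: "Y.L (\<tau> n k) \<in> borel_measurable M" for n k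
    by (simp_all add: X.X_measurable Y.X_measurable X.L_measurable Y.L_measurable \<tau>0)
  have gM: "g n k \<in> borel_measurable M" and uM: "u n k \<in> borel_measurable M" for n k
    by (rule measurable_F_M[OF \<tau>0 gF], rule measurable_F_M[OF \<tau>0 uF])
  have eM: "e n k \<in> borel_measurable M" for n k
  proof -
    note [measurable] = XM YM LXM LYM gM uM
    show ?thesis unfolding e_def[abs_def] Z_def W_def D_def R_def U_def by measurable
  qed
  have SM: "S n \<in> borel_measurable M" for n
    unfolding S_def[abs_def] using eM by measurable
  have e_residual: "e n k \<omega> = g n k \<omega> * coupled_paths.residual \<beta> x y (\<lambda>t. X t \<omega>) (\<lambda>t. Y t \<omega>)
      (\<lambda>t. X.L t \<omega>) (\<lambda>t. Y.L t \<omega>) d (\<tau> n k) (\<tau> n (Suc k))"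
    if "coupled_paths \<beta> x y (\<lambda>t. X t \<omega>) (\<lambda>t. Y t \<omega>) (\<lambda>t. B t \<omega>) (\<lambda>t. X.L t \<omega>) (\<lambda>t. Y.L t \<omega>)" for n k \<omega>
  proof -
    have Wd: "W t \<omega> - W s \<omega> = (R t \<omega> - R s \<omega>) - ((Y.L t \<omega> - Y.L s \<omega>) - (X.L t \<omega> - X.L s \<omega>))" for s t
      by (simp add: W_def R_def)
    show ?thesis
      using g01[of n k \<omega>]
      by (auto simp: e_def g_Suc u_def coupled_paths.residual_def[OF that] coupled_paths.U_def[OF that]
          Z_def U_def D_def Wd R_def)
  qed
  \<comment> \<open>Holds on every grid, since the crude bound telescopes; it is the dominating
    function for the pointwise limit of \<open>S\<close>.\<close>
  have Sle: "AE \<omega> in M. norm (S n \<omega>) \<le> (X.L T \<omega> + Y.L T \<omega>) / sqrt d" for n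
    using AE_paths
  proof eventually_elim
    case (elim \<omega>)
    then interpret C: coupled_paths \<beta> x y "\<lambda>t. X t \<omega>" "\<lambda>t. Y t \<omega>" "\<lambda>t. B t \<omega>" "\<lambda>t. X.L t \<omega>" "\<lambda>t. Y.L t \<omega>" .
    let ?A = "\<lambda>t. (X.L t \<omega> + Y.L t \<omega>) / sqrt d"
    have A_mono: "?A s \<le> ?A t" if "0 \<le> s" "s \<le> t" for s t
      using C.X.L_le[OF that] C.Y.L_le[OF that] d by (intro divide_right_mono add_mono) auto
    have step: "max 0 (e n k \<omega>) \<le> ?A (\<tau> n (Suc k)) - ?A (\<tau> n k)" for k
    proof -
      have nn: "0 \<le> ?A (\<tau> n (Suc k)) - ?A (\<tau> n k)" using A_mono[OF \<tau>0 \<tau>mono[of k "Suc k" n]] by simp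
      have "e n k \<omega> \<le> ?A (\<tau> n (Suc k)) - ?A (\<tau> n k)"
        using g01[of n k \<omega>]
      proof
        assume "g n k \<omega> = 1 \<and> d \<le> D (\<tau> n k) \<omega>"
        then have "e n k \<omega> = C.residual d (\<tau> n k) (\<tau> n (Suc k))" "d \<le> Y (\<tau> n k) \<omega> - X (\<tau> n k) \<omega>"
          using e_residual[OF C.coupled_paths_axioms, of n k] by (simp_all add: D_def)
        then have "e n k \<omega> \<le> ((X.L (\<tau> n (Suc k)) \<omega> - X.L (\<tau> n k) \<omega>) + (Y.L (\<tau> n (Suc k)) \<omega> - Y.L (\<tau> n k) \<omega>)) / sqrt d"
          using C.residual_le[OF d \<tau>0 \<tau>mono[of k "Suc k" n]] by simp
        also have "\<dots> = ?A (\<tau> n (Suc k)) - ?A (\<tau> n k)"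
          by (simp add: diff_divide_distrib add_divide_distrib)
        finally show ?thesis .
      qed (use nn e_residual[OF C.coupled_paths_axioms, of n k] in simp)
      then show ?thesis using nn by simp
    qed
    have "S n \<omega> \<le> (\<Sum>k<n. ?A (\<tau> n (Suc k)) - ?A (\<tau> n k))"
      unfolding S_def by (intro sum_mono step)
    also have "\<dots> \<le> ?A T"
    proof (cases "n = 0")
      case False
      then have "(\<Sum>k<n. ?A (\<tau> n (Suc k)) - ?A (\<tau> n k)) = ?A T - ?A 0"
        unfolding \<tau>_def by (intro sum_grid_diff) simp
      then show ?thesis by (simp add: C.X.L_0 C.Y.L_0)
    qed (use A_mono[OF order_refl T(2)] C.X.L_0 C.Y.L_0 in simp)
    finally have "S n \<omega> \<le> ?A T" .
    moreover have "0 \<le> S n \<omega>" by (simp add: S_def sum_nonneg)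
    ultimately show ?case by simp
  qed
  \<comment> \<open>For a fixed path \<open>S n\<close> even vanishes from some \<open>n\<close> on,
    but that \<open>n\<close> varies with \<open>\<omega>\<close>.\<close>
  have Slim: "AE \<omega> in M. (\<lambda>n. S n \<omega>) \<longlonglongrightarrow> 0"
    using AE_paths
  proof eventually_elim
    case (elim \<omega>)
    then interpret C: coupled_paths \<beta> x y "\<lambda>t. X t \<omega>" "\<lambda>t. Y t \<omega>" "\<lambda>t. B t \<omega>" "\<lambda>t. X.L t \<omega>" "\<lambda>t. Y.L t \<omega>" .
    have "\<forall>\<^sub>F n in sequentially. S n \<omega> = 0"
      using C.eventually_residual_nonpos[OF T(1) d]
    proof eventually_elim
      case (elim n)
      have "max 0 (e n k \<omega>) = 0" if "k < n" for k
        using g01[of n k \<omega>] elim that e_residual[OF C.coupled_paths_axioms, of n k]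
        by (auto simp: D_def \<tau>_def)
      then show ?case by (simp add: S_def)
    qed
    then show ?case by (rule tendsto_eventually)
  qed
  have Ai: "integrable M (\<lambda>\<omega>. (X.L T \<omega> + Y.L T \<omega>) / sqrt d)"
    using T by (intro integrable_divide Bochner_Integration.integrable_add square_integrable_integrable
        X.L_square_integrable Y.L_square_integrable)
  have Si: "integrable M (S n)" for n
  proof (rule Bochner_Integration.integrable_bound[OF Ai SM])
    show "AE \<omega> in M. norm (S n \<omega>) \<le> norm ((X.L T \<omega> + Y.L T \<omega>) / sqrt d)"
      using Sle[of n] unfolding real_norm_def by eventually_elim (rule order_trans[OF _ abs_ge_self])
  qed
  have ES: "(\<lambda>n. expectation (S n)) \<longlonglongrightarrow> expectation (\<lambda>\<omega>. 0)"
    by (rule integral_dominated_convergence[OF _ SM Ai Slim Sle]) simp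
  let ?I = "\<lambda>\<omega>. indicator (apart N d) \<omega> * (\<bar>\<beta>\<bar> / 12 * U T \<omega>)"
  have Ii: "integrable M ?I"
  proof -
    have "integrable M (\<lambda>\<omega>. \<bar>\<beta>\<bar> / 12 * U T \<omega>)"
      using T by (intro integrable_mult_right square_integrable_integrable U_square_integrable)
    from integrable_real_mult_indicator[OF apart_sets this] show ?thesis by (simp add: mult.commute)
  qed
  have bound: "expectation ?I \<le> 2 * sqrt (y - x) + expectation (S n)" if n: "0 < n" for n
  proof -
    let ?m = "\<lambda>\<omega>. \<Sum>k<n. u n k \<omega> * (W (\<tau> n (Suc k)) \<omega> - W (\<tau> n k) \<omega>)"
    have "expectation ?I \<le> expectation (\<lambda>\<omega>. (2 * sqrt (y - x) - ?m \<omega>) + S n \<omega>)"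
    proof (rule integral_mono_AE[OF Ii])
      show "integrable M (\<lambda>\<omega>. (2 * sqrt (y - x) - ?m \<omega>) + S n \<omega>)"
        using ui Si by (intro Bochner_Integration.integrable_add Bochner_Integration.integrable_diff
            Bochner_Integration.integrable_sum integrable_const)
      show "AE \<omega> in M. ?I \<omega> \<le> (2 * sqrt (y - x) - ?m \<omega>) + S n \<omega>"
        using AE_paths
      proof eventually_elim
        case (elim \<omega>)
        then interpret C: coupled_paths \<beta> x y "\<lambda>t. X t \<omega>" "\<lambda>t. Y t \<omega>" "\<lambda>t. B t \<omega>" "\<lambda>t. X.L t \<omega>" "\<lambda>t. Y.L t \<omega>" .
        have RD: "\<bar>\<beta> * R t \<omega>\<bar> \<le> D t \<omega>" if "0 \<le> D t \<omega>" for t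
        proof -
          have "\<bar>R t \<omega>\<bar> \<le> D t \<omega>" using that by (auto simp: R_def D_def)
          then have "\<bar>\<beta>\<bar> * \<bar>R t \<omega>\<bar> \<le> 1 * D t \<omega>" using beta_le by (intro mult_mono) auto
          then show ?thesis by (simp add: abs_mult)
        qed
        \<comment> \<open>The correction costs at most half of \<open>sqrt D\<close>, so
          \<open>Z\<close> is bounded below by its \<open>U\<close> term while
          \<open>D > 0\<close>.\<close>
        have half: "\<bar>\<beta> * R t \<omega> / (2 * sqrt (D t \<omega>))\<bar> \<le> sqrt (D t \<omega>) / 2" if "0 < D t \<omega>" for t
        proof -
          have "\<bar>\<beta> * R t \<omega> / (2 * sqrt (D t \<omega>))\<bar> = \<bar>\<beta> * R t \<omega>\<bar> / (2 * sqrt (D t \<omega>))"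
            using that by (simp add: abs_mult)
          also have "\<dots> \<le> (sqrt (D t \<omega>) * sqrt (D t \<omega>)) / (2 * sqrt (D t \<omega>))"
            using RD[of t] that by (intro divide_right_mono) auto
          also have "\<dots> = sqrt (D t \<omega>) / 2" using that by (simp del: real_sqrt_mult_self)
          finally show ?thesis .
        qed
        have UT: "0 \<le> U T \<omega>" using C.U_nonneg[OF T(2)] by (simp add: C.U_def U_def)
        have Zlow: "\<bar>\<beta>\<bar> / 12 * U t \<omega> \<le> Z t \<omega>" if "0 < D t \<omega>" for t
          using half[OF that] that real_sqrt_gt_zero[OF that] unfolding Z_def by linarith
        have end_bound: "?I \<omega> \<le> g n n \<omega> * Z T \<omega>"
        proof (cases "\<omega> \<in> apart N d")
          case True
          have Dj: "d \<le> D (\<tau> n j) \<omega>" if "j \<le> n" for j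
          proof -
            have "d \<le> Y (grid 0 (real N) n j) \<omega> - X (grid 0 (real N) n j) \<omega> \<or> n < j"
              using True unfolding apart_def by blast
            then show ?thesis using that by (simp add: D_def \<tau>_def T_def)
          qed
          then have "g n n \<omega> = 1" by (simp add: g_def)
          moreover have "0 < D T \<omega>" using Dj[of n] d n by (simp add: \<tau>_def)
          ultimately show ?thesis using True Zlow[of T] by simp
        next
          case False
          have "0 \<le> Z T \<omega>" if "g n n \<omega> = 1"
          proof -
            have "0 < D T \<omega>" using g01[of n n \<omega>] that d n by (simp add: \<tau>_def)
            moreover have "0 \<le> \<bar>\<beta>\<bar> / 12 * U T \<omega>" using UT by simp
            ultimately show ?thesis using Zlow[of T] by linarith
          qed
          then show ?thesis using False g01[of n n \<omega>] by auto
        qed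
        have D0: "D 0 \<omega> = y - x" by (simp add: D_def C.X.X_0 C.Y.X_0)
        have U0: "U 0 \<omega> = sqrt (y - x)" by (simp add: U_def C.X.L_0 C.Y.L_0)
        \<comment> \<open>The three summands are at most 1, \<open>1 / 2\<close> and
          \<open>1 / 12\<close> times \<open>sqrt (y - x)\<close>.\<close>
        have start_bound: "g n 0 \<omega> * Z (\<tau> n 0) \<omega> \<le> 2 * sqrt (y - x)"
        proof -
          have "\<bar>\<beta>\<bar> / 12 * sqrt (y - x) \<le> 1 / 12 * sqrt (y - x)"
            using beta_le xy by (intro mult_right_mono) auto
          then have "Z 0 \<omega> \<le> 2 * sqrt (y - x)"
            using half[of 0] xy real_sqrt_gt_zero[of "y - x"] unfolding Z_def D0 U0 by linarith
          moreover have "\<tau> n 0 = 0" by (simp add: \<tau>_def)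
          ultimately show ?thesis using g01[of n 0 \<omega>] xy by auto
        qed
        have "g n n \<omega> * Z (\<tau> n n) \<omega> - g n 0 \<omega> * Z (\<tau> n 0) \<omega> =
            (\<Sum>k<n. g n (Suc k) \<omega> * Z (\<tau> n (Suc k)) \<omega> - g n k \<omega> * Z (\<tau> n k) \<omega>)"
          by (rule sum_lessThan_telescope[symmetric])
        also have "\<dots> = (\<Sum>k<n. e n k \<omega>) - ?m \<omega>"
          by (simp add: e_def sum_subtractf[symmetric])
        also have "(\<Sum>k<n. e n k \<omega>) \<le> S n \<omega>" unfolding S_def by (intro sum_mono) simp
        finally have "g n n \<omega> * Z (\<tau> n n) \<omega> - g n 0 \<omega> * Z (\<tau> n 0) \<omega> \<le> S n \<omega> - ?m \<omega>" by simp
        moreover have "\<tau> n n = T" using n by (simp add: \<tau>_def)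
        ultimately show ?case using end_bound start_bound by simp
      qed
    qed
    also have "\<dots> = 2 * sqrt (y - x) + expectation (S n)"
      using ui u0 Si by (simp add: prob_space)
    finally show ?thesis .
  qed
  have "(\<lambda>n. 2 * sqrt (y - x) + expectation (S n)) \<longlonglongrightarrow> 2 * sqrt (y - x) + 0"
    using ES by (intro tendsto_add tendsto_const) simp
  then have "expectation ?I \<le> 2 * sqrt (y - x) + 0"
    by (rule tendsto_lowerbound[OF _ eventually_mono[OF eventually_gt_at_top[of 0] bound]]) auto
  then show ?thesis by (simp add: T_def)
qed

text \<open>Markov's inequality: where the local time of \<open>X\<close> exceeds \<open>K\<close>,
  \<open>U\<close> is at least \<open>sqrt (\<bar>\<beta>\<bar> * K)\<close>. The factor 24 is the 2
  of \<open>lyapunov_bound\<close> times the 12 in front of \<open>U\<close>.\<close>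

lemma prob_apart_le:
  assumes N: "0 < N" and d: "0 < d" and K: "0 < K"
  shows "prob (apart N d) \<le> prob {\<omega> \<in> space M. X.L (real N) \<omega> \<le> K}
    + 24 * sqrt (y - x) / (\<bar>\<beta>\<bar> * sqrt (\<bar>\<beta>\<bar> * K))"
proof -
  let ?S = "{\<omega> \<in> space M. X.L (real N) \<omega> \<le> K}"
  define c where "c = \<bar>\<beta>\<bar> / 12 * sqrt (\<bar>\<beta>\<bar> * K)"
  have c: "0 < c" using X.\<beta> K by (simp add: c_def)
  have [measurable]: "X.L (real N) \<in> borel_measurable M" by (rule X.L_measurable) simp
  let ?I = "\<lambda>\<omega>. indicator (apart N d) \<omega> * (\<bar>\<beta>\<bar> / 12 * U (real N) \<omega>)"
  have Ii: "integrable M ?I"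
  proof -
    have "integrable M (\<lambda>\<omega>. \<bar>\<beta>\<bar> / 12 * U (real N) \<omega>)"
      by (intro integrable_mult_right square_integrable_integrable U_square_integrable) simp
    from integrable_real_mult_indicator[OF apart_sets this] show ?thesis by (simp add: mult.commute)
  qed
  have sum_int: "integrable M (indicator ?S :: _ \<Rightarrow> real)" "integrable M (\<lambda>\<omega>. ?I \<omega> / c)"
    using integrable_divide[OF Ii] by (auto simp: emeasure_eq_measure)
  have "prob (apart N d) = expectation (indicator (apart N d))" by simp
  also have "\<dots> \<le> expectation (\<lambda>\<omega>. indicator ?S \<omega> + ?I \<omega> / c)"
  proof (rule integral_mono_AE)
    show "AE \<omega> in M. indicator (apart N d) \<omega> \<le> indicator ?S \<omega> + ?I \<omega> / c"
      using AE_paths AE_space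
    proof eventually_elim
      case (elim \<omega>)
      then interpret C: coupled_paths \<beta> x y "\<lambda>t. X t \<omega>" "\<lambda>t. Y t \<omega>" "\<lambda>t. B t \<omega>" "\<lambda>t. X.L t \<omega>" "\<lambda>t. Y.L t \<omega>"
        by simp
      have U0: "0 \<le> U (real N) \<omega>" using C.U_nonneg[of "real N"] by (simp add: C.U_def U_def)
      show ?case
      proof (cases "\<omega> \<in> apart N d \<and> K < X.L (real N) \<omega>")
        case True
        have "\<bar>\<beta>\<bar> * K \<le> \<bar>\<beta>\<bar> * (X.L (real N) \<omega> + Y.L (real N) \<omega>)"
          using True C.Y.L_nonneg[of "real N"] by (intro mult_left_mono) auto
        then have "sqrt (\<bar>\<beta>\<bar> * K) \<le> U (real N) \<omega>" unfolding U_def using xy by simp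
        then have "c \<le> \<bar>\<beta>\<bar> / 12 * U (real N) \<omega>" unfolding c_def by (intro mult_left_mono) auto
        then have "1 \<le> ?I \<omega> / c" using True c by simp
        then show ?thesis using True by (simp add: indicator_def)
      next
        case False
        have "0 \<le> ?I \<omega> / c" using U0 c by simp
        then show ?thesis using False elim(2) by (auto simp: indicator_def)
      qed
    qed
    show "integrable M (\<lambda>\<omega>. indicator ?S \<omega> + ?I \<omega> / c)"
      by (rule Bochner_Integration.integrable_add[OF sum_int])
  qed (simp add: emeasure_eq_measure)
  also have "\<dots> = prob ?S + expectation ?I / c"
    by (subst Bochner_Integration.integral_add[OF sum_int]) simp
  also have "\<dots> \<le> prob ?S + 2 * sqrt (y - x) / c"
    using lyapunov_bound[OF N d] c by (intro add_left_mono divide_right_mono) auto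
  also have "2 * sqrt (y - x) / c = 24 * sqrt (y - x) / (\<bar>\<beta>\<bar> * sqrt (\<bar>\<beta>\<bar> * K))"
    by (simp add: c_def)
  finally show ?thesis .
qed

text \<open>The limits are taken in this order: \<open>d\<close> to 0 by continuity along increasing
  events, \<open>N\<close> to infinity to remove the first term of \<open>prob_apart_le\<close> by
  \<open>local_time_unbounded\<close>, and \<open>K\<close> to infinity to remove the second, which
  depends on neither \<open>d\<close> nor \<open>N\<close>.\<close>

lemma apart_null: "(\<Inter>N. \<Union>j. apart N (1 / real (Suc j))) \<in> null_sets M"
proof -
  let ?A = "\<lambda>N. \<Union>j. apart N (1 / real (Suc j))"
  have ev: "(\<Inter>N. ?A N) \<in> events" by measurable
  have le: "prob (\<Inter>N. ?A N) \<le> prob {\<omega> \<in> space M. X.L (real N) \<omega> \<le> K}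
    + 24 * sqrt (y - x) / (\<bar>\<beta>\<bar> * sqrt (\<bar>\<beta>\<bar> * K))" if N: "0 < N" and K: "0 < K" for N K
  proof -
    have "(\<lambda>j. prob (apart N (1 / real (Suc j)))) \<longlonglongrightarrow> prob (?A N)"
    proof (rule finite_Lim_measure_incseq)
      show "incseq (\<lambda>j. apart N (1 / real (Suc j)))"
      proof (rule incseq_SucI)
        fix j
        have "1 / real (Suc (Suc j)) \<le> 1 / real (Suc j)" by (simp add: frac_le)
        then show "apart N (1 / real (Suc j)) \<subseteq> apart N (1 / real (Suc (Suc j)))"
          unfolding apart_def by (auto intro: order_trans)
      qed
    qed auto
    then have "prob (?A N) \<le> prob {\<omega> \<in> space M. X.L (real N) \<omega> \<le> K}
        + 24 * sqrt (y - x) / (\<bar>\<beta>\<bar> * sqrt (\<bar>\<beta>\<bar> * K))"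
      by (rule LIMSEQ_le_const2) (use prob_apart_le[OF N _ K] in auto)
    moreover have "prob (\<Inter>N. ?A N) \<le> prob (?A N)"
      by (rule finite_measure_mono) auto
    ultimately show ?thesis by simp
  qed
  have le2: "prob (\<Inter>N. ?A N) \<le> 24 * sqrt (y - x) / (\<bar>\<beta>\<bar> * sqrt (\<bar>\<beta>\<bar> * K))" if K: "0 < K" for K
  proof -
    have "(\<lambda>N. prob {\<omega> \<in> space M. X.L (real N) \<omega> \<le> K} + 24 * sqrt (y - x) / (\<bar>\<beta>\<bar> * sqrt (\<bar>\<beta>\<bar> * K)))
        \<longlonglongrightarrow> 0 + 24 * sqrt (y - x) / (\<bar>\<beta>\<bar> * sqrt (\<bar>\<beta>\<bar> * K))"
      by (intro tendsto_add X.local_time_unbounded tendsto_const)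
    then show ?thesis
      using tendsto_lowerbound[OF _ eventually_mono[OF eventually_gt_at_top[of 0] le[OF _ K]]] by fastforce
  qed
  have "((\<lambda>K. 24 * sqrt (y - x) / (\<bar>\<beta>\<bar> * sqrt (\<bar>\<beta>\<bar> * K))) \<longlongrightarrow> 0) at_top"
    using X.\<beta> by real_asymp
  then have "prob (\<Inter>N. ?A N) \<le> 0"
    by (rule tendsto_lowerbound[OF _ eventually_mono[OF eventually_gt_at_top[of 0] le2]]) auto
  then have "prob (\<Inter>N. ?A N) = 0" using measure_nonneg[of M] by (simp add: order_antisym)
  then show ?thesis using ev by (simp add: null_sets_def emeasure_eq_measure)
qed

text \<open>If the paths never meet, the intermediate value theorem keeps \<open>D\<close> positive,
  and by compactness it is bounded away from 0 on each \<open>[0, N]\<close>. This puts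
  \<open>\<omega>\<close> into the null set of \<open>apart_null\<close>.\<close>

lemma coalescence: "AE \<omega> in M. \<exists>t\<ge>0. X t \<omega> = Y t \<omega>"
  using AE_paths AE_not_in[OF apart_null] AE_space
proof eventually_elim
  case (elim \<omega>)
  then interpret C: coupled_paths \<beta> x y "\<lambda>t. X t \<omega>" "\<lambda>t. Y t \<omega>" "\<lambda>t. B t \<omega>" "\<lambda>t. X.L t \<omega>" "\<lambda>t. Y.L t \<omega>"
    by simp
  show ?case
  proof (rule ccontr)
    assume "\<not> ?thesis"
    then have ne: "X t \<omega> \<noteq> Y t \<omega>" if "0 \<le> t" for t using that by blast
    have cont: "continuous_on {0..T} (\<lambda>t. Y t \<omega> - X t \<omega>)" for T
      using C.X.cont(1)[OF order_refl] C.Y.cont(1)[OF order_refl] by (intro continuous_on_diff)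
    have pos: "0 < Y t \<omega> - X t \<omega>" if t: "0 \<le> t" for t
    proof (rule ccontr)
      assume "\<not> 0 < Y t \<omega> - X t \<omega>"
      then have "\<exists>s\<ge>0. s \<le> t \<and> Y s \<omega> - X s \<omega> = 0"
        using t cont[of t] C.xy by (intro IVT2') (auto simp: C.X.X_0 C.Y.X_0)
      then show False using ne by force
    qed
    have "\<omega> \<in> (\<Union>j. apart N (1 / real (Suc j)))" for N
    proof -
      obtain v where v: "v \<in> {0..real N}"
        "\<And>t. t \<in> {0..real N} \<Longrightarrow> Y v \<omega> - X v \<omega> \<le> Y t \<omega> - X t \<omega>"
        using continuous_attains_inf[OF _ _ cont[of "real N"]] by auto
      obtain j where "1 / real (Suc j) < Y v \<omega> - X v \<omega>"
        using pos[of v] v(1) reals_Archimedean[of "Y v \<omega> - X v \<omega>"] by (auto simp: inverse_eq_divide)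
      moreover have "Y v \<omega> - X v \<omega> \<le> Y (grid 0 (real N) n k) \<omega> - X (grid 0 (real N) n k) \<omega>"
        if "k \<le> n" for n k
        using that by (intro v(2)) (auto intro: grid_ge grid_le)
      ultimately have "1 / real (Suc j) \<le> Y (grid 0 (real N) n k) \<omega> - X (grid 0 (real N) n k) \<omega> \<or> n < k" for n k
        by (metis less_imp_le not_less order_trans)
      then have "\<omega> \<in> apart N (1 / real (Suc j))"
        unfolding apart_def using elim(3) by blast
      then show ?thesis by blast
    qed
    then show False using elim(2) by blast
  qed
qed

end

theorem mainTheorem1:
  fixes M :: "'w measure" and F :: "real \<Rightarrow> 'w measure"
    and B X Y Lx Ly :: "real \<Rightarrow> 'w \<Rightarrow> real"
    and \<beta> x y :: real
  assumes "\<beta> \<in> {-1..1} - {0}"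
    and "brownian_motion M F B"
    and "skew_brownian_motion M F B \<beta> x X Lx"
    and "skew_brownian_motion M F B \<beta> y Y Ly"
  shows "AE \<omega> in M. \<exists>t\<ge>0. X t \<omega> = Y t \<omega>"
proof -
  have \<beta>: "\<beta> \<noteq> 0" "\<bar>\<beta>\<bar> \<le> 1" using assms(1) by auto
  have X: "skew_process M F B \<beta> x X Lx" and Y: "skew_process M F B \<beta> y Y Ly"
    using assms \<beta> by (auto simp: skew_process_def skew_process_axioms_def)
  consider "x = y" | "x < y" | "y < x" by linarith
  then show ?thesis
  proof cases
    case 1
    show ?thesis
      using skew_process.AE_path[OF X] skew_process.AE_path[OF Y]
    proof eventually_elim
      case (elim \<omega>)
      then have "X 0 \<omega> = Y 0 \<omega>"
        using 1 skew_path.X_0[OF elim(1)] skew_path.X_0[OF elim(2)] by simp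
      then show ?case by auto
    qed
  next
    case 2
    then have "coupled_processes M F B \<beta> x y X Y Lx Ly"
      using assms(2) X Y \<beta> by (simp add: coupled_processes_def coupled_processes_axioms_def)
    then show ?thesis by (rule coupled_processes.coalescence)
  next
    case 3
    then have "coupled_processes M F B \<beta> y x Y X Ly Lx"
      using assms(2) X Y \<beta> by (simp add: coupled_processes_def coupled_processes_axioms_def)
    from coupled_processes.coalescence[OF this] show ?thesis by (simp add: eq_commute)
  qed
qed

end
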